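(* Let $X=\Gamma^4(1/4)$ and $Y=\pi^{-1}$. For all positive integers $a$ and $m$ with $a-2m>0$ and $a-2m\equiv 1 \pmod{4}$, the integral \[ \int_0^\infty \frac{x^{a}\, dx}{(\cos x-\cosh x)^{m}} \] belongs to $\mathbb{Q}[X,Y]$; more precisely, it equals a finite sum $\sum c_{\alpha,\beta} X^\alpha Y^\beta$ with $c_{\alpha,\beta}\in\mathbb{Q}$, in which every exponent $\alpha$ of $X$ is even and satisfies $(a+3)/2-m\le \alpha\le (a-1)/2+m$, and every exponent $\beta$ of $Y$ satisfies $(a+3)/2-m\le \beta\le (a-5)/2+3m$.
   Context: $\Gamma$ denotes Euler's gamma function. *)

theory Defs
  imports "HOL-Analysis.Analysis"
begin

text \<open>The subring \<open>\<rat>[x, y]\<close> of the reals: all values at \<open>(x, y)\<close> of polynomials in two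
  variables with rational coefficients.\<close>

definition rat_poly_ring2 :: "real \<Rightarrow> real \<Rightarrow> real set" where
  "rat_poly_ring2 x y =
     {(\<Sum>(i, j)\<in>S. of_rat (c i j) * x ^ i * y ^ j) | (S :: (nat \<times> nat) set) (c :: nat \<Rightarrow> nat \<Rightarrow> rat).
        finite S}"

end

theory Submission
  imports Defs "HOL-Complex_Analysis.Complex_Analysis"
begin

text \<open>Up to constants, \<open>cos x - cosh x\<close> is the product of \<open>sin ((1 + \<i>) x / 2)\<close> and \<open>sin ((1 - \<i>) x / 2)\<close>, so
  its inverse \<open>m\<close>-th power is a double negative binomial series in exponentials. Integrating termwise
  gives a sum of \<open>P(J) P(K) / (J - \<i> K) ^ (a + 1)\<close> over positive \<open>J, K\<close> of the parity of \<open>m\<close>, where \<open>P\<close> is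
  a polynomial of degree \<open>m - 1\<close>. Since \<open>a - 2 m\<close> is 1 modulo 4, the summand is invariant under
  multiplication by \<open>\<i>\<close>, so the quadrant sum is a quarter of a full lattice sum, that is, a
  combination over \<open>\<rat>(\<i>)\<close> of the sums of \<open>cnj p ^ t / p ^ b\<close> over the nonzero Gaussian integers.

  Damerell's theorem evaluates the latter as rational multiples of \<open>w ^ (t + b) / pi ^ t\<close>. By
  Legendre's relation \<open>\<zeta>(z + q) = \<zeta>(z) + pi * cnj q\<close>, the coefficients of \<open>\<sigma>(z + u) / (\<sigma>(z) \<sigma>(u))\<close>
  in powers of \<open>u\<close> have the same quasi-periodicity as the sums of \<open>cnj p ^ t / (z - p) ^ b\<close>, so by
  Liouville's theorem both have proportional derivatives; the Taylor coefficients at \<open>0\<close> of the former are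
  rational multiples of powers of \<open>w\<close> because \<open>\<wp>'' = 6 \<wp>\<^sup>2 - 2 w\<^sup>4\<close>. Here \<open>w = B(1/4, 1/2) / 2\<close>, whose fourth power is
  \<open>X\<^sup>2 Y\<^sup>2 / 64\<close>. Each lattice sum is thus a rational multiple of a single monomial in \<open>X\<close> and \<open>Y\<close>,
  which gives the bounds on the exponents.\<close>


section \<open>Sums over the Gaussian integers\<close>

text \<open>The sums converge absolutely only for \<open>b \<ge> t + 3\<close>, and for
  \<open>t > 0\<close> the factor \<open>cnj p ^ t\<close> prevents reading them off as Taylor
  coefficients of an elliptic function. Replacing \<open>p ^ b\<close> by \<open>(z - p) ^ b\<close>
  gives functions holomorphic off the lattice, but translation by \<open>q\<close> mixes each with
  those of smaller \<open>t\<close>, polynomially in \<open>cnj q\<close>. Kronecker's function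
  obeys the same law because \<open>zeta\<close> has quasi-periods \<open>pi * cnj q\<close>. By
  induction on \<open>t\<close> the difference of the two families is periodic and thus constant,
  and one further derivative removes the constant; hence the comparison of derivatives of high
  order. Rationality needs a single parameter: symmetry under \<open>\<i>\<close> kills
  \<open>g\<^sub>3\<close>, so \<open>g2c\<close> determines every coefficient. The scale
  \<open>w\<close> is fixed by \<open>wp (1/2) = w\<^sup>2\<close>, and inverting \<open>wp\<close>
  on the interval from 0 to 1/2 yields the Beta integral. The sum for \<open>(t, b)\<close> gives
  \<open>X\<close> the exponent \<open>(t + b) / 2\<close> and \<open>Y\<close> the exponent
  \<open>t + (t + b) / 2\<close>. Only \<open>4 dvd (t + b)\<close> contributes, so the first is
  even. With \<open>b = a + 1 - s\<close> and \<open>s + t \<le> 2 * m - 2\<close> all four bounds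
  follow.\<close>

definition gauss :: "complex set" where
  "gauss = {z. Re z \<in> \<int> \<and> Im z \<in> \<int>}"

abbreviation gauss' :: "complex set" where
  "gauss' \<equiv> gauss - {0}"

lemma gauss_0 [simp, intro]: "0 \<in> gauss"
  and gauss_1 [simp, intro]: "1 \<in> gauss"
  and gauss_ii [simp, intro]: "\<i> \<in> gauss"
  by (auto simp: gauss_def)

lemma gauss_add [intro]: "p \<in> gauss \<Longrightarrow> q \<in> gauss \<Longrightarrow> p + q \<in> gauss"
  and gauss_diff [intro]: "p \<in> gauss \<Longrightarrow> q \<in> gauss \<Longrightarrow> p - q \<in> gauss"
  and gauss_mult [intro]: "p \<in> gauss \<Longrightarrow> q \<in> gauss \<Longrightarrow> p * q \<in> gauss"
  and gauss_of_int [intro, simp]: "of_int n \<in> gauss"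
  by (auto simp: gauss_def)

lemma gauss_uminus_iff [simp]: "- p \<in> gauss \<longleftrightarrow> p \<in> gauss"
  and gauss_cnj_iff [simp]: "cnj p \<in> gauss \<longleftrightarrow> p \<in> gauss"
  and gauss_ii_mult_iff [simp]: "\<i> * p \<in> gauss \<longleftrightarrow> p \<in> gauss"
  by (auto simp: gauss_def minus_in_Ints_iff)

lemma gauss_add_iff [simp]: "q \<in> gauss \<Longrightarrow> z + q \<in> gauss \<longleftrightarrow> z \<in> gauss"
  and gauss_diff_iff [simp]: "q \<in> gauss \<Longrightarrow> z - q \<in> gauss \<longleftrightarrow> z \<in> gauss"
  by (metis add_diff_cancel_right' gauss_add gauss_diff) (metis diff_add_cancel gauss_add gauss_diff)

lemma bij_betw_gauss: "bij_betw (\<lambda>(m, n). Complex (of_int m) (of_int n)) UNIV gauss"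
proof (rule bij_betwI')
  fix p assume "p \<in> gauss"
  then obtain m n where "Re p = of_int m" "Im p = of_int n"
    by (auto simp: gauss_def elim!: Ints_cases)
  then show "\<exists>x\<in>UNIV. p = (case x of (m, n) \<Rightarrow> Complex (of_int m) (of_int n))"
    by (intro bexI[of _ "(m, n)"]) (auto simp: complex_eq_iff)
qed (auto simp: gauss_def)

lemma countable_gauss: "countable gauss"
  using countable_image[OF countableI_type] bij_betw_imp_surj_on[OF bij_betw_gauss] by metis

lemma norm_gauss_ge_1:
  assumes "p \<in> gauss'"
  shows "norm p \<ge> 1"
proof -
  have "\<bar>Re p\<bar> \<ge> 1 \<or> \<bar>Im p\<bar> \<ge> 1"
    using assms Ints_nonzero_abs_ge1[of "Re p"] Ints_nonzero_abs_ge1[of "Im p"]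
    by (auto simp: gauss_def complex_eq_iff)
  then show ?thesis
    using abs_Re_le_cmod[of p] abs_Im_le_cmod[of p] by linarith
qed

lemma closed_gauss: "A \<subseteq> gauss \<Longrightarrow> closed A"
proof (rule discrete_imp_closed[of 1]; (intro ballI impI)?)
  fix x y assume "A \<subseteq> gauss" "x \<in> A" "y \<in> A" "dist y x < 1"
  then show "y = x"
    using norm_gauss_ge_1[of "y - x"] gauss_diff[of y x] by (auto simp: dist_norm)
qed auto

lemma open_compl_gauss [simp, intro]: "open (- gauss)" "open (- gauss')"
  by (simp_all only: open_closed double_complement) (rule closed_gauss; blast)+

lemma connected_compl_gauss: "connected (- gauss)"
  using connected_open_diff_countable[of "UNIV :: complex set" gauss] countable_gauss
  by (simp add: Compl_eq_Diff_UNIV connected_UNIV)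

lemma deriv_cong_open:
  fixes f :: "complex \<Rightarrow> complex"
  assumes "open S" "z \<in> S" "\<And>y. y \<in> S \<Longrightarrow> f y = g y"
  shows "deriv f z = deriv g z"
proof (rule deriv_cong_ev)
  show "\<forall>\<^sub>F y in nhds z. f y = g y"
    using eventually_nhds_in_open[OF assms(1,2)] by eventually_elim (rule assms(3))
qed auto

lemma ball_subset_compl_gauss: "ball 0 1 \<subseteq> - gauss'"
  using norm_gauss_ge_1 by force

section \<open>Convergence and termwise differentiation of series over the lattice\<close>

lemma summable_int_powr:
  assumes "s > 1"
  shows "(\<lambda>n::int. (1 + \<bar>real_of_int n\<bar>) powr (-s)) summable_on UNIV"
proof -
  let ?f = "\<lambda>n::int. (1 + \<bar>real_of_int n\<bar>) powr (-s)"
  have "summable (\<lambda>n. of_nat n powr (-s) :: real)"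
    using assms by (subst summable_real_powr_iff) auto
  then have "summable (\<lambda>n. of_nat (Suc n) powr (-s) :: real)"
    by (subst summable_Suc_iff)
  then have nat: "(\<lambda>n::nat. (1 + real n) powr (-s)) summable_on UNIV"
    by (subst summable_on_UNIV_nonneg_real_iff) (auto simp: add_ac)
  have "?f summable_on range int"
    by (subst summable_on_reindex) (use nat in \<open>auto simp: o_def\<close>)
  moreover have "?f summable_on range (\<lambda>n. - int n)"
    by (subst summable_on_reindex) (use nat in \<open>auto simp: o_def inj_def\<close>)
  ultimately have "?f summable_on (range int \<union> range (\<lambda>n. - int n))"
    by (rule summable_on_union)
  moreover have "n \<in> range int \<union> range (\<lambda>n. - int n)" for n
    by (cases n rule: int_cases2) auto
  then have "range int \<union> range (\<lambda>n. - int n) = UNIV" by blast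
  ultimately show ?thesis by simp
qed

text \<open>Both \<open>1 + \<bar>Re p\<bar>\<close> and \<open>1 + \<bar>Im p\<bar>\<close> are at
  most \<open>2 * norm p\<close>, so \<open>1 / norm p ^ 3\<close> is at most 8 times a product of
  one-variable terms with exponent \<open>3/2 > 1\<close>. The double series of such products
  factors.\<close>

lemma summable_gauss: "(\<lambda>p. 1 / norm p ^ 3) summable_on gauss'"
proof -
  let ?f = "\<lambda>x::real. (1 + \<bar>x\<bar>) powr (-(3/2))"
  let ?F = "\<lambda>p. ?f (Re p) * ?f (Im p)"
  have s: "(\<lambda>n::int. ?f (of_int n)) summable_on UNIV"
    by (rule summable_int_powr) simp
  have "(\<lambda>(m::int, n::int). ?f (of_int m) * ?f (of_int n)) summable_on (SIGMA m:UNIV. UNIV)"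
    by (rule summable_on_SigmaI[where g = "\<lambda>m. ?f (of_int m) * (\<Sum>\<^sub>\<infinity>n::int. ?f (of_int n))"])
       (use s in \<open>auto intro!: summable_on_cmult_left has_sum_cmult_right\<close>)
  then have "?F summable_on gauss"
    by (subst summable_on_reindex_bij_betw[OF bij_betw_gauss, symmetric]) (simp add: case_prod_unfold)
  then have "?F summable_on gauss'"
    by (rule summable_on_subset) auto
  then have "(\<lambda>p. 8 * ?F p) summable_on gauss'"
    by (rule summable_on_cmult_right)
  then show ?thesis
  proof (rule summable_on_comparison_test)
    fix p :: complex assume w: "p \<in> gauss'"
    have n1: "norm p \<ge> 1" using norm_gauss_ge_1[OF w] .
    have "(1 + \<bar>Re p\<bar>) * (1 + \<bar>Im p\<bar>) \<le> (norm p + norm p) * (norm p + norm p)"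
      using n1 abs_Re_le_cmod[of p] abs_Im_le_cmod[of p] by (intro mult_mono) linarith+
    also have "\<dots> = (2 * norm p) powr 2"
      using n1 by (simp add: powr_numeral power2_eq_square)
    finally have "((1 + \<bar>Re p\<bar>) * (1 + \<bar>Im p\<bar>)) powr (3/2) \<le> ((2 * norm p) powr 2) powr (3/2)"
      by (intro powr_mono2) auto
    also have "\<dots> = (2 * norm p) powr 3"
      by (subst powr_powr) simp
    also have "\<dots> = 8 * norm p ^ 3"
      using n1 by (subst powr_numeral) (auto simp: power_mult_distrib)
    finally have le: "((1 + \<bar>Re p\<bar>) * (1 + \<bar>Im p\<bar>)) powr (3/2) \<le> 8 * norm p ^ 3" .
    have "?F p = 1 / ((1 + \<bar>Re p\<bar>) * (1 + \<bar>Im p\<bar>)) powr (3/2)"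
      by (simp only: powr_minus_divide powr_mult times_divide_times_eq mult_1)
    moreover have "1 / (8 * norm p ^ 3) \<le> 1 / ((1 + \<bar>Re p\<bar>) * (1 + \<bar>Im p\<bar>)) powr (3/2)"
    proof (intro divide_left_mono le mult_pos_pos)
      have "(1 + \<bar>Re p\<bar>) * (1 + \<bar>Im p\<bar>) > 0" by (intro mult_pos_pos) auto
      then show "((1 + \<bar>Re p\<bar>) * (1 + \<bar>Im p\<bar>)) powr (3/2) > 0"
        by (metis powr_gt_zero less_irrefl)
    qed (use n1 in auto)
    ultimately show "1 / norm p ^ 3 \<le> 8 * ?F p" by simp
  qed auto
qed

lemma higher_deriv_sum:
  assumes "\<And>i. i \<in> I \<Longrightarrow> f i holomorphic_on S" "open S" "z \<in> S"
  shows "(deriv ^^ n) (\<lambda>w. \<Sum>i\<in>I. f i w) z = (\<Sum>i\<in>I. (deriv ^^ n) (f i) z)"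
  using assms
proof (induction I rule: infinite_finite_induct)
  case (insert i I)
  then have "(deriv ^^ n) (\<lambda>w. f i w + (\<Sum>i\<in>I. f i w)) z =
      (deriv ^^ n) (f i) z + (deriv ^^ n) (\<lambda>w. \<Sum>i\<in>I. f i w) z"
    by (intro higher_deriv_add[where S = S] holomorphic_on_sum) auto
  with insert show ?case by simp
qed auto

text \<open>A cubic majorant on compact sets gives locally uniform convergence by
  \<open>summable_gauss\<close>, hence a holomorphic limit and termwise derivatives of every order.
  Both \<open>lat_sum\<close> and \<open>zeta0\<close> are treated this way.\<close>

lemma
  fixes f :: "complex \<Rightarrow> complex \<Rightarrow> complex"
  assumes "open S" and holo: "\<And>p. p \<in> gauss' \<Longrightarrow> f p holomorphic_on S"
    and bound: "\<And>C. compact C \<Longrightarrow> C \<subseteq> S \<Longrightarrow>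
      \<exists>B. \<forall>w\<in>C. \<forall>p\<in>gauss'. norm (f p w) \<le> B / norm p ^ 3"
  shows gauss_sum_holomorphic: "(\<lambda>z. \<Sum>\<^sub>\<infinity>p\<in>gauss'. f p z) holomorphic_on S"
    and gauss_sum_higher_deriv: "z \<in> S \<Longrightarrow>
      ((\<lambda>p. (deriv ^^ n) (f p) z) has_sum (deriv ^^ n) (\<lambda>z. \<Sum>\<^sub>\<infinity>p\<in>gauss'. f p z) z) gauss'"
proof -
  define F where "F = (\<lambda>z. \<Sum>\<^sub>\<infinity>p\<in>gauss'. f p z)"
  have unif: "uniform_limit C (\<lambda>X y. \<Sum>p\<in>X. f p y) F (finite_subsets_at_top gauss')"
    if C: "compact C" "C \<subseteq> S" for C
  proof -
    obtain B where B: "\<forall>w\<in>C. \<forall>p\<in>gauss'. norm (f p w) \<le> B / norm p ^ 3"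
      using bound[OF C] by blast
    have "norm (f p w) \<le> B * (1 / norm p ^ 3)" if "p \<in> gauss'" "w \<in> C" for w p
      using B that by fastforce
    then show ?thesis
      unfolding F_def
      by (rule Weierstrass_m_test_general[where M = "\<lambda>p. B * (1 / norm p ^ 3)"])
        (assumption | rule summable_on_cmult_right[OF summable_gauss])+
  qed
  have ev: "\<forall>\<^sub>F X in finite_subsets_at_top gauss'. finite X \<and> X \<subseteq> gauss'"
    by (rule eventually_finite_subsets_at_top_weakI) auto
  have holo': "\<forall>\<^sub>F X in finite_subsets_at_top gauss'. (\<lambda>y. \<Sum>p\<in>X. f p y) holomorphic_on T"
    if "T \<subseteq> S" for T
    using ev
  proof eventually_elim
    case (elim X)
    then show ?case
      using that holo by (intro holomorphic_on_sum) (meson holomorphic_on_subset subsetD)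
  qed
  have ball: "\<exists>r>0. cball z r \<subseteq> S" if "z \<in> S" for z
    using that \<open>open S\<close> open_contains_cball by blast
  show "(\<lambda>z. \<Sum>\<^sub>\<infinity>p\<in>gauss'. f p z) holomorphic_on S"
    unfolding F_def[symmetric] holomorphic_on_def
  proof
    fix z assume "z \<in> S"
    then obtain r where r: "r > 0" "cball z r \<subseteq> S" using ball by blast
    have "F holomorphic_on ball z r"
    proof (rule holomorphic_uniform_limit[OF _ unif[OF compact_cball r(2)]])
      show "\<forall>\<^sub>F X in finite_subsets_at_top gauss'. continuous_on (cball z r) (\<lambda>y. \<Sum>p\<in>X. f p y) \<and>
          (\<lambda>y. \<Sum>p\<in>X. f p y) holomorphic_on ball z r"
        using holo'[OF r(2)] by eventually_elim
          (auto intro: holomorphic_on_imp_continuous_on holomorphic_on_subset)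
    qed auto
    then show "F field_differentiable at z within S"
      using r by (meson centre_in_ball field_differentiable_at_within holomorphic_on_imp_differentiable_at open_ball)
  qed
  assume "z \<in> S"
  then obtain r where r: "r > 0" "cball z r \<subseteq> S" using ball by blast
  have sub: "ball z r \<subseteq> S" using r by (meson ball_subset_cball order_trans)
  have "((\<lambda>X. (deriv ^^ n) (\<lambda>y. \<Sum>p\<in>X. f p y) z) \<longlongrightarrow> (deriv ^^ n) F z) (finite_subsets_at_top gauss')"
    by (rule higher_deriv_complex_uniform_limit[where A = "ball z r"])
       (use r holo'[OF sub] in \<open>auto intro: uniform_limit_on_subset[OF unif[OF compact_cball r(2)]]\<close>)
  also have "?this \<longleftrightarrow> ((\<lambda>X. \<Sum>p\<in>X. (deriv ^^ n) (f p) z) \<longlongrightarrow> (deriv ^^ n) F z) (finite_subsets_at_top gauss')"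
  proof (rule filterlim_cong)
    show "\<forall>\<^sub>F X in finite_subsets_at_top gauss'.
        (deriv ^^ n) (\<lambda>y. \<Sum>p\<in>X. f p y) z = (\<Sum>p\<in>X. (deriv ^^ n) (f p) z)"
      using ev
    proof eventually_elim
      case (elim X)
      then show ?case
        using holo r \<open>z \<in> S\<close> \<open>open S\<close> by (intro higher_deriv_sum[where S = S]) auto
    qed
  qed auto
  finally show "((\<lambda>p. (deriv ^^ n) (f p) z) has_sum (deriv ^^ n) (\<lambda>z. \<Sum>\<^sub>\<infinity>p\<in>gauss'. f p z) z) gauss'"
    by (simp add: has_sum_def F_def)
qed

text \<open>Let \<open>R\<close> bound \<open>C\<close>. For \<open>norm p \<ge> 2 * R\<close> the
  triangle inequality gives the constant 1/2; for the remaining \<open>p\<close> the positive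
  distance \<open>d\<close> between \<open>C\<close> and the lattice points suffices.\<close>

lemma compact_away_gauss:
  assumes "compact C" "C \<subseteq> - gauss'"
  obtains c where "c > 0" "\<And>w p. w \<in> C \<Longrightarrow> p \<in> gauss' \<Longrightarrow> norm (w - p) \<ge> c * norm p"
proof -
  have "closed gauss'" by (rule closed_gauss) auto
  then obtain d where d: "d > 0" "\<And>w p. w \<in> C \<Longrightarrow> p \<in> gauss' \<Longrightarrow> d \<le> dist w p"
    using separate_compact_closed[of C "gauss'"] assms by blast
  obtain R where R: "R > 0" "\<And>w. w \<in> C \<Longrightarrow> norm w \<le> R"
    using compact_imp_bounded[OF assms(1)] bounded_pos by blast
  show ?thesis
  proof (rule that[of "min (1/2) (d / (2 * R))"])
    fix w p assume w: "w \<in> C" "p \<in> gauss'"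
    show "norm (w - p) \<ge> min (1/2) (d / (2 * R)) * norm p"
    proof (cases "norm p \<ge> 2 * R")
      case True
      have "norm (w - p) \<ge> norm p - norm w" by (metis norm_minus_commute norm_triangle_ineq2)
      also have "norm p - norm w \<ge> 1/2 * norm p" using True R(2)[OF w(1)] by simp
      finally show ?thesis
        by (smt (verit) min.cobounded1 mult_right_mono norm_ge_zero)
    next
      case False
      have "min (1/2) (d / (2 * R)) * norm p \<le> d / (2 * R) * (2 * R)"
        using False d(1) R(1) by (intro mult_mono) auto
      also have "\<dots> = d" using R(1) by simp
      also have "\<dots> \<le> norm (w - p)" using d(2)[OF w] by (simp add: dist_norm)
      finally show ?thesis .
    qed
  qed (use d R in auto)
qed

section \<open>The Weierstrass zeta function of the Gaussian integers\<close>

text \<open>The limit at 0 removes the singularity there, and periodicity carries this to every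
  lattice point. The resulting entire function takes all its values on the unit square, so it is
  bounded and Liouville's theorem applies.\<close>

lemma gauss_periodic_constant:
  assumes holo: "f holomorphic_on - gauss"
    and per: "\<And>z q. q \<in> gauss \<Longrightarrow> z \<notin> gauss \<Longrightarrow> f (z + q) = f z"
    and lim: "(f \<longlongrightarrow> l) (at 0)" and z: "z \<notin> gauss"
  shows "f z = l"
proof -
  define F where "F = (\<lambda>z. if z \<in> gauss then l else f z)"
  define h where "h = (\<lambda>y. if y = 0 then l else f y)"
  have "ball 0 1 - {0} \<subseteq> - gauss" using ball_subset_compl_gauss by blast
  then have "f holomorphic_on ball 0 1 - {0}" using holo holomorphic_on_subset by blast
  then have h: "h holomorphic_on ball 0 1"
    unfolding h_def by (rule removable_singularity) (auto intro: lim)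
  have shift: "F w = h (w - q)" if "q \<in> gauss" "w \<in> ball q 1" for w q
  proof (cases "w = q")
    case True
    then show ?thesis using that by (simp add: F_def h_def)
  next
    case False
    have "w - q \<in> ball 0 1" using that by (simp add: dist_norm norm_minus_commute)
    then have n: "w - q \<notin> gauss" using ball_subset_compl_gauss False by auto
    then have "w \<notin> gauss" using that by auto
    moreover have "f (w - q + q) = f (w - q)" using per[OF that(1) n] .
    ultimately show ?thesis using False by (simp add: F_def h_def)
  qed
  have "F field_differentiable at z" for z
  proof (cases "z \<in> gauss")
    case True
    have "(\<lambda>w. h (w - z)) holomorphic_on ball z 1"
      by (rule holomorphic_on_compose_gen[OF _ h, unfolded o_def])
         (auto intro!: holomorphic_intros simp: dist_norm norm_minus_commute)
    then have "F holomorphic_on ball z 1"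
      by (rule holomorphic_transform) (use shift True in auto)
    then show ?thesis by (simp add: holomorphic_on_imp_differentiable_at)
  next
    case False
    have "F holomorphic_on - gauss"
      by (rule holomorphic_transform[OF holo]) (auto simp: F_def)
    then show ?thesis using False by (simp add: holomorphic_on_imp_differentiable_at)
  qed
  then have F: "F holomorphic_on UNIV"
    by (simp add: holomorphic_on_def)
  have Fper: "F (z + q) = F z" if "q \<in> gauss" for z q
    using that per by (simp add: F_def)
  have "range F \<subseteq> F ` cbox 0 (Complex 1 1)"
  proof
    fix y assume "y \<in> range F"
    then obtain z where y: "y = F z" by auto
    define q where "q = Complex (of_int \<lfloor>Re z\<rfloor>) (of_int \<lfloor>Im z\<rfloor>)"
    have "q \<in> gauss" by (simp add: q_def gauss_def)
    then have "y = F (z - q)" using Fper[of q "z - q"] y by simp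
    moreover have "z - q \<in> cbox 0 (Complex 1 1)"
      by (auto simp: in_cbox_complex_iff q_def) linarith+
    ultimately show "y \<in> F ` cbox 0 (Complex 1 1)" by blast
  qed
  moreover have "compact (F ` cbox 0 (Complex 1 1))"
    by (intro compact_continuous_image holomorphic_on_imp_continuous_on holomorphic_on_subset[OF F]) auto
  ultimately have "bounded (range F)"
    using compact_imp_bounded bounded_subset by blast
  then have "F constant_on UNIV" using F by (rule Liouville_theorem[rotated])
  then have "F z = F 0" by (auto simp: constant_on_def)
  then show ?thesis using z by (simp add: F_def)
qed

text \<open>With the point 0 left out, the function is regular at 0, where it takes the value to be
  computed up to the sign \<open>(-1) ^ b\<close>.\<close>

definition lat_sum :: "nat \<Rightarrow> nat \<Rightarrow> complex \<Rightarrow> complex" where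
  "lat_sum t b z = (\<Sum>\<^sub>\<infinity>p\<in>gauss'. cnj p ^ t / (z - p) ^ b)"

text \<open>The usual summand \<open>1 / (z - p) + 1 / p + z / p ^ 2\<close> of the Weierstrass zeta
  function, written as one fraction to display its cubic decay.\<close>

definition zeta0 :: "complex \<Rightarrow> complex" where
  "zeta0 z = (\<Sum>\<^sub>\<infinity>p\<in>gauss'. z ^ 2 / (p ^ 2 * (z - p)))"

definition zeta :: "complex \<Rightarrow> complex" where
  "zeta z = 1 / z + zeta0 z"

lemma lat_sum_bound:
  assumes "b \<ge> t + 3" "compact C" "C \<subseteq> - gauss'"
  shows "\<exists>B. \<forall>w\<in>C. \<forall>p\<in>gauss'. norm (cnj p ^ t / (w - p) ^ b) \<le> B / norm p ^ 3"
proof -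
  obtain c where c: "c > 0" "\<And>w p. w \<in> C \<Longrightarrow> p \<in> gauss' \<Longrightarrow> norm (w - p) \<ge> c * norm p"
    using compact_away_gauss[OF assms(2,3)] by metis
  show ?thesis
  proof (intro exI ballI)
    fix w p assume w: "w \<in> C" "p \<in> gauss'"
    have n1: "norm p \<ge> 1" using norm_gauss_ge_1 w by blast
    have w0: "p \<noteq> 0" using w by simp
    have pos: "0 < c * norm p" using n1 c(1) by (intro mult_pos_pos) auto
    have "norm (cnj p ^ t / (w - p) ^ b) = norm p ^ t / norm (w - p) ^ b"
      by (simp add: norm_divide norm_power)
    also have "\<dots> \<le> norm p ^ t / (c * norm p) ^ b"
      using c(2)[OF w] pos c(1) by (intro divide_left_mono power_mono mult_pos_pos zero_less_power) auto
    also have "\<dots> = (1 / c ^ b) * (norm p ^ t / norm p ^ b)"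
      by (simp add: power_mult_distrib)
    \<comment> \<open>As \<open>norm p \<ge> 1\<close>, the exponent \<open>b\<close> may be lowered
      to \<open>t + 3\<close>, which leaves exactly cubic decay.\<close>
    also have "\<dots> \<le> (1 / c ^ b) * (norm p ^ t / norm p ^ (t + 3))"
      using n1 w0 c(1) assms(1) by (intro mult_left_mono divide_left_mono power_increasing mult_pos_pos) auto
    also have "\<dots> = (1 / c ^ b) / norm p ^ 3"
      using w0 by (simp add: power_add)
    finally show "norm (cnj p ^ t / (w - p) ^ b) \<le> (1 / c ^ b) / norm p ^ 3" .
  qed
qed

lemma zeta0_bound:
  assumes "compact C" "C \<subseteq> - gauss'"
  shows "\<exists>B. \<forall>w\<in>C. \<forall>p\<in>gauss'. norm (w ^ 2 / (p ^ 2 * (w - p))) \<le> B / norm p ^ 3"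
proof -
  obtain c where c: "c > 0" "\<And>w p. w \<in> C \<Longrightarrow> p \<in> gauss' \<Longrightarrow> norm (w - p) \<ge> c * norm p"
    using compact_away_gauss[OF assms] by metis
  obtain R where R: "R > 0" "\<And>w. w \<in> C \<Longrightarrow> norm w \<le> R"
    using compact_imp_bounded[OF assms(1)] bounded_pos by blast
  show ?thesis
  proof (intro exI ballI)
    fix w p assume w: "w \<in> C" "p \<in> gauss'"
    have n1: "norm p \<ge> 1" using norm_gauss_ge_1 w by blast
    have "norm (w ^ 2 / (p ^ 2 * (w - p))) = norm w ^ 2 / (norm p ^ 2 * norm (w - p))"
      by (simp add: norm_divide norm_power norm_mult)
    also have "\<dots> \<le> R ^ 2 / (norm p ^ 2 * (c * norm p))"
      using c(1) c(2)[OF w] w n1 R(2)[OF w(1)]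
      by (intro frac_le power_mono mult_left_mono mult_pos_pos) auto
    also have "\<dots> = (R ^ 2 / c) / norm p ^ 3"
      by (simp add: power3_eq_cube power2_eq_square)
    finally show "norm (w ^ 2 / (p ^ 2 * (w - p))) \<le> (R ^ 2 / c) / norm p ^ 3" .
  qed
qed

lemma summand_holomorphic: 
  assumes "p \<in> gauss'" 
  shows "(\<lambda>z. cnj p ^ t / (z - p) ^ b) holomorphic_on - gauss'"
    and "(\<lambda>z. z ^ 2 / (p ^ 2 * (z - p))) holomorphic_on - gauss'"
  using assms by (auto intro!: holomorphic_intros)

lemma lat_sum_holomorphic: "b \<ge> t + 3 \<Longrightarrow> lat_sum t b holomorphic_on - gauss'"
  using gauss_sum_holomorphic[OF open_compl_gauss(2) summand_holomorphic(1) lat_sum_bound]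
  by (simp add: lat_sum_def[abs_def])

lemma zeta0_holomorphic: "zeta0 holomorphic_on - gauss'"
  using gauss_sum_holomorphic[OF open_compl_gauss(2) summand_holomorphic(2) zeta0_bound]
  by (simp add: zeta0_def[abs_def])

lemma zeta_holomorphic: "zeta holomorphic_on - gauss"
  unfolding zeta_def[abs_def]
  by (auto intro!: holomorphic_intros holomorphic_on_subset[OF zeta0_holomorphic])

lemma lat_sum_higher_deriv:
  assumes "b \<ge> t + 3" "z \<in> - gauss'"
  shows "((\<lambda>p. (deriv ^^ n) (\<lambda>z. cnj p ^ t / (z - p) ^ b) z) has_sum (deriv ^^ n) (lat_sum t b) z) gauss'"
  unfolding lat_sum_def[abs_def] using assms
  by (intro gauss_sum_higher_deriv[OF open_compl_gauss(2)] summand_holomorphic lat_sum_bound)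

lemma lat_sum_has_sum:
  assumes "b \<ge> t + 3" "z \<in> - gauss'"
  shows "((\<lambda>p. cnj p ^ t / (z - p) ^ b) has_sum lat_sum t b z) gauss'"
  using lat_sum_higher_deriv[OF assms, of 0] by simp

lemma deriv_lat_sum:
  assumes "b \<ge> t + 3" "z \<in> - gauss'"
  shows "deriv (lat_sum t b) z = - of_nat b * lat_sum t (Suc b) z"
proof -
  have "((\<lambda>p. deriv (\<lambda>z. cnj p ^ t / (z - p) ^ b) z) has_sum deriv (lat_sum t b) z) gauss'"
    using lat_sum_higher_deriv[OF assms, of 1] by simp
  also have "?this \<longleftrightarrow> ((\<lambda>p. - of_nat b * (cnj p ^ t / (z - p) ^ Suc b)) has_sum deriv (lat_sum t b) z) gauss'"
  proof (intro has_sum_cong)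
    fix p assume "p \<in> gauss'"
    then have "z \<noteq> p" using assms by auto
    obtain k where k: "b = Suc k" using assms(1) by (cases b) auto
    have "((\<lambda>z. cnj p ^ t / (z - p) ^ b) has_field_derivative
       (0 * (z - p) ^ b - cnj p ^ t * (of_nat b * (z - p) ^ (b - 1))) / ((z - p) ^ b * (z - p) ^ b)) (at z)"
      by (rule derivative_eq_intros refl | use \<open>z \<noteq> p\<close> in simp)+
    moreover have "(0 * (z - p) ^ b - cnj p ^ t * (of_nat b * (z - p) ^ (b - 1))) / ((z - p) ^ b * (z - p) ^ b) =
        - of_nat b * (cnj p ^ t / (z - p) ^ Suc b)"
    proof -
      define u where "u = z - p"
      have "u \<noteq> 0" using \<open>z \<noteq> p\<close> by (simp add: u_def)
      then show ?thesis unfolding u_def[symmetric] by (simp add: k field_simps)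
    qed
    ultimately have "((\<lambda>z. cnj p ^ t / (z - p) ^ b) has_field_derivative
       - of_nat b * (cnj p ^ t / (z - p) ^ Suc b)) (at z)"
      by (simp only:)
    then show "deriv (\<lambda>z. cnj p ^ t / (z - p) ^ b) z = - of_nat b * (cnj p ^ t / (z - p) ^ Suc b)"
      by (rule DERIV_imp_deriv)
  qed
  finally have "((\<lambda>p. - of_nat b * (cnj p ^ t / (z - p) ^ Suc b)) has_sum deriv (lat_sum t b) z) gauss'" .
  moreover have "((\<lambda>p. - of_nat b * (cnj p ^ t / (z - p) ^ Suc b)) has_sum - of_nat b * lat_sum t (Suc b) z) gauss'"
    using assms by (intro has_sum_cmult_right lat_sum_has_sum) auto
  ultimately show ?thesis by (rule has_sum_unique)
qed

text \<open>The corrections \<open>1 / p + z / p ^ 2\<close> are affine in \<open>z\<close>, so two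
  derivatives leave only \<open>2 / (z - p) ^ 3\<close> of each summand.\<close>

lemma deriv2_zeta0:
  assumes "z \<in> - gauss'"
  shows "deriv (deriv zeta0) z = 2 * lat_sum 0 3 z"
proof -
  have "((\<lambda>p. (deriv ^^ 2) (\<lambda>z. z ^ 2 / (p ^ 2 * (z - p))) z) has_sum (deriv ^^ 2) zeta0 z) gauss'"
    using gauss_sum_higher_deriv[OF open_compl_gauss(2) summand_holomorphic(2) zeta0_bound assms, of 2]
    by (simp add: zeta0_def[abs_def])
  also have "?this \<longleftrightarrow> ((\<lambda>p. 2 * (cnj p ^ 0 / (z - p) ^ 3)) has_sum (deriv ^^ 2) zeta0 z) gauss'"
  proof (intro has_sum_cong)
    fix p assume w: "p \<in> gauss'"
    then have zw: "z \<noteq> p" "p \<noteq> 0" using assms by auto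
    have d1: "deriv (\<lambda>z. z ^ 2 / (p ^ 2 * (z - p))) y = 1 / p ^ 2 - 1 / (y - p) ^ 2" if "y \<noteq> p" for y
    proof -
      define u where "u = y - p"
      have u: "u \<noteq> 0" "y = u + p" using that by (simp_all add: u_def)
      have "((\<lambda>z. z ^ 2 / (p ^ 2 * (z - p))) has_field_derivative
          (2 * y * (p ^ 2 * (y - p)) - y ^ 2 * p ^ 2) / ((p ^ 2 * (y - p)) * (p ^ 2 * (y - p)))) (at y)"
        by (rule derivative_eq_intros refl | use that zw in simp)+
      then have "deriv (\<lambda>z. z ^ 2 / (p ^ 2 * (z - p))) y =
          (2 * y * (p ^ 2 * (y - p)) - y ^ 2 * p ^ 2) / ((p ^ 2 * (y - p)) * (p ^ 2 * (y - p)))"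
        by (rule DERIV_imp_deriv)
      also have "\<dots> = 1 / p ^ 2 - 1 / (y - p) ^ 2"
        unfolding u(2) using u(1) zw(2) by (simp add: field_simps power2_eq_square)
      finally show ?thesis .
    qed
    have "deriv (deriv (\<lambda>z. z ^ 2 / (p ^ 2 * (z - p)))) z = deriv (\<lambda>y. 1 / p ^ 2 - 1 / (y - p) ^ 2) z"
      by (rule deriv_cong_open[of "- {p}"]) (use d1 zw in auto)
    also have "\<dots> = 2 / (z - p) ^ 3"
    proof (rule DERIV_imp_deriv)
      have "((\<lambda>y. 1 / p ^ 2 - 1 / (y - p) ^ 2) has_field_derivative
          - (- (2 * (z - p)) / ((z - p) ^ 2 * (z - p) ^ 2))) (at z)"
        by (rule derivative_eq_intros refl | use zw in simp)+
      moreover have "- (- (2 * u) / (u ^ 2 * u ^ 2)) = 2 / u ^ 3" if "u \<noteq> 0" for u :: complex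
        using that by (simp add: power2_eq_square power3_eq_cube)
      ultimately show "((\<lambda>y. 1 / p ^ 2 - 1 / (y - p) ^ 2) has_field_derivative 2 / (z - p) ^ 3) (at z)"
        using zw by (metis right_minus_eq)
    qed
    finally show "(deriv ^^ 2) (\<lambda>z. z ^ 2 / (p ^ 2 * (z - p))) z = 2 * (cnj p ^ 0 / (z - p) ^ 3)"
      by (simp add: numeral_2_eq_2)
  qed
  finally have "((\<lambda>p. 2 * (cnj p ^ 0 / (z - p) ^ 3)) has_sum (deriv ^^ 2) zeta0 z) gauss'" .
  moreover have "((\<lambda>p. 2 * (cnj p ^ 0 / (z - p) ^ 3)) has_sum 2 * lat_sum 0 3 z) gauss'"
    using assms by (intro has_sum_cmult_right lat_sum_has_sum) auto
  ultimately have "(deriv ^^ 2) zeta0 z = 2 * lat_sum 0 3 z" by (rule has_sum_unique)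
  then show ?thesis by (simp add: numeral_2_eq_2)
qed

section \<open>Quasi-periods\<close>

lemma has_sum_finite_sum:
  fixes f :: "'i \<Rightarrow> 'a \<Rightarrow> 'b :: {comm_monoid_add, topological_comm_monoid_add, t2_space}"
  assumes "\<And>i. i \<in> I \<Longrightarrow> (f i has_sum s i) A"
  shows "((\<lambda>x. \<Sum>i\<in>I. f i x) has_sum (\<Sum>i\<in>I. s i)) A"
  using assms by (induction I rule: infinite_finite_induct) (auto intro: has_sum_add)

text \<open>The term \<open>0 ^ t / z ^ b\<close> is the contribution of the lattice point \<open>0\<close>: it is \<open>1 / z ^ b\<close> for
  \<open>t = 0\<close> and vanishes otherwise.\<close>

definition lat_full :: "nat \<Rightarrow> nat \<Rightarrow> complex \<Rightarrow> complex" where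
  "lat_full t b z = 0 ^ t / z ^ b + lat_sum t b z"

lemma lat_full_has_sum:
  assumes "b \<ge> t + 3" "z \<notin> gauss"
  shows "((\<lambda>p. cnj p ^ t / (z - p) ^ b) has_sum lat_full t b z) gauss"
proof -
  have "((\<lambda>p. cnj p ^ t / (z - p) ^ b) has_sum (cnj 0 ^ t / (z - 0) ^ b + lat_sum t b z)) (insert 0 gauss')"
    by (rule has_sum_insert) (use assms in \<open>auto intro!: lat_sum_has_sum\<close>)
  moreover have "insert 0 gauss' = gauss" by auto
  ultimately show ?thesis by (simp add: lat_full_def)
qed

text \<open>Moving the summation index by \<open>q\<close> turns \<open>cnj p ^ t\<close> into
  \<open>(cnj p + cnj q) ^ t\<close>, which the binomial theorem expands. For \<open>t = 0\<close>
  this is plain periodicity.\<close>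

lemma lat_full_shift:
  assumes "b \<ge> t + 3" "z \<notin> gauss" "q \<in> gauss"
  shows "lat_full t b (z + q) = (\<Sum>j\<le>t. of_nat (t choose j) * cnj q ^ (t - j) * lat_full j b z)"
proof -
  have "z + q \<notin> gauss" using assms by simp
  have "((\<lambda>p. cnj p ^ t / (z + q - p) ^ b) has_sum lat_full t b (z + q)) gauss"
    by (rule lat_full_has_sum) fact+
  also have "?this \<longleftrightarrow> ((\<lambda>p. (cnj p + cnj q) ^ t / (z - p) ^ b) has_sum lat_full t b (z + q)) gauss"
    by (rule has_sum_reindex_bij_witness[of _ "\<lambda>p. p + q" "\<lambda>p. p - q"])
       (use assms in \<open>auto simp: algebra_simps\<close>)
  also have "\<dots> \<longleftrightarrow> ((\<lambda>p. \<Sum>j\<le>t. of_nat (t choose j) * cnj q ^ (t - j) * (cnj p ^ j / (z - p) ^ b)) has_sum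
      lat_full t b (z + q)) gauss"
    by (intro has_sum_cong) (simp add: binomial_ring sum_divide_distrib mult_ac)
  finally show ?thesis
  proof (rule has_sum_unique)
    show "((\<lambda>p. \<Sum>j\<le>t. of_nat (t choose j) * cnj q ^ (t - j) * (cnj p ^ j / (z - p) ^ b)) has_sum
        (\<Sum>j\<le>t. of_nat (t choose j) * cnj q ^ (t - j) * lat_full j b z)) gauss"
      by (intro has_sum_finite_sum has_sum_cmult_right lat_full_has_sum) (use assms in auto)
  qed
qed

text \<open>Multiplication by \<open>\<i>\<close> permutes the lattice, and the summand is
  homogeneous of degree -1 in \<open>(z, p)\<close>.\<close>

lemma zeta0_ii: "zeta0 (\<i> * z) = - \<i> * zeta0 z"
proof -
  have "zeta0 (\<i> * z) = (\<Sum>\<^sub>\<infinity>p\<in>gauss'. - \<i> * (z ^ 2 / (p ^ 2 * (z - p))))"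
    unfolding zeta0_def
  proof (rule infsum_reindex_bij_witness[of _ "\<lambda>p. \<i> * p" "\<lambda>p. - \<i> * p"])
    fix p assume "p \<in> gauss'"
    have "\<i> * z - p = \<i> * (z - - \<i> * p)" by (simp add: algebra_simps)
    then show "- \<i> * (z ^ 2 / ((- \<i> * p) ^ 2 * (z - - \<i> * p))) = (\<i> * z) ^ 2 / (p ^ 2 * (\<i> * z - p))"
      by (simp add: power_mult_distrib divide_simps power2_eq_square)
  qed (auto simp: minus_mult_left[symmetric] simp del: minus_mult_left)
  also have "\<dots> = - \<i> * zeta0 z" unfolding zeta0_def by (rule infsum_cmult_right')
  finally show ?thesis .
qed

lemma zeta0_cnj: "zeta0 (cnj z) = cnj (zeta0 z)"
proof -
  have "zeta0 (cnj z) = (\<Sum>\<^sub>\<infinity>p\<in>gauss'. cnj (z ^ 2 / (p ^ 2 * (z - p))))"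
    unfolding zeta0_def
    by (rule infsum_reindex_bij_witness[of _ cnj cnj]) auto
  also have "\<dots> = cnj (zeta0 z)" unfolding zeta0_def by (rule infsum_cnj)
  finally show ?thesis .
qed

lemma zeta_ii: "zeta (\<i> * z) = - \<i> * zeta z"
  by (simp add: zeta_def zeta0_ii algebra_simps divide_simps)

lemma zeta_uminus: "zeta (- z) = - zeta z"
  using zeta_ii[of "\<i> * z"] by (simp add: zeta_ii)

lemma zeta_differentiable: "z \<notin> gauss \<Longrightarrow> zeta field_differentiable at z"
  using zeta_holomorphic by (simp add: holomorphic_on_imp_differentiable_at)

lemma zeta_has_field_derivative: "z \<notin> gauss \<Longrightarrow> (zeta has_field_derivative deriv zeta z) (at z)"
  using zeta_differentiable DERIV_deriv_iff_field_differentiable by blast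

lemma deriv2_zeta:
  assumes "z \<notin> gauss"
  shows "deriv (deriv zeta) z = 2 * lat_full 0 3 z"
proof -
  have 1: "deriv zeta y = - 1 / y ^ 2 + deriv zeta0 y" if "y \<in> - gauss" for y
  proof (rule DERIV_imp_deriv)
    have "(zeta0 has_field_derivative deriv zeta0 y) (at y)"
      using that by (intro holomorphic_derivI[OF zeta0_holomorphic open_compl_gauss(2)]) auto
    moreover have "y \<noteq> 0" using that by auto
    ultimately show "(zeta has_field_derivative (- 1 / y ^ 2 + deriv zeta0 y)) (at y)"
      unfolding zeta_def[abs_def]
      by (auto intro!: derivative_eq_intros simp: power2_eq_square)
  qed
  have "z \<noteq> 0" using assms by auto
  have "deriv (deriv zeta) z = deriv (\<lambda>y. - 1 / y ^ 2 + deriv zeta0 y) z"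
    by (rule deriv_cong_open[of "- gauss"]) (use 1 assms in auto)
  also have "\<dots> = 2 / z ^ 3 + deriv (deriv zeta0) z"
  proof (rule DERIV_imp_deriv)
    have "(deriv zeta0 has_field_derivative deriv (deriv zeta0) z) (at z)"
      using assms
      by (intro holomorphic_derivI[OF holomorphic_deriv[OF zeta0_holomorphic open_compl_gauss(2)] open_compl_gauss(2)]) auto
    then show "((\<lambda>y. - 1 / y ^ 2 + deriv zeta0 y) has_field_derivative 2 / z ^ 3 + deriv (deriv zeta0) z) (at z)"
      using \<open>z \<noteq> 0\<close> by (auto intro!: derivative_eq_intros simp: power2_eq_square power3_eq_cube)
  qed
  also have "\<dots> = 2 * lat_full 0 3 z"
    using assms by (simp add: deriv2_zeta0 lat_full_def)
  finally show ?thesis .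
qed

lemma deriv_shift:
  assumes "f holomorphic_on - gauss" "z \<notin> gauss" "q \<in> gauss"
  shows "((\<lambda>z. f (z + q)) has_field_derivative deriv f (z + q)) (at z)"
proof -
  have "(f has_field_derivative deriv f (z + q)) (at (z + q))"
    by (rule holomorphic_derivI[OF assms(1)]) (use assms in auto)
  then show ?thesis by (simp add: DERIV_shift)
qed

lemma deriv_periodic:
  assumes "f holomorphic_on - gauss" "\<And>z q. z \<notin> gauss \<Longrightarrow> q \<in> gauss \<Longrightarrow> f (z + q) = f z"
    and "z \<notin> gauss" "q \<in> gauss"
  shows "deriv f (z + q) = deriv f z"
proof -
  have "deriv (\<lambda>z. f (z + q)) z = deriv f (z + q)"
    by (rule DERIV_imp_deriv[OF deriv_shift[OF assms(1,3,4)]])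
  moreover have "deriv (\<lambda>z. f (z + q)) z = deriv f z"
    by (rule deriv_cong_open[of "- gauss"]) (use assms in auto)
  ultimately show ?thesis by simp
qed

lemma constant_on_compl_gauss:
  assumes "\<And>z. z \<notin> gauss \<Longrightarrow> (f has_field_derivative 0) (at z)" "z \<notin> gauss" "w \<notin> gauss"
  shows "f z = f w"
proof -
  have "f constant_on - gauss"
  proof (rule has_field_derivative_0_imp_constant_on)
    fix z assume "z \<in> - gauss"
    then show "(f has_field_derivative 0) (at z)" using assms(1) by simp
  qed (use connected_compl_gauss in auto)
  then show ?thesis using assms(2,3) unfolding constant_on_def by (metis ComplI)
qed

lemma deriv_zeta_uminus:
  assumes "z \<notin> gauss"
  shows "deriv zeta (- z) = deriv zeta z"
proof -
  have "((\<lambda>z. - zeta (- z)) has_field_derivative deriv zeta (- z)) (at z)"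
    using assms zeta_has_field_derivative[of "- z"]
    by (auto intro!: derivative_eq_intros DERIV_chain2[where f = zeta])
  then show ?thesis
    by (simp add: zeta_uminus DERIV_imp_deriv)
qed

text \<open>The second derivative of \<open>zeta\<close> is periodic, so
  \<open>deriv zeta (z + q) - deriv zeta z\<close> does not depend on \<open>z\<close>. At
  \<open>- z - q\<close> this difference equals its own negative, because \<open>deriv zeta\<close>
  is even; hence it is 0.\<close>

lemma deriv_zeta_shift:
  assumes "z \<notin> gauss" "q \<in> gauss"
  shows "deriv zeta (z + q) = deriv zeta z"
proof -
  have holo: "deriv zeta holomorphic_on - gauss"
    by (intro holomorphic_deriv zeta_holomorphic) auto
  have const: "deriv zeta (z + q) - deriv zeta z = deriv zeta (w + q) - deriv zeta w"
    if "w \<notin> gauss" for w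
  proof (rule constant_on_compl_gauss[where f = "\<lambda>z. deriv zeta (z + q) - deriv zeta z"])
    fix z assume z: "z \<notin> gauss"
    have "((\<lambda>z. deriv zeta (z + q) - deriv zeta z) has_field_derivative
        deriv (deriv zeta) (z + q) - deriv (deriv zeta) z) (at z)"
      by (intro DERIV_diff deriv_shift holomorphic_derivI[OF holo]) (use z holo assms in auto)
    moreover have "deriv (deriv zeta) (z + q) = deriv (deriv zeta) z"
      using z assms lat_full_shift[of 0 3 z q] by (simp add: deriv2_zeta)
    ultimately show "((\<lambda>z. deriv zeta (z + q) - deriv zeta z) has_field_derivative 0) (at z)" by simp
  qed (use assms that in auto)
  have n: "- z - q \<notin> gauss" using assms by simp
  have "deriv zeta (z + q) - deriv zeta z = deriv zeta (- z - q + q) - deriv zeta (- z - q)"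
    by (rule const[OF n])
  also have "\<dots> = deriv zeta z - deriv zeta (z + q)"
    using assms deriv_zeta_uminus[of z] deriv_zeta_uminus[of "z + q"] by simp
  finally show ?thesis by simp
qed

section \<open>The quasi-periods of zeta and Legendre's relation\<close>

definition eta :: "complex \<Rightarrow> complex" where
  "eta q = zeta (Complex (1/2) (1/2) + q) - zeta (Complex (1/2) (1/2))"

lemma half_not_Int: "(1/2::real) \<notin> \<int>"
proof
  assume "(1/2::real) \<in> \<int>"
  then obtain n where "1/2 = real_of_int n" by (rule Ints_cases)
  then have "1 = 2 * n" by linarith
  then show False by presburger
qed

lemma half_notin_gauss: "Complex (1/2) (1/2) \<notin> gauss"
  by (simp add: gauss_def half_not_Int)

text \<open>The base point in \<open>eta\<close> is just some point off the lattice: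
  \<open>zeta (z + q) - zeta z\<close> has derivative 0 on a connected set.\<close>

lemma zeta_shift_eta:
  assumes "z \<notin> gauss" "q \<in> gauss"
  shows "zeta (z + q) = zeta z + eta q"
proof -
  have "zeta (z + q) - zeta z = eta q" unfolding eta_def
  proof (rule constant_on_compl_gauss[where f = "\<lambda>z. zeta (z + q) - zeta z"])
    fix z assume z: "z \<notin> gauss"
    have "((\<lambda>z. zeta (z + q) - zeta z) has_field_derivative deriv zeta (z + q) - deriv zeta z) (at z)"
      by (intro DERIV_diff deriv_shift zeta_holomorphic zeta_has_field_derivative) (use z assms in auto)
    then show "((\<lambda>z. zeta (z + q) - zeta z) has_field_derivative 0) (at z)"
      using deriv_zeta_shift z assms by simp
  qed (use assms half_notin_gauss in auto)
  then show ?thesis by (simp add: algebra_simps)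
qed

lemma eta_add:
  assumes "q \<in> gauss" "\<nu> \<in> gauss"
  shows "eta (q + \<nu>) = eta q + eta \<nu>"
proof -
  have "Complex (1/2) (1/2) + q \<notin> gauss" using assms half_notin_gauss by (simp del: complex_add)
  from zeta_shift_eta[OF this assms(2)] zeta_shift_eta[OF half_notin_gauss assms(1)]
    zeta_shift_eta[OF half_notin_gauss gauss_add[OF assms]]
  show ?thesis by (simp add: add.assoc)
qed

lemma eta_0: "eta 0 = 0" by (simp add: eta_def)

lemma eta_ii:
  assumes "q \<in> gauss"
  shows "eta (\<i> * q) = - \<i> * eta q"
proof -
  let ?z = "Complex (1/2) (1/2)"
  have "zeta (\<i> * ?z + \<i> * q) = zeta (\<i> * ?z) + eta (\<i> * q)"
    by (rule zeta_shift_eta) (use half_notin_gauss assms in auto)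
  moreover have "zeta (\<i> * ?z + \<i> * q) = - \<i> * zeta (?z + q)"
    by (metis zeta_ii distrib_left)
  ultimately show ?thesis
    using zeta_shift_eta[OF half_notin_gauss assms] by (simp add: zeta_ii algebra_simps)
qed

lemma eta_uminus: "q \<in> gauss \<Longrightarrow> eta (- q) = - eta q"
  using eta_add[of q "- q"] eta_0 by (simp add: eq_neg_iff_add_eq_0 add.commute)

lemma eta_of_nat: "eta (of_nat n) = of_nat n * eta 1"
proof (induction n)
  case (Suc n)
  have "eta (of_nat n + 1) = eta (of_nat n) + eta 1"
    by (rule eta_add) (use gauss_of_int[of "int n"] in auto)
  then show ?case using Suc by (simp add: algebra_simps)
qed (simp add: eta_0)

lemma eta_of_int: "eta (of_int n) = of_int n * eta 1"
proof (cases n rule: int_cases2)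
  case (nonpos k)
  then show ?thesis using eta_uminus[of "of_nat k"] gauss_of_int[of "int k"] eta_of_nat[of k] by simp
qed (use eta_of_nat in simp)

text \<open>\<open>eta\<close> is additive and satisfies
  \<open>eta (\<i> * q) = - \<i> * eta q\<close>, so it is conjugate-linear over the Gaussian
  integers and determined by \<open>eta 1\<close>.\<close>

lemma eta_eq:
  assumes "q \<in> gauss"
  shows "eta q = cnj q * eta 1"
proof -
  obtain m n where mn: "Re q = of_int m" "Im q = of_int n"
    using assms by (auto simp: gauss_def elim!: Ints_cases)
  then have mu: "q = of_int m + \<i> * of_int n" by (simp add: complex_eq_iff)
  have "eta q = eta (of_int m) + eta (\<i> * of_int n)"
    unfolding mu by (rule eta_add) auto
  also have "\<dots> = cnj q * eta 1"
    by (simp add: eta_ii eta_of_int mu algebra_simps)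
  finally show ?thesis .
qed

lemma contour_integral_linepath_shift:
  "contour_integral (linepath (a + c) (b + c)) f = contour_integral (linepath a b) (\<lambda>z. f (z + c))"
proof -
  have "linepath (a + c) (b + c) x = linepath a b x + c" for x
    by (simp add: linepath_def algebra_simps scaleR_conv_of_real)
  then show ?thesis
    by (simp add: contour_integral_integral)
qed

lemma contour_integral_linepath_mult:
  "contour_integral (linepath (c * a) (c * b)) f = contour_integral (linepath a b) (\<lambda>z. c * f (c * z))"
proof -
  have "linepath (c * a) (c * b) x = c * linepath a b x" for x
    by (simp add: linepath_def algebra_simps scaleR_conv_of_real)
  then show ?thesis
    unfolding contour_integral_integral vector_derivative_linepath_at
    by (intro integral_cong) (simp add: algebra_simps)
qed

text \<open>Legendre's relation, from integrating \<open>zeta\<close> around the square centred at \<open>0\<close>: by the symmetry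
  \<open>zeta (\<i> * z) = - \<i> * zeta z\<close> the four sides contribute equally.\<close>

lemma eta_1: "eta 1 = of_real pi"
proof -
  define p where "p = Complex (1/2) (-1/2)"
  let ?q = "\<i> * p"
  define J where "J = contour_integral (linepath p ?q) zeta"
  have q: "?q = Complex (1/2) (1/2)" by (simp add: p_def complex_eq_iff)
  have off: "z \<notin> gauss" if "\<bar>Re z\<bar> = 1/2 \<or> \<bar>Im z\<bar> = 1/2" for z
  proof
    assume "z \<in> gauss"
    then have "\<bar>Re z\<bar> \<in> \<int>" "\<bar>Im z\<bar> \<in> \<int>"
      by (auto simp: gauss_def abs_if)
    then show False using that half_not_Int by metis
  qed
  have seg: "closed_segment a b \<subseteq> - gauss"
    if "(Re a = Re b \<and> \<bar>Re b\<bar> = 1/2) \<or> (Im a = Im b \<and> \<bar>Im b\<bar> = 1/2)" for a b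
  proof
    fix z assume "z \<in> closed_segment a b"
    then obtain u where "z = (1 - u) *\<^sub>R a + u *\<^sub>R b" by (auto simp: in_segment)
    then have "Re z = (1 - u) * Re a + u * Re b" "Im z = (1 - u) * Im a + u * Im b" by simp_all
    then have "(Re a = Re b \<longrightarrow> Re z = Re b) \<and> (Im a = Im b \<longrightarrow> Im z = Im b)"
      by (auto simp: algebra_simps)
    then show "z \<in> - gauss" using that off by force
  qed
  have cont: "continuous_on (closed_segment a b) zeta"
    if "(Re a = Re b \<and> \<bar>Re b\<bar> = 1/2) \<or> (Im a = Im b \<and> \<bar>Im b\<bar> = 1/2)" for a b
    by (rule holomorphic_on_imp_continuous_on, rule holomorphic_on_subset[OF zeta_holomorphic])
       (rule seg, fact that)
  have intble: "zeta contour_integrable_on linepath a b"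
    if "(Re a = Re b \<and> \<bar>Re b\<bar> = 1/2) \<or> (Im a = Im b \<and> \<bar>Im b\<bar> = 1/2)" for a b
    by (rule contour_integrable_continuous_linepath, rule cont, fact that)
  \<comment> \<open>The factor \<open>\<i>\<close> from the change of variable cancels the
    \<open>- \<i>\<close> from \<open>zeta_ii\<close>.\<close>
  have rot: "contour_integral (linepath (\<i> * a) (\<i> * b)) zeta = contour_integral (linepath a b) zeta" for a b
    by (simp add: contour_integral_linepath_mult zeta_ii)
  have rot2: "contour_integral (linepath (- a) (- b)) zeta = contour_integral (linepath a b) zeta" for a b
    using rot[of "\<i> * a" "\<i> * b"] rot[of a b] by simp
  let ?R = "rectpath (- ?q) ?q"
  have img: "path_image ?R \<subseteq> ball 0 1 - {0}"
  proof
    fix z assume "z \<in> path_image ?R"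
    then have "z \<in> cbox (- ?q) ?q" and "z \<notin> box (- ?q) ?q"
      using path_image_rectpath_cbox_minus_box[of "- ?q" ?q] by (auto simp: q)
    then have "\<bar>Re z\<bar> \<le> 1/2" "\<bar>Im z\<bar> \<le> 1/2" "z \<noteq> 0"
      by (auto simp: in_cbox_complex_iff in_box_complex_iff q)
    moreover from this have "norm z \<le> \<bar>Re z\<bar> + \<bar>Im z\<bar>"
      using cmod_le by auto
    moreover have "norm z ^ 2 < 1"
    proof -
      have "norm z ^ 2 = \<bar>Re z\<bar> ^ 2 + \<bar>Im z\<bar> ^ 2" by (simp add: cmod_power2)
      also have "\<dots> \<le> (1/2) ^ 2 + (1/2) ^ 2"
        using \<open>\<bar>Re z\<bar> \<le> 1/2\<close> \<open>\<bar>Im z\<bar> \<le> 1/2\<close> by (intro add_mono power_mono) auto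
      finally show ?thesis by (simp add: power2_eq_square)
    qed
    ultimately show "z \<in> ball 0 1 - {0}"
      by (simp add: abs_square_less_1)
  qed
  have "zeta0 holomorphic_on ball 0 1"
    using holomorphic_on_subset[OF zeta0_holomorphic ball_subset_compl_gauss] .
  then have z0: "(zeta0 has_contour_integral 0) ?R"
    by (rule Cauchy_theorem_convex_simple) (use img in auto)
  have nz: "0 \<notin> path_image ?R" using img by auto
  have "winding_number ?R 0 = 1"
    by (rule winding_number_rectpath) (simp add: in_box_complex_iff q)
  then have "contour_integral ?R (\<lambda>w. 1 / w) = 2 * of_real pi * \<i>"
    using nz by (subst (asm) winding_number_valid_path) (auto simp: field_simps)
  moreover have "(\<lambda>w. 1 / (w - 0)) contour_integrable_on ?R"
    by (rule contour_integrable_inversediff) (use nz in auto)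
  ultimately have total: "contour_integral ?R zeta = 2 * of_real pi * \<i>"
    using z0 has_contour_integral_integrable[OF z0] contour_integral_unique[OF z0]
    by (simp add: zeta_def[abs_def] contour_integral_add)
  have "contour_integral ?R zeta = contour_integral (linepath (- ?q) p) zeta +
    (contour_integral (linepath p ?q) zeta + (contour_integral (linepath ?q (- p)) zeta +
     contour_integral (linepath (- p) (- ?q)) zeta))"
  proof -
    have "Complex (Re ?q) (Im (- ?q)) = p" "Complex (Re (- ?q)) (Im ?q) = - p"
      by (simp_all add: p_def complex_eq_iff)
    then have R: "?R = linepath (- ?q) p +++ linepath p ?q +++ linepath ?q (- p) +++ linepath (- p) (- ?q)"
      by (simp add: rectpath_def Let_def)
    show ?thesis unfolding R
      by (subst contour_integral_join contour_integrable_join; auto simp: p_def intro!: intble)+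
  qed
  also have "\<dots> = 4 * J"
    using rot[of p ?q] rot2[of p ?q] rot[of "- p" "- ?q"] by (simp add: J_def)
  finally have J: "J = \<i> * of_real pi / 2" using total by simp
  have pq: "- ?q + 1 = p" "- p + 1 = ?q" by (simp_all add: p_def complex_eq_iff)
  \<comment> \<open>The right side of the square is its left side moved by 1, and the left side
    traversed upwards contributes \<open>- J\<close>. Hence
    \<open>J = - J + eta 1 * \<i>\<close>.\<close>
  have "J = contour_integral (linepath (- ?q + 1) (- p + 1)) zeta"
    by (simp only: pq J_def)
  also have "\<dots> = contour_integral (linepath (- ?q) (- p)) (\<lambda>z. zeta (z + 1))"
    by (rule contour_integral_linepath_shift)
  also have "\<dots> = contour_integral (linepath (- ?q) (- p)) (\<lambda>z. zeta z + eta 1)"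
  proof (rule contour_integral_cong[OF refl])
    fix z assume "z \<in> path_image (linepath (- ?q) (- p))"
    then have "z \<notin> gauss" using seg[of "- ?q" "- p"] by (auto simp: p_def)
    then show "zeta (z + 1) = zeta z + eta 1" by (rule zeta_shift_eta) auto
  qed
  also have "\<dots> = contour_integral (linepath (- ?q) (- p)) zeta + eta 1 * (?q - p)"
    by (subst contour_integral_add) (auto simp: p_def intro!: intble)
  also have "contour_integral (linepath (- ?q) (- p)) zeta = - J"
    using rot2[of ?q p] contour_integral_reverse_linepath[OF cont[of p ?q]]
    by (simp add: J_def p_def)
  finally have "2 * J = eta 1 * (?q - p)" by (simp add: algebra_simps)
  moreover have "?q - p = \<i>" by (simp add: q p_def complex_eq_iff)
  ultimately show ?thesis using J by simp
qed

lemma zeta_shift: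
  assumes "z \<notin> gauss" "q \<in> gauss"
  shows "zeta (z + q) = zeta z + of_real pi * cnj q"
  using assms zeta_shift_eta eta_eq eta_1 by (simp add: mult.commute)

section \<open>The function \<open>\<wp>\<close>\<close>

lemma open_insert_compl_gauss [simp]: "open (insert 0 (- gauss))"
proof -
  have "insert 0 (- gauss) = - gauss'" by auto
  then show ?thesis using open_compl_gauss(2) by simp
qed

section \<open>Laurent behaviour of wp at the origin and its differential equation\<close>

lemma fps_expansion_divide_power:
  fixes f :: "complex \<Rightarrow> complex"
  assumes f: "f has_fps_expansion F" and F: "\<And>k. k < n \<Longrightarrow> fps_nth F k = 0"
  obtains g where "g has_fps_expansion fps_shift n F" "\<forall>\<^sub>F z in nhds 0. f z = z ^ n * g z"
proof (cases "F = 0")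
  case True
  then show ?thesis using that[of "\<lambda>_. 0"] f by (simp add: has_fps_expansion_0_iff)
next
  case False
  then have sub: "n \<le> subdegree F"
    using F by (intro subdegree_geI) auto
  have "\<forall>\<^sub>F z in nhds 0. z \<in> eball 0 (fps_conv_radius F)"
    using f by (intro eventually_nhds_in_open) (auto simp: has_fps_expansion_def zero_ereal_def)
  moreover have "\<forall>\<^sub>F z in nhds 0. eval_fps F z = f z"
    using f by (simp add: has_fps_expansion_def)
  ultimately have "\<forall>\<^sub>F z in nhds 0. f z = z ^ n * eval_fps (fps_shift n F) z"
  proof eventually_elim
    case (elim z)
    have "f 0 = fps_nth F 0" by (rule has_fps_expansion_imp_0_eq_fps_nth_0[OF f])
    then show ?case
      using elim sub F[of 0] by (subst eval_fps_shift) (auto simp: power_0_left)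
  qed
  then show ?thesis
    using that[of "eval_fps (fps_shift n F)"] f
    by (simp add: has_fps_expansion_def)
qed

lemma divide_power_tendsto:
  fixes f :: "complex \<Rightarrow> complex"
  assumes f: "f has_fps_expansion F" and F: "\<And>k. k < n \<Longrightarrow> fps_nth F k = 0"
  shows "((\<lambda>z. f z / z ^ n) \<longlongrightarrow> fps_nth F n) (at 0)"
proof -
  obtain g where g: "g has_fps_expansion fps_shift n F" "\<forall>\<^sub>F z in nhds 0. f z = z ^ n * g z"
    using fps_expansion_divide_power[OF assms] by metis
  have "(g \<longlongrightarrow> fps_nth F n) (at 0)"
    using has_fps_expansion_imp_tendsto_0[OF g(1)] by (simp add: tendsto_nhds_iff)
  also have "?this \<longleftrightarrow> ?thesis"
  proof (rule tendsto_cong)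
    have "\<forall>\<^sub>F z in at 0. z \<noteq> 0 \<and> f z = z ^ n * g z"
      using g(2) by (auto simp: eventually_at_filter elim: eventually_mono)
    then show "\<forall>\<^sub>F z in at 0. g z = f z / z ^ n"
      by eventually_elim auto
  qed
  finally show ?thesis .
qed

definition wp :: "complex \<Rightarrow> complex" where "wp z = - deriv zeta z"

definition wp0 :: "complex \<Rightarrow> complex" where "wp0 z = - deriv zeta0 z"

lemma wp_holomorphic: "wp holomorphic_on - gauss"
  unfolding wp_def[abs_def] by (intro holomorphic_intros holomorphic_deriv zeta_holomorphic) auto

lemma wp0_holomorphic: "wp0 holomorphic_on - gauss'"
  unfolding wp0_def[abs_def] 
  by (intro holomorphic_intros holomorphic_deriv zeta0_holomorphic open_compl_gauss)

lemma zeta0_has_field_derivative: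
  "z \<in> - gauss' \<Longrightarrow> (zeta0 has_field_derivative - wp0 z) (at z)"
  unfolding wp0_def using holomorphic_derivI[OF zeta0_holomorphic open_compl_gauss(2)] by simp

lemma wp_eq:
  assumes "z \<notin> gauss"
  shows "wp z = 1 / z ^ 2 + wp0 z"
proof -
  have "z \<noteq> 0" using assms by auto
  then have "(zeta has_field_derivative (- 1 / z ^ 2 + - wp0 z)) (at z)"
    unfolding zeta_def[abs_def]
    by (auto intro!: derivative_eq_intros zeta0_has_field_derivative simp: power2_eq_square assms)
  then show ?thesis
    unfolding wp_def by (simp add: DERIV_imp_deriv)
qed

lemma wp_shift: "z \<notin> gauss \<Longrightarrow> q \<in> gauss \<Longrightarrow> wp (z + q) = wp z"
  by (simp add: wp_def deriv_zeta_shift)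

lemma wp0_ii:
  assumes "z \<in> - gauss'"
  shows "wp0 (\<i> * z) = - wp0 z"
proof -
  have "\<i> * z \<in> - gauss'" using assms by auto
  then have "((\<lambda>z. zeta0 (\<i> * z)) has_field_derivative - wp0 (\<i> * z) * \<i>) (at z)"
    by (intro DERIV_chain2[where f = zeta0] zeta0_has_field_derivative) (auto intro!: derivative_eq_intros)
  moreover have "((\<lambda>z. - \<i> * zeta0 z) has_field_derivative - \<i> * - wp0 z) (at z)"
    by (intro DERIV_cmult zeta0_has_field_derivative assms)
  ultimately have "- wp0 (\<i> * z) * \<i> = - \<i> * - wp0 z"
    by (intro DERIV_unique[where f = "\<lambda>z. zeta0 (\<i> * z)"]) (simp_all add: zeta0_ii)
  moreover have "wp0 (\<i> * z) = \<i> * (- wp0 (\<i> * z) * \<i>)" by (simp add: complex_eq_iff)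
  ultimately show ?thesis by simp
qed

lemma wp_ii:
  assumes "z \<notin> gauss"
  shows "wp (\<i> * z) = - wp z"
  using assms wp0_ii[of z] by (simp add: wp_eq power_mult_distrib)

lemma wp_has_field_derivative: "z \<notin> gauss \<Longrightarrow> (wp has_field_derivative deriv wp z) (at z)"
  using holomorphic_derivI[OF wp_holomorphic] by auto

lemma deriv_wp_has_field_derivative:
  "z \<notin> gauss \<Longrightarrow> (deriv wp has_field_derivative deriv (deriv wp) z) (at z)"
  using holomorphic_derivI[OF holomorphic_deriv[OF wp_holomorphic]] by auto

lemma deriv_wp_shift: "z \<notin> gauss \<Longrightarrow> q \<in> gauss \<Longrightarrow> deriv wp (z + q) = deriv wp z"
  by (rule deriv_periodic[OF wp_holomorphic wp_shift])

lemma deriv2_wp_shift: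
  "z \<notin> gauss \<Longrightarrow> q \<in> gauss \<Longrightarrow> deriv (deriv wp) (z + q) = deriv (deriv wp) z"
  by (rule deriv_periodic[OF _ deriv_wp_shift]) (auto intro!: holomorphic_deriv wp_holomorphic)

lemma deriv_wp_ii:
  assumes "z \<notin> gauss"
  shows "deriv wp (\<i> * z) = \<i> * deriv wp z"
proof -
  have "((\<lambda>z. - wp (\<i> * z)) has_field_derivative - (deriv wp (\<i> * z) * \<i>)) (at z)"
    by (intro DERIV_minus DERIV_chain2[where f = wp] wp_has_field_derivative)
       (use assms in \<open>auto intro!: derivative_eq_intros\<close>)
  then have "deriv (\<lambda>z. - wp (\<i> * z)) z = - (deriv wp (\<i> * z) * \<i>)" by (rule DERIV_imp_deriv)
  moreover have "deriv (\<lambda>z. - wp (\<i> * z)) z = deriv wp z"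
    by (rule deriv_cong_open[of "- gauss"]) (use assms wp_ii in auto)
  moreover have "deriv wp (\<i> * z) = \<i> * - (deriv wp (\<i> * z) * \<i>)" by (simp add: complex_eq_iff)
  ultimately show ?thesis by simp
qed

definition Wp0 :: "complex fps" where "Wp0 = fps_expansion wp0 0"

lemma wp0_expansion: "wp0 has_fps_expansion Wp0"
  unfolding Wp0_def by (rule has_fps_expansion_fps_expansion[OF open_compl_gauss(2) _ wp0_holomorphic]) auto

lemma ii_power_mod_4: "\<i> ^ n = \<i> ^ (n mod 4)"
proof -
  have "\<i> ^ (4 * (n div 4)) = 1" by (simp add: power_mult power4_eq_xxxx)
  then have "\<i> ^ (4 * (n div 4) + n mod 4) = \<i> ^ (n mod 4)" by (simp only: power_add mult_1)
  then show ?thesis by simp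
qed

text \<open>Comparing coefficients in \<open>wp0 (\<i> * z) = - wp0 z\<close> gives
  \<open>(\<i> ^ n + 1) * fps_nth Wp0 n = 0\<close>, and \<open>\<i> ^ n = -1\<close> only for
  \<open>n\<close> congruent to 2 modulo 4.\<close>

lemma Wp0_eq_0:
  assumes "n mod 4 \<noteq> 2"
  shows "fps_nth Wp0 n = 0"
proof -
  have "(wp0 \<circ> (\<lambda>z. \<i> * z)) has_fps_expansion fps_compose Wp0 (fps_const \<i> * fps_X)"
    by (intro fps_expansion_intros wp0_expansion) auto
  also have "?this \<longleftrightarrow> (\<lambda>z. - wp0 z) has_fps_expansion fps_compose Wp0 (fps_const \<i> * fps_X)"
  proof (rule has_fps_expansion_cong)
    have "\<forall>\<^sub>F z in nhds 0. z \<in> - gauss'" by (rule eventually_nhds_in_open) auto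
    then show "\<forall>\<^sub>F z in nhds 0. (wp0 \<circ> (\<lambda>z. \<i> * z)) z = - wp0 z"
      by eventually_elim (use wp0_ii in auto)
  qed auto
  finally have "fps_compose Wp0 (fps_const \<i> * fps_X) = - Wp0"
    using has_fps_expansion_minus[OF wp0_expansion] fps_expansion_unique_complex by blast
  then have "fps_nth (fps_compose Wp0 (fps_const \<i> * fps_X)) n = - fps_nth Wp0 n" by simp
  then have eq: "(\<i> ^ n + 1) * fps_nth Wp0 n = 0"
    unfolding fps_compose_linear by (simp add: algebra_simps)
  have "\<i> ^ n = \<i> ^ (n mod 4)" by (rule ii_power_mod_4)
  moreover have "n mod 4 = 0 \<or> n mod 4 = 1 \<or> n mod 4 = 3"
    using assms by presburger
  ultimately have "\<i> ^ n + 1 \<noteq> 0"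
    by (auto simp: power3_eq_cube complex_eq_iff)
  then show ?thesis using eq by simp
qed

text \<open>\<open>wp z = 1 / z\<^sup>2 + g2c * z\<^sup>2 + \<dots>\<close>, so \<open>g2c\<close> is the classical \<open>g\<^sub>2 / 20\<close>; \<open>g\<^sub>3 = 0\<close> by symmetry.\<close>

definition g2c :: complex where "g2c = fps_nth Wp0 2"

lemma deriv2_wp:
  assumes "z \<notin> gauss"
  shows "deriv (deriv wp) z = 6 / z ^ 4 + deriv (deriv wp0) z"
proof -
  have d0: "(wp0 has_field_derivative deriv wp0 y) (at y)"
    "(deriv wp0 has_field_derivative deriv (deriv wp0) y) (at y)" if "y \<in> - gauss" for y
    using that by (auto intro!: holomorphic_derivI[OF _ open_compl_gauss(2)] holomorphic_deriv wp0_holomorphic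
      simp del: Compl_Diff_eq)
  have 1: "deriv wp y = - 2 / y ^ 3 + deriv wp0 y" if y: "y \<in> - gauss" for y
  proof -
    have "y \<noteq> 0" using y by auto
    have "deriv wp y = deriv (\<lambda>y. 1 / y ^ 2 + wp0 y) y"
      by (rule deriv_cong_open[of "- gauss"]) (use wp_eq y in auto)
    also have "\<dots> = - 2 / y ^ 3 + deriv wp0 y"
      by (rule DERIV_imp_deriv)
         (use \<open>y \<noteq> 0\<close> d0[OF y] in \<open>auto intro!: derivative_eq_intros simp: power2_eq_square power3_eq_cube\<close>)
    finally show ?thesis .
  qed
  have "z \<noteq> 0" using assms by auto
  have z: "z \<in> - gauss" using assms by simp
  have "deriv (deriv wp) z = deriv (\<lambda>y. - 2 / y ^ 3 + deriv wp0 y) z"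
    by (rule deriv_cong_open[of "- gauss"]) (use 1 z in auto)
  also have "\<dots> = 6 / z ^ 4 + deriv (deriv wp0) z"
    by (rule DERIV_imp_deriv)
       (use \<open>z \<noteq> 0\<close> d0[OF z] in \<open>auto intro!: derivative_eq_intros simp: power2_eq_square power3_eq_cube power4_eq_xxxx\<close>)
  finally show ?thesis .
qed

text \<open>In \<open>deriv (deriv wp) z - 6 * wp z ^ 2\<close> the terms \<open>6 / z ^ 4\<close>
  cancel, and \<open>12 * wp0 z / z ^ 2\<close> stays bounded because \<open>wp0\<close> vanishes to
  second order. The periodic function is thus constant, with limit \<open>2 * g2c - 12 * g2c\<close>
  at 0.\<close>

lemma wp_ode:
  assumes "z \<notin> gauss"
  shows "deriv (deriv wp) z = 6 * wp z ^ 2 - 10 * g2c"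
proof -
  have "(\<lambda>z. deriv (deriv wp) z - 6 * wp z ^ 2) z = - 10 * g2c"
  proof (rule gauss_periodic_constant[where f = "\<lambda>z. deriv (deriv wp) z - 6 * wp z ^ 2" and l = "- 10 * g2c"])
    show "(\<lambda>z. deriv (deriv wp) z - 6 * wp z ^ 2) holomorphic_on - gauss"
      by (intro holomorphic_intros holomorphic_deriv wp_holomorphic) auto
    have n: "fps_nth Wp0 0 = 0" "fps_nth Wp0 (Suc 0) = 0" by (simp_all add: Wp0_eq_0)
    have "((\<lambda>z. wp0 z / z ^ 2) \<longlongrightarrow> g2c) (at 0)"
      unfolding g2c_def by (rule divide_power_tendsto[OF wp0_expansion]) (auto simp: less_Suc_eq numeral_2_eq_2 n)
    moreover have "(wp0 \<longlongrightarrow> fps_nth Wp0 0) (at 0)"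
      using has_fps_expansion_imp_tendsto_0[OF wp0_expansion] by (simp add: tendsto_nhds_iff)
    moreover have "(deriv (deriv wp0) \<longlongrightarrow> fps_nth (fps_deriv (fps_deriv Wp0)) 0) (at 0)"
      using has_fps_expansion_imp_tendsto_0[OF has_fps_expansion_deriv[OF has_fps_expansion_deriv[OF wp0_expansion]]]
      by (simp add: tendsto_nhds_iff)
    ultimately have lim: "((\<lambda>z. deriv (deriv wp0) z - 12 * (wp0 z / z ^ 2) - 6 * wp0 z ^ 2) \<longlongrightarrow>
        fps_nth (fps_deriv (fps_deriv Wp0)) 0 - 12 * g2c - 6 * (fps_nth Wp0 0) ^ 2) (at 0)"
      by (intro tendsto_intros)
    have L: "fps_nth (fps_deriv (fps_deriv Wp0)) 0 - 12 * g2c - 6 * (fps_nth Wp0 0) ^ 2 = - 10 * g2c"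
      by (simp add: n g2c_def numeral_2_eq_2)
    show "((\<lambda>z. deriv (deriv wp) z - 6 * wp z ^ 2) \<longlongrightarrow> - 10 * g2c) (at 0)"
    proof (rule Lim_transform_eventually[OF lim[unfolded L]])
      have "\<forall>\<^sub>F z in at 0. z \<in> - gauss' - {0}" by (rule eventually_at_in_open) auto
      then show "\<forall>\<^sub>F z in at 0. deriv (deriv wp0) z - 12 * (wp0 z / z ^ 2) - 6 * wp0 z ^ 2 =
          deriv (deriv wp) z - 6 * wp z ^ 2"
      proof eventually_elim
        case (elim z)
        then have z: "z \<notin> gauss" "z \<noteq> 0" by auto
        have "6 * (1 / z ^ 2 + w) ^ 2 = 6 / z ^ 4 + 12 * (w / z ^ 2) + 6 * w ^ 2" for w
          using z(2) by (simp add: power2_eq_square power4_eq_xxxx field_simps)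
        then show ?case by (simp add: wp_eq[OF z(1)] deriv2_wp[OF z(1)])
      qed
    qed
  qed (use assms in \<open>simp_all add: wp_shift deriv2_wp_shift\<close>)
  then show ?thesis by (simp add: algebra_simps)
qed

text \<open>By \<open>wp_ode\<close> the difference of the two sides is constant. Each of its terms
  changes sign under \<open>z\<close> to \<open>\<i> * z\<close>, so the constant is 0; this is the
  vanishing of \<open>g\<^sub>3\<close>.\<close>

lemma wp_first_integral:
  assumes "z \<notin> gauss"
  shows "deriv wp z ^ 2 = 4 * wp z ^ 3 - 20 * g2c * wp z"
proof -
  define f where "f = (\<lambda>z. deriv wp z ^ 2 - 4 * wp z ^ 3 + 20 * g2c * wp z)"
  have "f (\<i> * z) = f z"
  proof (rule constant_on_compl_gauss[where f = f])
    fix z assume z: "z \<notin> gauss"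
    have "(f has_field_derivative 2 * deriv wp z * deriv (deriv wp) z - 4 * (3 * wp z ^ 2 * deriv wp z) +
        20 * g2c * deriv wp z) (at z)"
      unfolding f_def
      by (auto intro!: derivative_eq_intros wp_has_field_derivative deriv_wp_has_field_derivative z)
    also have "2 * deriv wp z * deriv (deriv wp) z - 4 * (3 * wp z ^ 2 * deriv wp z) + 20 * g2c * deriv wp z = 0"
      by (simp add: wp_ode[OF z] algebra_simps)
    finally show "(f has_field_derivative 0) (at z)" .
  qed (use assms in auto)
  moreover have "f (\<i> * z) = - f z"
    using assms by (simp add: f_def wp_ii deriv_wp_ii power_mult_distrib algebra_simps)
  ultimately have "f z = 0" by simp
  then show ?thesis by (simp add: f_def algebra_simps)
qed

section \<open>Homogeneity of Taylor coefficients\<close>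

text \<open>\<open>n\<close> is a weight: sums stay within one weight and products add weights, so
  recurrences with rational coefficients can be followed by counting exponents alone.\<close>

definition homog :: "complex \<Rightarrow> nat \<Rightarrow> complex set" where
  "homog w n = {r * w ^ n | r. r \<in> \<rat>}"

lemma homog_0 [simp, intro]: "0 \<in> homog w n"
  unfolding homog_def by (auto intro!: exI[of _ 0])

lemma homog_Rats: "r \<in> \<rat> \<Longrightarrow> r \<in> homog w 0"
  by (auto simp: homog_def)

lemma homog_add: "x \<in> homog w n \<Longrightarrow> y \<in> homog w n \<Longrightarrow> x + y \<in> homog w n"
  unfolding homog_def by clarify (metis distrib_right Rats_add)

lemma homog_sum: "(\<And>i. i \<in> I \<Longrightarrow> f i \<in> homog w n) \<Longrightarrow> sum f I \<in> homog w n"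
  by (induction I rule: infinite_finite_induct) (auto intro: homog_add)

lemma homog_mult:
  assumes "x \<in> homog w m" "y \<in> homog w n" "k = m + n"
  shows "x * y \<in> homog w k"
proof -
  obtain r s where "x = r * w ^ m" "y = s * w ^ n" "r \<in> \<rat>" "s \<in> \<rat>"
    using assms by (auto simp: homog_def)
  then have "x * y = (r * s) * w ^ k" "r * s \<in> \<rat>" using assms by (simp_all add: power_add mult_ac)
  then show ?thesis unfolding homog_def by blast
qed

lemma homog_cmult: "r \<in> \<rat> \<Longrightarrow> x \<in> homog w n \<Longrightarrow> r * x \<in> homog w n"
  by (rule homog_mult[OF homog_Rats]) auto

lemma homog_cmult_iff:
  assumes "r \<in> \<rat>" "r \<noteq> 0"
  shows "r * x \<in> homog w n \<longleftrightarrow> x \<in> homog w n"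
  using homog_cmult[OF assms(1), of x w n] homog_cmult[OF Rats_inverse[OF assms(1)], of "r * x" w n] assms(2)
  by (auto simp: mult.assoc[symmetric])

lemma homog_uminus: "x \<in> homog w n \<Longrightarrow> - x \<in> homog w n"
  using homog_cmult[of "-1" x w n] by simp

text \<open>This is \<open>wp_ode\<close> after cancelling \<open>6 / z ^ 4\<close> and multiplying
  by \<open>z ^ 2\<close>, which turns it into an identity of power series.\<close>

lemma Wp0_recurrence:
  "of_nat ((n + 1) * (n + 2)) * fps_nth Wp0 (n + 2) + (if n = 0 then 10 * g2c else 0) =
     12 * fps_nth Wp0 (n + 2) + 6 * (\<Sum>i=0..n. fps_nth Wp0 i * fps_nth Wp0 (n - i))"
proof -
  let ?L = "fps_X ^ 2 * (fps_deriv (fps_deriv Wp0) + fps_const (10 * g2c))"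
  let ?R = "fps_const 12 * Wp0 + fps_X ^ 2 * (fps_const 6 * (Wp0 * Wp0))"
  have "(\<lambda>z. z ^ 2 * (deriv (deriv wp0) z + 10 * g2c)) has_fps_expansion ?L"
    by (intro fps_expansion_intros wp0_expansion)
  also have "?this \<longleftrightarrow> (\<lambda>z. 12 * wp0 z + z ^ 2 * (6 * (wp0 z * wp0 z))) has_fps_expansion ?L"
  proof (rule has_fps_expansion_cong)
    have "\<forall>\<^sub>F z in nhds 0. z \<in> - gauss'" by (rule eventually_nhds_in_open) auto
    then show "\<forall>\<^sub>F z in nhds 0. z ^ 2 * (deriv (deriv wp0) z + 10 * g2c) = 12 * wp0 z + z ^ 2 * (6 * (wp0 z * wp0 z))"
    proof eventually_elim
      case (elim z)
      show ?case
      proof (cases "z = 0")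
        case True
        have "wp0 0 = fps_nth Wp0 0"
          by (rule has_fps_expansion_imp_0_eq_fps_nth_0[OF wp0_expansion])
        then show ?thesis using True Wp0_eq_0[of 0] by simp
      next
        case False
        then have z: "z \<notin> gauss" using elim by auto
        have "deriv (deriv wp0) z = 6 * (1 / z ^ 2 + wp0 z) ^ 2 - 6 / z ^ 4 - 10 * g2c"
          using wp_ode[OF z] by (simp add: wp_eq[OF z] deriv2_wp[OF z] algebra_simps)
        also have "6 * (1 / z ^ 2 + v) ^ 2 - 6 / z ^ 4 = 12 * v / z ^ 2 + 6 * v ^ 2" for v
          using False by (simp add: power2_eq_square power4_eq_xxxx field_simps)
        finally have "deriv (deriv wp0) z + 10 * g2c = 12 * wp0 z / z ^ 2 + 6 * wp0 z ^ 2" by simp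
        then show ?thesis using False by (simp add: power2_eq_square distrib_left)
      qed
    qed
  qed auto
  finally have "?L = ?R"
    by (rule fps_expansion_unique_complex) (intro fps_expansion_intros wp0_expansion)
  moreover have "fps_nth ?L (n + 2) = of_nat ((n + 1) * (n + 2)) * fps_nth Wp0 (n + 2) + (if n = 0 then 10 * g2c else 0)"
    unfolding fps_X_power_mult_nth by (simp add: algebra_simps)
  moreover have "fps_nth ?R (n + 2) = 12 * fps_nth Wp0 (n + 2) + 6 * fps_nth (Wp0 * Wp0) n"
    unfolding fps_add_nth fps_X_power_mult_nth by simp
  ultimately show ?thesis by (simp only: fps_mult_nth)
qed

section \<open>Weights of the Taylor coefficients of zeta and sigma\<close>

definition Zeta0 :: "complex fps" where "Zeta0 = fps_expansion zeta0 0"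

lemma zeta0_expansion: "zeta0 has_fps_expansion Zeta0"
  unfolding Zeta0_def by (rule has_fps_expansion_fps_expansion[OF open_compl_gauss(2) _ zeta0_holomorphic]) auto

lemma Zeta0_nth_0: "fps_nth Zeta0 0 = 0"
  using has_fps_expansion_imp_0_eq_fps_nth_0[OF zeta0_expansion] by (simp add: zeta0_def)

lemma fps_deriv_Zeta0: "fps_deriv Zeta0 = - Wp0"
proof -
  have "deriv zeta0 has_fps_expansion fps_deriv Zeta0"
    by (intro fps_expansion_intros zeta0_expansion)
  moreover have "deriv zeta0 = (\<lambda>z. - wp0 z)" by (simp add: wp0_def fun_eq_iff)
  ultimately show ?thesis
    using has_fps_expansion_minus[OF wp0_expansion] fps_expansion_unique_complex by metis
qed

text \<open>The Weierstrass sigma function near the origin is \<open>z * sigma_quot z\<close>.\<close>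

lemma sigma_quot_exists:
  "\<exists>S. S 0 = 1 \<and> (\<forall>z\<in>ball 0 1. S z \<noteq> 0 \<and> (S has_field_derivative zeta0 z * S z) (at z))"
proof -
  have "zeta0 holomorphic_on ball 0 1"
    using holomorphic_on_subset[OF zeta0_holomorphic ball_subset_compl_gauss] .
  then obtain K where K: "\<And>z. z \<in> ball 0 1 \<Longrightarrow> (K has_field_derivative zeta0 z) (at z within ball 0 1)"
    by (rule holomorphic_convex_primitive'[rotated 2]) auto
  have "(K has_field_derivative zeta0 z) (at z)" if "z \<in> ball 0 1" for z
    using K[OF that] at_within_open[OF that] by simp
  then show ?thesis
    by (intro exI[of _ "\<lambda>z. exp (K z - K 0)"]) (auto intro!: derivative_eq_intros simp: mult.commute)
qed

definition sigma_quot :: "complex \<Rightarrow> complex" where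
  "sigma_quot = (SOME S. S 0 = 1 \<and> (\<forall>z\<in>ball 0 1. S z \<noteq> 0 \<and> (S has_field_derivative zeta0 z * S z) (at z)))"

lemma sigma_quot: "sigma_quot 0 = 1"
  "z \<in> ball 0 1 \<Longrightarrow> sigma_quot z \<noteq> 0"
  "z \<in> ball 0 1 \<Longrightarrow> (sigma_quot has_field_derivative zeta0 z * sigma_quot z) (at z)"
  using someI_ex[OF sigma_quot_exists] unfolding sigma_quot_def[symmetric] by auto

lemma sigma_quot_holomorphic: "sigma_quot holomorphic_on ball 0 1"
  using sigma_quot(3) unfolding holomorphic_on_open[OF open_ball] by blast

definition Sigma_quot :: "complex fps" where "Sigma_quot = fps_expansion sigma_quot 0"

lemma sigma_quot_expansion: "sigma_quot has_fps_expansion Sigma_quot"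
  unfolding Sigma_quot_def by (rule has_fps_expansion_fps_expansion[OF _ _ sigma_quot_holomorphic]) auto

lemma Sigma_quot_nth_0 [simp]: "fps_nth Sigma_quot 0 = 1"
  using has_fps_expansion_imp_0_eq_fps_nth_0[OF sigma_quot_expansion] by (simp add: sigma_quot(1))

lemma fps_deriv_Sigma_quot: "fps_deriv Sigma_quot = Zeta0 * Sigma_quot"
proof -
  have "deriv sigma_quot has_fps_expansion fps_deriv Sigma_quot"
    by (intro fps_expansion_intros sigma_quot_expansion)
  also have "?this \<longleftrightarrow> (\<lambda>z. zeta0 z * sigma_quot z) has_fps_expansion fps_deriv Sigma_quot"
  proof (rule has_fps_expansion_cong)
    have "\<forall>\<^sub>F z :: complex in nhds 0. z \<in> ball 0 1" by (rule eventually_nhds_in_open) auto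
    then show "\<forall>\<^sub>F z in nhds 0. deriv sigma_quot z = zeta0 z * sigma_quot z"
      by eventually_elim (rule DERIV_imp_deriv, rule sigma_quot)
  qed auto
  finally show ?thesis
    by (rule fps_expansion_unique_complex) (intro fps_expansion_intros sigma_quot_expansion zeta0_expansion)
qed

text \<open>In this normalisation \<open>wp_ode\<close> has right-hand side
  \<open>6 * wp z ^ 2 - 2 * w ^ 4\<close>. The value of \<open>w\<close> is left open:
  \<open>gsum_eq\<close> inserts the Beta value, while \<open>g2c_nonzero\<close> uses
  \<open>w = 0\<close>.\<close>

context
  fixes w :: complex
  assumes w: "g2c = w ^ 4 / 5"
begin

text \<open>For \<open>n = m + 2\<close> the recurrence determines the coefficient unless
  \<open>(m + 1) * (m + 2) = 12\<close>, that is \<open>m = 2\<close>; the coefficient for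
  \<open>n = 4\<close> vanishes by symmetry. The case \<open>n = 2\<close> is the normalisation of
  \<open>g2c\<close>.\<close>

lemma Wp0_homog: "fps_nth Wp0 n \<in> homog w (n + 2)"
proof (induction n rule: less_induct)
  case (less n)
  consider "n < 2" | "n = 2" | "n = 4" | m where "n = m + 2" "m \<noteq> 0" "m \<noteq> 2"
    by (metis add.commute add_2_eq_Suc' le_Suc_ex linorder_not_le numeral_Bit0 add_0)
  then show ?case
  proof cases
    case 1
    then have "n mod 4 \<noteq> 2" by auto
    then show ?thesis by (simp add: Wp0_eq_0)
  next
    case 2
    have "w ^ 4 / 5 = (1 / 5) * w ^ 4" by simp
    then show ?thesis
      using w unfolding 2 g2c_def[symmetric] homog_def by (auto intro!: exI[of _ "1/5"])
  next
    case 3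
    then show ?thesis by (simp add: Wp0_eq_0)
  next
    case 4
    have "(of_nat ((m + 1) * (m + 2)) - 12) * fps_nth Wp0 (m + 2) =
        6 * (\<Sum>i=0..m. fps_nth Wp0 i * fps_nth Wp0 (m - i))"
      using Wp0_recurrence[of m] 4 by (simp add: algebra_simps)
    moreover have "6 * (\<Sum>i=0..m. fps_nth Wp0 i * fps_nth Wp0 (m - i)) \<in> homog w (n + 2)"
      by (intro homog_cmult homog_sum homog_mult[OF less.IH less.IH]) (use 4 in auto)
    moreover have "(of_nat ((m + 1) * (m + 2)) - 12 :: complex) \<noteq> 0"
    proof
      assume "(of_nat ((m + 1) * (m + 2)) - 12 :: complex) = 0"
      then have "(of_nat ((m + 1) * (m + 2)) :: complex) = of_nat 12" by simp
      then have eq: "(m + 1) * (m + 2) = 12" using of_nat_eq_iff by blast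
      then show False
      proof (cases "m \<le> 2")
        case True
        then show False using eq 4 by (auto simp: le_Suc_eq numeral_2_eq_2)
      next
        case False
        then have "4 * 5 \<le> (m + 1) * (m + 2)" by (intro mult_le_mono) auto
        then show False using eq by simp
      qed
    qed
    moreover have "(of_nat ((m + 1) * (m + 2)) - 12 :: complex) \<in> \<rat>" by (intro Rats_diff) auto
    ultimately show ?thesis using homog_cmult_iff 4 by metis
  qed
qed

lemma Zeta0_homog: "fps_nth Zeta0 n \<in> homog w (n + 1)"
proof (cases n)
  case (Suc m)
  have "fps_nth (fps_deriv Zeta0) m = - fps_nth Wp0 m" by (simp add: fps_deriv_Zeta0)
  then have "of_nat (Suc m) * fps_nth Zeta0 (Suc m) \<in> homog w (m + 2)"
    using Wp0_homog[of m] by (simp add: homog_uminus)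
  then show ?thesis
    using homog_cmult_iff[of "of_nat (Suc m)"] Suc by (simp del: of_nat_Suc)
qed (simp add: Zeta0_nth_0)

lemma Sigma_quot_homog: "fps_nth Sigma_quot n \<in> homog w n"
proof (induction n rule: less_induct)
  case (less n)
  show ?case
  proof (cases n)
    case 0
    then show ?thesis by (simp add: homog_Rats)
  next
    case (Suc m)
    have "of_nat (Suc m) * fps_nth Sigma_quot (Suc m) = (\<Sum>i=0..m. fps_nth Zeta0 i * fps_nth Sigma_quot (m - i))"
      using arg_cong[OF fps_deriv_Sigma_quot, of "\<lambda>F. fps_nth F m"] by (simp add: fps_mult_nth)
    also have "\<dots> \<in> homog w n"
      by (intro homog_sum homog_mult[OF Zeta0_homog less.IH]) (use Suc in auto)
    finally show ?thesis
      using homog_cmult_iff[of "of_nat (Suc m)"] Suc by (simp del: of_nat_Suc)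
  qed
qed

lemma inverse_Sigma_quot_homog: "fps_nth (inverse Sigma_quot) n \<in> homog w n"
proof (induction n rule: less_induct)
  case (less n)
  show ?case
  proof (cases n)
    case 0
    then show ?thesis by (simp add: homog_Rats)
  next
    case (Suc m)
    have "Sigma_quot * inverse Sigma_quot = 1" by (rule inverse_mult_eq_1') simp
    then have "0 = (\<Sum>i=0..n. fps_nth Sigma_quot i * fps_nth (inverse Sigma_quot) (n - i))"
      by (metis Suc fps_mult_nth fps_one_nth nat.distinct(1))
    also have "\<dots> = fps_nth (inverse Sigma_quot) n + (\<Sum>i=1..n. fps_nth Sigma_quot i * fps_nth (inverse Sigma_quot) (n - i))"
      by (simp add: sum.atLeast_Suc_atMost)
    finally have "fps_nth (inverse Sigma_quot) n = - (\<Sum>i=1..n. fps_nth Sigma_quot i * fps_nth (inverse Sigma_quot) (n - i))"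
      by (simp add: eq_neg_iff_add_eq_0)
    also have "\<dots> \<in> homog w n"
      by (intro homog_uminus homog_sum homog_mult[OF Sigma_quot_homog less.IH]) auto
    finally show ?thesis .
  qed
qed

end

section \<open>Kronecker's function\<close>

text \<open>\<open>sigma_coeff j z\<close> is \<open>\<sigma>\<^sup>(\<^sup>j\<^sup>)(z) / (j! \<sigma>(z))\<close>, the coefficient of \<open>u\<^sup>j\<close> in \<open>\<sigma>(z + u) / \<sigma>(z)\<close>; the recursion avoids
  constructing \<open>\<sigma>\<close> globally.\<close>

fun sigma_coeff :: "nat \<Rightarrow> complex \<Rightarrow> complex" where
  "sigma_coeff 0 = (\<lambda>z. 1)"
| "sigma_coeff (Suc j) = (\<lambda>z. (deriv (sigma_coeff j) z + zeta z * sigma_coeff j z) / of_nat (Suc j))"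

lemma sigma_coeff_holomorphic: "sigma_coeff j holomorphic_on - gauss"
proof (induction j)
  case (Suc j)
  then show ?case
    by (auto intro!: holomorphic_intros holomorphic_deriv zeta_holomorphic simp del: of_nat_Suc)
qed (auto intro: holomorphic_intros)

lemma sigma_coeff_Suc_mult:
  "of_nat (Suc j) * sigma_coeff (Suc j) z = deriv (sigma_coeff j) z + zeta z * sigma_coeff j z"
  by (simp del: of_nat_Suc)

text \<open>In generating functions: translating \<open>z\<close> by \<open>q\<close> multiplies
  \<open>\<sigma>(z + u) / \<sigma>(z)\<close> by \<open>exp (pi * cnj q * u)\<close>, since
  \<open>zeta\<close> gains \<open>pi * cnj q\<close>.\<close>

lemma sigma_coeff_shift:
  assumes "q \<in> gauss" "z \<notin> gauss"
  shows "sigma_coeff j (z + q) = (\<Sum>i\<le>j. (of_real pi * cnj q) ^ i / fact i * sigma_coeff (j - i) z)"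
  using assms(2)
proof (induction j arbitrary: z)
  case (Suc j)
  define c where "c = of_real pi * cnj q"
  define a where "a = (\<lambda>i. c ^ i / fact i)"
  let ?e = sigma_coeff
  have "deriv (?e j) (z + q) = deriv (\<lambda>z. ?e j (z + q)) z"
    using deriv_shift[OF sigma_coeff_holomorphic Suc.prems assms(1), of j] by (simp add: DERIV_imp_deriv)
  also have "\<dots> = deriv (\<lambda>z. \<Sum>i\<le>j. a i * ?e (j - i) z) z"
    by (rule deriv_cong_open[of "- gauss"]) (use Suc in \<open>auto simp: a_def c_def\<close>)
  also have "\<dots> = (\<Sum>i\<le>j. a i * deriv (?e (j - i)) z)"
    by (rule DERIV_imp_deriv, intro DERIV_sum DERIV_cmult holomorphic_derivI[OF sigma_coeff_holomorphic])
       (use Suc.prems in auto)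
  finally have d: "deriv (?e j) (z + q) = (\<Sum>i\<le>j. a i * deriv (?e (j - i)) z)" .
  have IH: "?e j (z + q) = (\<Sum>i\<le>j. a i * ?e (j - i) z)"
    using Suc.IH[OF Suc.prems] by (simp add: a_def c_def)
  have "of_nat (Suc j) * ?e (Suc j) (z + q) = deriv (?e j) (z + q) + (zeta z + c) * ?e j (z + q)"
    unfolding sigma_coeff_Suc_mult zeta_shift[OF Suc.prems assms(1)] c_def ..
  also have "\<dots> = (\<Sum>i\<le>j. a i * (deriv (?e (j - i)) z + zeta z * ?e (j - i) z)) + (\<Sum>i\<le>j. c * a i * ?e (j - i) z)"
    unfolding d IH by (simp add: algebra_simps sum.distrib sum_distrib_left)
  also have "(\<Sum>i\<le>j. a i * (deriv (?e (j - i)) z + zeta z * ?e (j - i) z)) =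
      (\<Sum>i\<le>j. a i * (of_nat (Suc j - i) * ?e (Suc j - i) z))"
    unfolding sigma_coeff_Suc_mult[symmetric] by (intro sum.cong refl) (simp add: Suc_diff_le)
  also have "\<dots> = (\<Sum>i\<le>Suc j. a i * (of_nat (Suc j - i) * ?e (Suc j - i) z))"
    by simp
  also have "(\<Sum>i\<le>j. c * a i * ?e (j - i) z) = (\<Sum>i\<le>j. of_nat (Suc i) * a (Suc i) * ?e (Suc j - Suc i) z)"
    by (intro sum.cong refl) (simp add: a_def del: of_nat_Suc)
  also have "\<dots> = (\<Sum>i\<le>Suc j. of_nat i * a i * ?e (Suc j - i) z)"
    by (subst sum.atMost_Suc_shift) simp
  \<comment> \<open>The factor \<open>Suc j\<close> splits as \<open>(Suc j - i) + i\<close>: the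
    first part comes from the recursion for \<open>sigma_coeff\<close>, the second from the
    quasi-period \<open>c\<close>.\<close>
  also have "(\<Sum>i\<le>Suc j. a i * (of_nat (Suc j - i) * ?e (Suc j - i) z)) + (\<Sum>i\<le>Suc j. of_nat i * a i * ?e (Suc j - i) z) =
      (\<Sum>i\<le>Suc j. of_nat (Suc j) * (a i * ?e (Suc j - i) z))"
    unfolding sum.distrib[symmetric]
    by (intro sum.cong refl) (auto simp: of_nat_diff algebra_simps)
  also have "\<dots> = of_nat (Suc j) * (\<Sum>i\<le>Suc j. a i * ?e (Suc j - i) z)"
    by (simp only: sum_distrib_left)
  finally have "?e (Suc j) (z + q) = (\<Sum>i\<le>Suc j. a i * ?e (Suc j - i) z)"
    by (subst (asm) mult_left_cancel) (simp_all only: of_nat_eq_0_iff nat.simps, simp)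
  then show ?case by (simp only: a_def c_def)
qed simp

text \<open>The coefficient of \<open>u ^ (n - 1)\<close> in Kronecker's function \<open>\<sigma>(z + u) / (\<sigma>(z) \<sigma>(u))\<close>.\<close>

definition kron :: "nat \<Rightarrow> complex \<Rightarrow> complex" where
  "kron n z = fps_nth (Abs_fps (\<lambda>j. sigma_coeff j z) * inverse Sigma_quot) n"

lemma kron_altdef: "kron n z = (\<Sum>j=0..n. sigma_coeff j z * fps_nth (inverse Sigma_quot) (n - j))"
  by (simp add: kron_def fps_mult_nth)

lemma kron_0: "kron 0 z = 1" by (simp add: kron_altdef)

lemma kron_holomorphic: "kron n holomorphic_on - gauss"
  unfolding kron_altdef[abs_def] by (intro holomorphic_intros sigma_coeff_holomorphic)

text \<open>The exponential factor of \<open>sigma_coeff_shift\<close> passes through the product,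
  as \<open>inverse Sigma_quot\<close> does not involve \<open>z\<close>.\<close>

lemma kron_shift:
  assumes "q \<in> gauss" "z \<notin> gauss"
  shows "kron n (z + q) = (\<Sum>i\<le>n. (of_real pi * cnj q) ^ i / fact i * kron (n - i) z)"
proof -
  have "Abs_fps (\<lambda>j. sigma_coeff j (z + q)) = fps_exp (of_real pi * cnj q) * Abs_fps (\<lambda>j. sigma_coeff j z)"
    by (rule fps_ext) (simp add: fps_mult_nth sigma_coeff_shift[OF assms] atMost_atLeast0)
  then have "kron n (z + q) =
      fps_nth (fps_exp (of_real pi * cnj q) * (Abs_fps (\<lambda>j. sigma_coeff j z) * inverse Sigma_quot)) n"
    by (simp add: kron_def mult.assoc)
  then show ?thesis
    by (simp add: fps_mult_nth[of "fps_exp _"] kron_def[symmetric] atMost_atLeast0)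
qed

section \<open>The coefficients of Kronecker's function near the origin\<close>

definition wsigma :: "complex \<Rightarrow> complex" where "wsigma z = z * sigma_quot z"

lemma wsigma_holomorphic: "wsigma holomorphic_on ball 0 1"
  unfolding wsigma_def[abs_def] by (intro holomorphic_intros sigma_quot_holomorphic)

lemma wsigma_expansion: "wsigma has_fps_expansion fps_X * Sigma_quot"
  unfolding wsigma_def[abs_def] by (intro fps_expansion_intros sigma_quot_expansion)

lemma ball_not_gauss: "z \<in> ball 0 1 - {0} \<Longrightarrow> z \<notin> gauss"
  using ball_subset_compl_gauss by auto

text \<open>Near 0 the recursion really yields the normalised derivatives of sigma, because
  \<open>wsigma\<close> has logarithmic derivative \<open>zeta\<close>.\<close>

lemma sigma_coeff_mult_wsigma:
  assumes "z \<in> ball 0 1 - {0}"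
  shows "sigma_coeff j z * wsigma z = (deriv ^^ j) wsigma z / fact j"
  using assms
proof (induction j arbitrary: z)
  case (Suc j)
  let ?e = sigma_coeff
  have z: "z \<notin> gauss" "z \<noteq> 0" using Suc.prems ball_not_gauss by auto
  have "deriv (\<lambda>z. ?e j z * wsigma z) z = deriv (\<lambda>z. (deriv ^^ j) wsigma z / fact j) z"
    by (rule deriv_cong_open[of "ball 0 1 - {0}"]) (use Suc in auto)
  also have "\<dots> = (deriv ^^ Suc j) wsigma z / fact j"
  proof (rule DERIV_imp_deriv, rule DERIV_cdivide)
    show "((deriv ^^ j) wsigma has_field_derivative (deriv ^^ Suc j) wsigma z) (at z)"
      using Suc.prems holomorphic_derivI[OF holomorphic_higher_deriv[OF wsigma_holomorphic]] by simp
  qed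
  also have "deriv (\<lambda>z. ?e j z * wsigma z) z = deriv (?e j) z * wsigma z + ?e j z * (zeta z * wsigma z)"
  proof (rule DERIV_imp_deriv)
    have "(wsigma has_field_derivative (1 * sigma_quot z + z * (zeta0 z * sigma_quot z))) (at z)"
      unfolding wsigma_def[abs_def] using Suc.prems
      by (auto intro!: derivative_eq_intros sigma_quot(3))
    also have "1 * sigma_quot z + z * (zeta0 z * sigma_quot z) = zeta z * wsigma z"
      using z by (simp add: zeta_def wsigma_def algebra_simps)
    finally have "(wsigma has_field_derivative zeta z * wsigma z) (at z)" .
    then show "((\<lambda>z. ?e j z * wsigma z) has_field_derivative deriv (?e j) z * wsigma z + ?e j z * (zeta z * wsigma z)) (at z)"
      using z by (auto intro!: derivative_eq_intros holomorphic_derivI[OF sigma_coeff_holomorphic])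
  qed
  also have "\<dots> = of_nat (Suc j) * ?e (Suc j) z * wsigma z"
    unfolding sigma_coeff_Suc_mult by (simp add: algebra_simps)
  finally show ?case
    by (simp add: field_simps del: of_nat_Suc)
qed simp

text \<open>The product of \<open>kron n\<close> with \<open>wsigma\<close> near 0: a combination of
  derivatives of sigma, hence regular there.\<close>

definition kron_num :: "nat \<Rightarrow> complex \<Rightarrow> complex" where
  "kron_num n z = (\<Sum>j=0..n. fps_nth (inverse Sigma_quot) (n - j) / fact j * (deriv ^^ j) wsigma z)"

definition Kron_num :: "nat \<Rightarrow> complex fps" where
  "Kron_num n = (\<Sum>j=0..n. fps_const (fps_nth (inverse Sigma_quot) (n - j) / fact j) * (fps_deriv ^^ j) (fps_X * Sigma_quot))"

lemma has_fps_expansion_higher_deriv: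
  "f has_fps_expansion F \<Longrightarrow> (deriv ^^ j) f has_fps_expansion (fps_deriv ^^ j) F"
  by (induction j) (auto intro: fps_expansion_intros)

lemma kron_num_expansion: "kron_num n has_fps_expansion Kron_num n"
  unfolding kron_num_def[abs_def] Kron_num_def
  by (intro fps_expansion_intros has_fps_expansion_higher_deriv wsigma_expansion)

lemma kron_mult_wsigma:
  assumes "z \<in> ball 0 1 - {0}"
  shows "kron n z * wsigma z = kron_num n z"
  unfolding kron_altdef kron_num_def sum_distrib_right
proof (intro sum.cong refl)
  fix j
  have "sigma_coeff j z * fps_nth (inverse Sigma_quot) (n - j) * wsigma z =
      fps_nth (inverse Sigma_quot) (n - j) * (sigma_coeff j z * wsigma z)" by simp
  then show "sigma_coeff j z * fps_nth (inverse Sigma_quot) (n - j) * wsigma z =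
      fps_nth (inverse Sigma_quot) (n - j) / fact j * (deriv ^^ j) wsigma z"
    by (simp add: sigma_coeff_mult_wsigma[OF assms])
qed

lemma fps_nth_higher_fps_deriv:
  fixes F :: "complex fps"
  shows "fps_nth ((fps_deriv ^^ j) F) k = fact (k + j) / fact k * fps_nth F (k + j)"
proof (induction j arbitrary: k)
  case (Suc j)
  have "fps_nth ((fps_deriv ^^ Suc j) F) k = of_nat (Suc k) * fps_nth ((fps_deriv ^^ j) F) (Suc k)" by simp
  also have "\<dots> = fact (k + Suc j) / fact k * fps_nth F (k + Suc j)"
    unfolding Suc.IH by (simp add: field_simps del: of_nat_Suc) (simp add: algebra_simps)?
  finally show ?case .
qed simp

text \<open>At \<open>z = 0\<close> the numerators have generating function
  \<open>u * Sigma_quot\<close> times \<open>inverse Sigma_quot\<close>, which is \<open>u\<close>.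
  So the simple zero of sigma is cancelled for every \<open>n\<close> except 1, where
  \<open>kron 1\<close> keeps the pole of \<open>zeta\<close>.\<close>

lemma Kron_num_nth_0:
  assumes "n \<noteq> 1"
  shows "fps_nth (Kron_num n) 0 = 0"
proof -
  have "fps_nth (Kron_num n) 0 = (\<Sum>j=0..n. fps_nth (fps_X * Sigma_quot) j * fps_nth (inverse Sigma_quot) (n - j))"
    by (simp only: Kron_num_def fps_sum_nth fps_mult_left_const_nth fps_nth_higher_fps_deriv) (simp add: mult_ac)
  also have "\<dots> = fps_nth (fps_X * (Sigma_quot * inverse Sigma_quot)) n"
    by (simp only: fps_mult_nth mult.assoc[symmetric])
  also have "Sigma_quot * inverse Sigma_quot = 1" by (rule inverse_mult_eq_1') simp
  finally show ?thesis using assms by simp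
qed

lemma kron_regular:
  assumes "n \<noteq> 1"
  obtains g where "g has_fps_expansion fps_shift 1 (Kron_num n) * inverse Sigma_quot"
    "\<forall>\<^sub>F z in at 0. kron n z = g z"
proof -
  obtain g where g: "g has_fps_expansion fps_shift 1 (Kron_num n)" "\<forall>\<^sub>F z in nhds 0. kron_num n z = z ^ 1 * g z"
    by (rule fps_expansion_divide_power[OF kron_num_expansion, of 1 n]) (use Kron_num_nth_0[OF assms] in auto)
  show thesis
  proof (rule that)
    show "(\<lambda>z. g z * inverse (sigma_quot z)) has_fps_expansion fps_shift 1 (Kron_num n) * inverse Sigma_quot"
      by (intro fps_expansion_intros g sigma_quot_expansion) auto
    have "\<forall>\<^sub>F z in at 0. z \<in> ball 0 1 - {0 :: complex}" by (rule eventually_at_in_open) auto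
    moreover have "\<forall>\<^sub>F z in at 0. kron_num n z = z * g z"
      using g(2) by (auto simp: eventually_at_filter elim: eventually_mono)
    ultimately show "\<forall>\<^sub>F z in at 0. kron n z = g z * inverse (sigma_quot z)"
    proof eventually_elim
      case (elim z)
      then show ?case
        using kron_mult_wsigma[of z n] sigma_quot(2)[of z] by (auto simp: wsigma_def field_simps)
    qed
  qed
qed

lemma fact_in_Rats: "(fact n :: 'a :: field_char_0) \<in> \<rat>"
  by (metis of_nat_fact Rats_of_nat)

text \<open>Every ingredient is a Taylor coefficient whose weight is its index, and differentiation
  contributes rational factors only. The shift by 1 compensates the factor \<open>fps_X\<close> in
  sigma.\<close>

lemma kron_coeff_homog:
  assumes "g2c = w ^ 4 / 5"
  shows "fps_nth (fps_shift 1 (Kron_num n) * inverse Sigma_quot) k \<in> homog w (n + k)"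
proof -
  have num: "fps_nth (Kron_num n) (Suc k) \<in> homog w (n + k)" for k
    unfolding Kron_num_def fps_sum_nth fps_mult_left_const_nth fps_nth_higher_fps_deriv
  proof (rule homog_sum)
    fix j assume j: "j \<in> {0..n}"
    have "fps_nth (inverse Sigma_quot) (n - j) * fps_nth Sigma_quot (k + j) \<in> homog w (n + k)"
      by (rule homog_mult[OF inverse_Sigma_quot_homog[OF assms] Sigma_quot_homog[OF assms]]) (use j in auto)
    then have "(1 / fact j * (fact (Suc k + j) / fact (Suc k))) *
        (fps_nth (inverse Sigma_quot) (n - j) * fps_nth Sigma_quot (k + j)) \<in> homog w (n + k)"
      by (rule homog_cmult[rotated]) (intro Rats_mult Rats_divide Rats_1 fact_in_Rats)
    then show "fps_nth (inverse Sigma_quot) (n - j) / fact j *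
        (fact (Suc k + j) / fact (Suc k) * fps_nth (fps_X * Sigma_quot) (Suc k + j)) \<in> homog w (n + k)"
      by (simp add: mult_ac)
  qed
  show ?thesis unfolding fps_mult_nth
    by (rule homog_sum, rule homog_mult[OF _ inverse_Sigma_quot_homog[OF assms]])
       (use num in auto)
qed

section \<open>Rationality of the lattice sums\<close>

lemma deriv_lat_full:
  assumes "b \<ge> t + 3" "z \<notin> gauss"
  shows "(lat_full t b has_field_derivative - of_nat b * lat_full t (Suc b) z) (at z)"
proof -
  have "z \<noteq> 0" using assms by auto
  obtain k where k: "b = Suc k" using assms(1) by (cases b) auto
  have "(lat_sum t b has_field_derivative deriv (lat_sum t b) z) (at z)"
    using assms by (intro holomorphic_derivI[OF lat_sum_holomorphic open_compl_gauss(2)]) auto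
  then have d: "(lat_sum t b has_field_derivative - of_nat b * lat_sum t (Suc b) z) (at z)"
    using assms by (simp add: deriv_lat_sum)
  have "((\<lambda>z. 0 ^ t / z ^ b) has_field_derivative
      (0 * z ^ b - 0 ^ t * (of_nat b * z ^ (b - 1))) / (z ^ b * z ^ b)) (at z)"
    by (rule derivative_eq_intros refl | use \<open>z \<noteq> 0\<close> in simp)+
  moreover have "(0 * z ^ b - 0 ^ t * (of_nat b * z ^ (b - 1))) / (z ^ b * z ^ b) = - of_nat b * (0 ^ t / z ^ Suc b)"
    using \<open>z \<noteq> 0\<close> by (simp add: k field_simps)
  ultimately have "((\<lambda>z. 0 ^ t / z ^ b) has_field_derivative - of_nat b * (0 ^ t / z ^ Suc b)) (at z)"
    by (simp only:)
  from DERIV_add[OF this d] show ?thesis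
    unfolding lat_full_def[abs_def] by (simp only: distrib_left)
qed

lemma lat_full_holomorphic: "b \<ge> t + 3 \<Longrightarrow> lat_full t b holomorphic_on - gauss"
  using deriv_lat_full unfolding holomorphic_on_open[OF open_compl_gauss(1)] by blast

lemma higher_deriv_has_field_derivative:
  assumes "f holomorphic_on - gauss" "z \<notin> gauss"
  shows "((deriv ^^ m) f has_field_derivative (deriv ^^ Suc m) f z) (at z)"
  using holomorphic_derivI[OF holomorphic_higher_deriv[OF assms(1)] open_compl_gauss(1)] assms(2) by auto

lemma higher_deriv_zeta:
  assumes "m \<ge> 2" "z \<notin> gauss"
  shows "(deriv ^^ m) zeta z = (-1) ^ m * fact m * lat_full 0 (Suc m) z"
  using assms
proof (induction m arbitrary: z rule: nat_induct_at_least)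
  case base
  then show ?case using deriv2_zeta by (simp add: numeral_2_eq_2 numeral_3_eq_3)
next
  case (Suc m)
  have "deriv ((deriv ^^ m) zeta) z = deriv (\<lambda>z. (-1) ^ m * fact m * lat_full 0 (Suc m) z) z"
    by (rule deriv_cong_open[OF open_compl_gauss(1)]) (use Suc in auto)
  also have "\<dots> = (-1) ^ m * fact m * (- of_nat (Suc m) * lat_full 0 (Suc (Suc m)) z)"
    by (rule DERIV_imp_deriv, rule DERIV_cmult, rule deriv_lat_full) (use Suc in auto)
  finally show ?case by (simp add: algebra_simps)
qed

lemma higher_deriv_zeta0:
  assumes "m \<ge> 2" "z \<in> - gauss'"
  shows "(deriv ^^ m) zeta0 z = (-1) ^ m * fact m * lat_sum 0 (Suc m) z"
  using assms
proof (induction m arbitrary: z rule: nat_induct_at_least)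
  case base
  then show ?case using deriv2_zeta0[of z] by (simp add: numeral_2_eq_2 numeral_3_eq_3)
next
  case (Suc m)
  have "deriv ((deriv ^^ m) zeta0) z = deriv (\<lambda>z. (-1) ^ m * fact m * lat_sum 0 (Suc m) z) z"
    by (rule deriv_cong_open[OF open_compl_gauss(2)]) (use Suc in auto)
  also have "\<dots> = (-1) ^ m * fact m * deriv (lat_sum 0 (Suc m)) z"
    by (rule deriv_cmult, rule holomorphic_on_imp_differentiable_at[OF lat_sum_holomorphic open_compl_gauss(2)])
       (use Suc in auto)
  also have "deriv (lat_sum 0 (Suc m)) z = - of_nat (Suc m) * lat_sum 0 (Suc (Suc m)) z"
    by (rule deriv_lat_sum) (use Suc in auto)
  finally show ?case by (simp add: algebra_simps)
qed

lemma kron_1: "kron 1 z = zeta z + fps_nth (inverse Sigma_quot) 1"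
  by (simp add: kron_altdef)

text \<open>Compared with \<open>kron_shift\<close> the last term is missing: it belongs to
  \<open>kron 0\<close>, a constant, which a derivative of positive order kills.\<close>

lemma higher_deriv_kron_shift:
  assumes "m > 0" "q \<in> gauss" "z \<notin> gauss"
  shows "(deriv ^^ m) (kron (Suc t)) (z + q) =
    (\<Sum>i\<le>t. (of_real pi * cnj q) ^ i / fact i * (deriv ^^ m) (kron (Suc (t - i))) z)"
proof -
  let ?a = "\<lambda>i. (of_real pi * cnj q) ^ i / fact i"
  have "(deriv ^^ m) (kron (Suc t)) (z + q) = (deriv ^^ m) (\<lambda>z. kron (Suc t) (1 * z + q)) z"
    by (subst higher_deriv_compose_linear'[OF kron_holomorphic open_compl_gauss(1) open_compl_gauss(1)])
       (use assms in auto)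
  also have "\<dots> = (deriv ^^ m) (\<lambda>z. \<Sum>i\<le>Suc t. ?a i * kron (Suc t - i) z) z"
  proof (rule higher_deriv_transform_within_open[where S = "- gauss"])
    show "(\<lambda>z. kron (Suc t) (1 * z + q)) holomorphic_on - gauss"
      by (rule holomorphic_on_compose_gen[OF _ kron_holomorphic, unfolded o_def])
         (use assms in \<open>auto intro!: holomorphic_intros\<close>)
  qed (use assms in \<open>auto intro!: holomorphic_intros kron_holomorphic simp: kron_shift\<close>)
  also have "\<dots> = (\<Sum>i\<le>Suc t. (deriv ^^ m) (\<lambda>z. ?a i * kron (Suc t - i) z) z)"
    by (rule higher_deriv_sum[where S = "- gauss"]) (use assms in \<open>auto intro!: holomorphic_intros kron_holomorphic\<close>)
  also have "\<dots> = (\<Sum>i\<le>Suc t. ?a i * (deriv ^^ m) (kron (Suc t - i)) z)"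
    by (intro sum.cong refl higher_deriv_cmult[OF kron_holomorphic]) (use assms in auto)
  also have "\<dots> = (\<Sum>i\<le>t. ?a i * (deriv ^^ m) (kron (Suc (t - i))) z)"
    using assms(1) by (simp add: kron_0[abs_def] Suc_diff_le)
  finally show ?thesis .
qed

text \<open>The factor \<open>pi ^ t / fact t\<close> is chosen so that the coefficients agree with
  those of \<open>higher_deriv_kron_shift\<close>.\<close>

lemma lat_full_shift':
  assumes "b \<ge> t + 3" "z \<notin> gauss" "q \<in> gauss"
  shows "of_real pi ^ t / fact t * lat_full t b (z + q) =
    (\<Sum>i\<le>t. (of_real pi * cnj q) ^ i / fact i * (of_real pi ^ (t - i) / fact (t - i) * lat_full (t - i) b z))"
proof -
  have "of_real pi ^ t / fact t * lat_full t b (z + q) =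
    (\<Sum>j\<le>t. of_real pi ^ t / fact t * (of_nat (t choose j) * cnj q ^ (t - j) * lat_full j b z))"
    by (simp add: lat_full_shift[OF assms] sum_distrib_left)
  also have "\<dots> = (\<Sum>j\<le>t. (of_real pi * cnj q) ^ (t - j) / fact (t - j) * (of_real pi ^ j / fact j * lat_full j b z))"
  proof (intro sum.cong refl)
    fix j assume "j \<in> {..t}"
    then have j: "j \<le> t" by simp
    then have "of_real pi ^ t = (of_real pi ^ j * of_real pi ^ (t - j) :: complex)"
      by (simp flip: power_add)
    then show "of_real pi ^ t / fact t * (of_nat (t choose j) * cnj q ^ (t - j) * lat_full j b z) =
        (of_real pi * cnj q) ^ (t - j) / fact (t - j) * (of_real pi ^ j / fact j * lat_full j b z)"
      by (simp add: binomial_fact[OF j] power_mult_distrib mult_ac)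
  qed
  also have "\<dots> = (\<Sum>i\<le>t. (of_real pi * cnj q) ^ i / fact i * (of_real pi ^ (t - i) / fact (t - i) * lat_full (t - i) b z))"
    by (rule sum.reindex_bij_witness[of _ "\<lambda>i. t - i" "\<lambda>i. t - i"]) auto
  finally show ?thesis .
qed

lemma lat_sum_tendsto:
  assumes "b \<ge> t + 3"
  shows "(lat_sum t b \<longlongrightarrow> lat_sum t b 0) (at 0)"
proof -
  have "isCont (lat_sum t b) 0"
    by (rule holomorphic_on_imp_continuous_on[OF lat_sum_holomorphic, THEN continuous_on_interior])
       (use assms in \<open>auto simp: interior_open\<close>)
  then show ?thesis by (simp add: isCont_def)
qed

lemma higher_deriv_kron_tendsto:
  assumes "n \<noteq> 1"
  shows "((deriv ^^ m) (kron n) \<longlongrightarrow> fact m * fps_nth (fps_shift 1 (Kron_num n) * inverse Sigma_quot) m) (at 0)"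
proof -
  obtain g where g: "g has_fps_expansion fps_shift 1 (Kron_num n) * inverse Sigma_quot"
      "\<forall>\<^sub>F z in at 0. kron n z = g z"
    using kron_regular[OF assms] by auto
  have "((deriv ^^ m) g \<longlongrightarrow> fps_nth ((fps_deriv ^^ m) (fps_shift 1 (Kron_num n) * inverse Sigma_quot)) 0) (at 0)"
    using has_fps_expansion_imp_tendsto_0[OF has_fps_expansion_higher_deriv[OF g(1)]]
    by (simp add: tendsto_nhds_iff)
  then have "((deriv ^^ m) g \<longlongrightarrow> fact m * fps_nth (fps_shift 1 (Kron_num n) * inverse Sigma_quot) m) (at 0)"
    by (simp only: fps_0th_higher_deriv)
  then show ?thesis
  proof (rule Lim_transform_eventually)
    obtain A where A: "open A" "0 \<in> A" "\<And>z. z \<in> A - {0} \<Longrightarrow> kron n z = g z"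
      using g(2) unfolding eventually_at_topological by blast
    have "\<forall>\<^sub>F z in at 0. z \<in> A - {0}" by (rule eventually_at_in_open) fact+
    then show "\<forall>\<^sub>F z in at 0. (deriv ^^ m) g z = (deriv ^^ m) (kron n) z"
    proof eventually_elim
      case (elim z)
      have "\<forall>\<^sub>F y in nhds z. y \<in> A - {0}"
        by (rule eventually_nhds_in_open) (use A elim in auto)
      then have "\<forall>\<^sub>F y in nhds z. g y = kron n y"
        by eventually_elim (use A in auto)
      then show ?case by (rule higher_deriv_cong_ev) auto
    qed
  qed
qed

text \<open>Both sides obey the same translation law, and for smaller \<open>t\<close> they already
  agree. So their difference is periodic, and \<open>gauss_periodic_constant\<close> applies to
  it.\<close>

lemma higher_deriv_kron:
  assumes "m \<ge> t + 3" "z \<notin> gauss"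
  shows "(-1) ^ m / fact m * (deriv ^^ m) (kron (Suc t)) z = of_real pi ^ t / fact t * lat_full t (Suc m) z"
  using assms
proof (induction t arbitrary: m z rule: less_induct)
  case (less t)
  show ?case
  proof (cases "t = 0")
    case True
    have "(deriv ^^ m) (kron 1) z = (deriv ^^ m) (\<lambda>z. zeta z + fps_nth (inverse Sigma_quot) 1) z"
      by (simp only: kron_1[abs_def])
    also have "\<dots> = (deriv ^^ m) zeta z + (deriv ^^ m) (\<lambda>z. fps_nth (inverse Sigma_quot) 1) z"
      by (rule higher_deriv_add[OF zeta_holomorphic _ open_compl_gauss(1)]) (use less.prems in auto)
    also have "\<dots> = (-1) ^ m * fact m * lat_full 0 (Suc m) z"
      using less.prems by (simp add: higher_deriv_zeta)
    finally show ?thesis using True by (simp flip: power_mult_distrib)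
  next
    case False
    \<comment> \<open>The comparison is made one derivative earlier, because Liouville's theorem
      only yields a constant. The bound on \<open>n\<close> still allows the induction hypothesis
      for all \<open>j < t\<close>.\<close>
    obtain n where m: "m = Suc n" "n \<ge> t + 2" using less.prems by (cases m) auto
    define D where "D = (\<lambda>t z. (-1) ^ n / fact n * (deriv ^^ n) (kron (Suc t)) z -
      of_real pi ^ t / fact t * lat_full t (Suc n) z)"
    have D0: "D j y = 0" if "j < t" "y \<notin> gauss" for j y
      using less.IH[of j n y] that m by (simp add: D_def)
    have shift: "D t (y + q) = D t y" if y: "y \<notin> gauss" "q \<in> gauss" for y q
    proof -
      let ?a = "\<lambda>i. (of_real pi * cnj q) ^ i / fact i"
      have "D t (y + q) = (\<Sum>i\<le>t. ?a i * D (t - i) y)"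
        unfolding D_def
        by (subst higher_deriv_kron_shift, use m y in simp, use y in simp, use y in simp,
            subst lat_full_shift', use m in simp, use y in simp, use y in simp)
           (simp add: sum_distrib_left sum_subtractf[symmetric] algebra_simps)
      also have "\<dots> = D t y + (\<Sum>i\<in>{..t} - {0}. ?a i * D (t - i) y)"
        by (subst sum.remove[of _ 0]) auto
      also have "(\<Sum>i\<in>{..t} - {0}. ?a i * D (t - i) y) = 0"
        by (intro sum.neutral ballI) (use D0 y False in auto)
      finally show ?thesis by simp
    qed
    have holo: "D t holomorphic_on - gauss"
      unfolding D_def
      by (intro holomorphic_intros holomorphic_higher_deriv kron_holomorphic lat_full_holomorphic open_compl_gauss)
         (use m in auto)
    define l where "l = (-1) ^ n / fact n * (fact n * fps_nth (fps_shift 1 (Kron_num (Suc t)) * inverse Sigma_quot) n) -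
      of_real pi ^ t / fact t * lat_sum t (Suc n) 0"
    \<comment> \<open>For \<open>t > 0\<close> the lattice point 0 contributes nothing and
      \<open>Suc t \<noteq> 1\<close>, so both parts of \<open>D t\<close> have finite limits at
      0.\<close>
    have "lat_full t (Suc n) = lat_sum t (Suc n)" using False by (simp add: lat_full_def fun_eq_iff)
    then have lim: "(D t \<longlongrightarrow> l) (at 0)"
      by (simp only: D_def l_def, intro tendsto_diff tendsto_mult tendsto_const higher_deriv_kron_tendsto lat_sum_tendsto)
         (use False m in auto)
    have const: "D t y = l" if "y \<notin> gauss" for y
      by (rule gauss_periodic_constant[OF holo shift lim that])
    have z: "z \<notin> gauss" by fact
    have "(D t has_field_derivative
        (-1) ^ n / fact n * (deriv ^^ Suc n) (kron (Suc t)) z -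
        of_real pi ^ t / fact t * (- of_nat (Suc n) * lat_full t (Suc (Suc n)) z)) (at z)"
      unfolding D_def
      by (intro DERIV_diff DERIV_cmult higher_deriv_has_field_derivative kron_holomorphic deriv_lat_full z)
         (use m in auto)
    moreover have "deriv (D t) z = deriv (\<lambda>_. l) z"
      by (rule deriv_cong_open[of "- gauss"]) (use const z in auto)
    then have "deriv (D t) z = 0" by simp
    ultimately have "(-1) ^ n / fact n * (deriv ^^ m) (kron (Suc t)) z =
        - of_nat m * (of_real pi ^ t / fact t * lat_full t (Suc m) z)"
      using DERIV_imp_deriv[of "D t"] unfolding m(1) by (metis diff_eq_eq add_0 mult.left_commute)
    then have "- (1 / of_nat m) * ((-1) ^ n / fact n * (deriv ^^ m) (kron (Suc t)) z) =
        of_real pi ^ t / fact t * lat_full t (Suc m) z"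
      using m(1) by (simp del: of_nat_Suc)
    moreover have "- (1 / of_nat m) * ((-1) ^ n / fact n) = ((-1) ^ m / fact m :: complex)"
      using m(1) by (simp add: field_simps del: of_nat_Suc)
    ultimately show ?thesis by (metis mult.assoc)
  qed
qed

text \<open>Letting \<open>z\<close> tend to 0 in \<open>higher_deriv_kron\<close> identifies the
  lattice sum with a coefficient covered by \<open>kron_coeff_homog\<close>. For
  \<open>t = 0\<close> both sides have a pole, and the regular part \<open>zeta0\<close> is used
  instead.\<close>

theorem lat_sum_homog:
  assumes w: "g2c = w ^ 4 / 5" and b: "b \<ge> t + 4"
  shows "of_real pi ^ t * lat_sum t b 0 \<in> homog w (t + b)"
proof -
  obtain m where m: "b = Suc m" "m \<ge> t + 3" using b by (cases b) auto
  have "of_real pi ^ t / fact t * lat_sum t (Suc m) 0 \<in> homog w (t + Suc m)"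
  proof (cases "t = 0")
    case False
    let ?c = "fps_nth (fps_shift 1 (Kron_num (Suc t)) * inverse Sigma_quot) m"
    have "((\<lambda>z. (-1) ^ m / fact m * (deriv ^^ m) (kron (Suc t)) z) \<longlongrightarrow> (-1) ^ m / fact m * (fact m * ?c)) (at 0)"
      using False by (intro tendsto_mult tendsto_const higher_deriv_kron_tendsto) simp
    moreover have "((\<lambda>z. (-1) ^ m / fact m * (deriv ^^ m) (kron (Suc t)) z) \<longlongrightarrow>
        of_real pi ^ t / fact t * lat_sum t (Suc m) 0) (at 0)"
    proof (rule Lim_transform_eventually)
      show "((\<lambda>z. of_real pi ^ t / fact t * lat_sum t (Suc m) z) \<longlongrightarrow> of_real pi ^ t / fact t * lat_sum t (Suc m) 0) (at 0)"
        by (intro tendsto_mult tendsto_const lat_sum_tendsto) (use m in auto)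
      have "\<forall>\<^sub>F z in at 0. z \<in> - gauss' - {0}" by (rule eventually_at_in_open) auto
      then show "\<forall>\<^sub>F z in at 0. of_real pi ^ t / fact t * lat_sum t (Suc m) z = (-1) ^ m / fact m * (deriv ^^ m) (kron (Suc t)) z"
        by eventually_elim (use higher_deriv_kron[OF m(2)] False in \<open>auto simp: lat_full_def\<close>)
    qed
    ultimately have "of_real pi ^ t / fact t * lat_sum t (Suc m) 0 = (-1) ^ m / fact m * (fact m * ?c)"
      using tendsto_unique trivial_limit_at by blast
    also have "\<dots> = (-1) ^ m * ?c" by simp
    also have "\<dots> \<in> homog w (t + Suc m)"
      using kron_coeff_homog[OF w, of "Suc t" m] by (intro homog_cmult Rats_power) simp_all
    finally show ?thesis .
  next
    case True
    have "(deriv ^^ m) zeta0 0 = (-1) ^ m * fact m * lat_sum 0 (Suc m) 0"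
      by (rule higher_deriv_zeta0) (use m in auto)
    then have "lat_sum 0 (Suc m) 0 = (-1) ^ m * fps_nth Zeta0 m"
      by (simp add: fps_nth_fps_expansion[OF zeta0_expansion] flip: power_mult_distrib)
    also have "\<dots> \<in> homog w (0 + Suc m)"
      using Zeta0_homog[OF w, of m] by (intro homog_cmult Rats_power) simp_all
    finally show ?thesis using True by simp
  qed
  then have "fact t * (of_real pi ^ t / fact t * lat_sum t (Suc m) 0) \<in> homog w (t + Suc m)"
    by (rule homog_cmult[OF fact_in_Rats])
  then show ?thesis using m by simp
qed

section \<open>The real period\<close>

text \<open>The fixed point other than 0 of multiplication by \<open>\<i>\<close> modulo the
  lattice. Since \<open>wp\<close> changes sign under this rotation, it vanishes at
  \<open>qpt\<close>.\<close>

definition qpt :: complex where "qpt = Complex (1/2) (1/2)"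

lemma two_qpt: "qpt + qpt = 1 + \<i>" "2 * qpt = 1 + \<i>"
  by (simp_all add: qpt_def complex_eq_iff)

lemma qpt_notin_gauss: "qpt \<notin> gauss" unfolding qpt_def by (rule half_notin_gauss)

lemma wp_qpt: "wp qpt = 0"
proof -
  have "wp (\<i> * qpt) = wp (qpt + (-1))"
    by (rule arg_cong[where f = wp]) (simp add: qpt_def complex_eq_iff)
  also have "\<dots> = wp qpt" by (rule wp_shift[OF qpt_notin_gauss]) simp
  finally show ?thesis using wp_ii[OF qpt_notin_gauss] by simp
qed

lemma deriv_wp_qpt: "deriv wp qpt = 0"
  using wp_first_integral[OF qpt_notin_gauss] wp_qpt by simp

lemma qpt_mult_gauss:
  assumes "qpt * y \<in> gauss" shows "y \<in> gauss"
proof -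
  have "y = (1 - \<i>) * (qpt * y)" by (simp add: qpt_def complex_eq_iff)
  moreover have "(1 - \<i>) * (qpt * y) \<in> gauss" by (rule gauss_mult[OF _ assms]) (rule gauss_diff; simp)
  ultimately show ?thesis by metis
qed

text \<open>The lattice has index 2 in its multiple by \<open>qpt\<close>, and \<open>qpt\<close>
  itself represents the other coset.\<close>

lemma qpt_mult_cases:
  assumes "q \<in> gauss"
  shows "qpt * q \<in> gauss \<or> qpt * q - qpt \<in> gauss"
proof -
  obtain m n where mn: "Re q = of_int m" "Im q = of_int n"
    using assms by (auto simp: gauss_def elim!: Ints_cases)
  have half: "real_of_int k / 2 \<in> \<int>" if "even k" for k
    using that by (auto elim!: evenE)
  have re: "Re (qpt * q) = of_int (m - n) / 2" "Im (qpt * q) = of_int (m + n) / 2"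
    "Re (qpt * q - qpt) = of_int (m - n - 1) / 2" "Im (qpt * q - qpt) = of_int (m + n - 1) / 2"
    by (simp_all add: qpt_def mn field_simps)
  show ?thesis
  proof (cases "even (m + n)")
    case True
    then have "even (m - n)" by simp
    then have "qpt * q \<in> gauss" unfolding gauss_def mem_Collect_eq re using half True by blast
    then show ?thesis ..
  next
    case False
    then have "even (m - n - 1)" "even (m + n - 1)" by simp_all
    then have "qpt * q - qpt \<in> gauss" unfolding gauss_def mem_Collect_eq re using half by blast
    then show ?thesis ..
  qed
qed

text \<open>Translating \<open>y\<close> by a lattice point fixes or exchanges the two factors, so
  the product is periodic. At 0 the double pole of one meets the double zero of the other, and the
  limit is half of \<open>deriv (deriv wp) qpt = - 10 * g2c\<close>. The identity serves to show
  \<open>wp (1/2) \<noteq> 0\<close>.\<close>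

lemma wp_mult_wp_qpt:
  assumes "y \<notin> gauss"
  shows "wp (qpt * y) * wp (qpt * y + qpt) = - 5 * g2c"
proof (rule gauss_periodic_constant[where f = "\<lambda>y. wp (qpt * y) * wp (qpt * y + qpt)"])
  have ng: "qpt * y \<notin> gauss" "qpt * y + qpt \<notin> gauss" if "y \<notin> gauss" for y
  proof -
    show "qpt * y \<notin> gauss" using qpt_mult_gauss that by blast
    have "qpt * (y + 1) \<notin> gauss" using qpt_mult_gauss[of "y + 1"] that by auto
    then show "qpt * y + qpt \<notin> gauss" by (simp add: algebra_simps)
  qed
  have h: "(\<lambda>y. wp (qpt * y)) holomorphic_on - gauss"
    by (rule holomorphic_on_compose_gen[OF _ wp_holomorphic, unfolded o_def])
       (use ng in \<open>auto intro!: holomorphic_intros\<close>)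
  moreover have "(\<lambda>y. wp (qpt * y + qpt)) holomorphic_on - gauss"
    by (rule holomorphic_on_compose_gen[OF _ wp_holomorphic, unfolded o_def])
       (use ng in \<open>auto intro!: holomorphic_intros\<close>)
  ultimately show "(\<lambda>y. wp (qpt * y) * wp (qpt * y + qpt)) holomorphic_on - gauss"
    by (rule holomorphic_on_mult)
  show "wp (qpt * (z + q)) * wp (qpt * (z + q) + qpt) = wp (qpt * z) * wp (qpt * z + qpt)"
    if "q \<in> gauss" "z \<notin> gauss" for z q
    using qpt_mult_cases[OF that(1)]
  proof
    assume m: "qpt * q \<in> gauss"
    have "qpt * (z + q) = qpt * z + qpt * q" "qpt * (z + q) + qpt = qpt * z + qpt + qpt * q"
      by (simp_all add: algebra_simps)
    then show ?thesis using wp_shift[OF ng(1)[OF that(2)] m] wp_shift[OF ng(2)[OF that(2)] m] by (simp only:)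
  next
    assume m: "qpt * q - qpt \<in> gauss"
    have "qpt * (z + q) = qpt * z + qpt + (qpt * q - qpt)"
      "qpt * (z + q) + qpt = qpt * z + (qpt * q - qpt + (qpt + qpt))"
      by (simp_all add: algebra_simps)
    moreover have "qpt * q - qpt + (qpt + qpt) \<in> gauss"
      unfolding two_qpt by (intro gauss_add m) auto
    ultimately show ?thesis
      using wp_shift[OF ng(2)[OF that(2)] m] wp_shift[OF ng(1)[OF that(2)], of "qpt * q - qpt + (qpt + qpt)"]
      by (simp only: mult.commute)
  qed
  \<comment> \<open>With \<open>v = qpt * y\<close> the product is
    \<open>G v / v ^ 2 + wp0 v * G v\<close> near 0, and \<open>G\<close> vanishes to second
    order.\<close>
  define G where "G = (\<lambda>v. wp (qpt + v))"
  have "wp analytic_on {qpt}"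
    using wp_holomorphic qpt_notin_gauss analytic_at by blast
  then have G: "G has_fps_expansion fps_expansion wp qpt"
    unfolding G_def by (rule analytic_at_imp_has_fps_expansion)
  have "((\<lambda>v. G v / v ^ 2) \<longlongrightarrow> fps_nth (fps_expansion wp qpt) 2) (at 0)"
    by (rule divide_power_tendsto[OF G])
       (auto simp: fps_expansion_def less_Suc_eq numeral_2_eq_2 wp_qpt deriv_wp_qpt)
  moreover have "fps_nth (fps_expansion wp qpt) 2 = - 5 * g2c"
    using wp_ode[OF qpt_notin_gauss] by (simp add: fps_expansion_def numeral_2_eq_2 wp_qpt)
  moreover have "(wp0 \<longlongrightarrow> 0) (at 0)"
    using has_fps_expansion_imp_tendsto_0[OF wp0_expansion] Wp0_eq_0[of 0] by (simp add: tendsto_nhds_iff)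
  moreover have "(G \<longlongrightarrow> 0) (at 0)"
    using has_fps_expansion_imp_tendsto_0[OF G] by (simp add: tendsto_nhds_iff fps_expansion_def wp_qpt)
  ultimately have "((\<lambda>v. G v / v ^ 2 + wp0 v * G v) \<longlongrightarrow> - 5 * g2c + 0 * 0) (at 0)"
    by (intro tendsto_intros) auto
  moreover have "filterlim (\<lambda>y. qpt * y) (at 0) (at 0)"
  proof (rule filterlim_atI)
    show "((\<lambda>y. qpt * y) \<longlongrightarrow> 0) (at 0)" by (auto intro!: tendsto_eq_intros)
    have "qpt \<noteq> 0" using qpt_notin_gauss by auto
    then show "\<forall>\<^sub>F y in at 0. qpt * y \<noteq> 0" by (auto simp: eventually_at_filter)
  qed
  ultimately have "((\<lambda>y. G (qpt * y) / (qpt * y) ^ 2 + wp0 (qpt * y) * G (qpt * y)) \<longlongrightarrow> - 5 * g2c) (at 0)"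
    using filterlim_compose[of "\<lambda>v. G v / v ^ 2 + wp0 v * G v" "nhds (- 5 * g2c)" "at 0" "\<lambda>y. qpt * y" "at 0"] by simp
  then show "((\<lambda>y. wp (qpt * y) * wp (qpt * y + qpt)) \<longlongrightarrow> - 5 * g2c) (at 0)"
  proof (rule Lim_transform_eventually)
    have "\<forall>\<^sub>F y in at 0. y \<in> - gauss' - {0}" by (rule eventually_at_in_open) auto
    then show "\<forall>\<^sub>F y in at 0. G (qpt * y) / (qpt * y) ^ 2 + wp0 (qpt * y) * G (qpt * y) =
        wp (qpt * y) * wp (qpt * y + qpt)"
    proof eventually_elim
      case (elim y)
      then have "y \<notin> gauss" by auto
      then show ?case by (simp add: wp_eq[OF ng(1)] G_def add.commute[of qpt] distrib_right)
    qed
  qed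
qed (use assms in auto)

lemma of_real_notin_gauss: "of_real x \<notin> gauss" if "0 < x" "x < 1" for x :: real
proof
  assume "of_real x \<in> gauss"
  then have "x \<in> \<int>" by (simp add: gauss_def)
  then show False using that by (auto elim!: Ints_cases)
qed

text \<open>Otherwise \<open>w = 0\<close> is admissible and all coefficients of positive weight
  vanish. Then \<open>wp z = 1 / z ^ 2\<close> everywhere off the lattice, which is not periodic, as
  1/2 and 3/2 show.\<close>

lemma g2c_nonzero: "g2c \<noteq> 0"
proof
  assume "g2c = 0"
  then have "g2c = 0 ^ 4 / 5" by simp
  from Wp0_homog[OF this] have "Wp0 = 0"
    by (intro fps_ext) (auto simp: homog_def)
  then have exp: "wp0 has_fps_expansion 0" using wp0_expansion by simp
  have "connected (- gauss')"
    using connected_open_diff_countable[of "UNIV :: complex set" gauss'] countable_gauss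
    by (simp add: Compl_eq_Diff_UNIV connected_UNIV countable_Diff)
  then have "wp0 z = 0" if "z \<in> - gauss'" for z
    using has_fps_expansion_0_analytic_continuation[OF exp wp0_holomorphic open_compl_gauss(2)] that by auto
  then have wp: "wp z = 1 / z ^ 2" if "z \<notin> gauss" for z
    using wp_eq[OF that] that by simp
  have "(1/2 :: complex) \<notin> gauss" using of_real_notin_gauss[of "1/2"] by simp
  moreover from this have "1/2 + 1 \<notin> gauss" by (simp only: gauss_add_iff[OF gauss_1] not_False_eq_True)
  ultimately have "1 / (1/2 + 1) ^ 2 = 1 / (1/2 :: complex) ^ 2"
    using wp_shift[of "1/2" 1] wp by (metis gauss_1)
  then show False by (simp add: power2_eq_square)
qed

lemma wp_half_nonzero: "wp (1/2) \<noteq> 0"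
proof -
  \<comment> \<open>Chosen so that \<open>qpt * y = 1/2\<close>.\<close>
  define y where "y = cnj qpt"
  have y: "y \<notin> gauss" unfolding y_def using qpt_notin_gauss by simp
  have "qpt * y = 1/2" by (simp add: qpt_def y_def complex_eq_iff)
  then have "wp (1/2) * wp (1/2 + qpt) = - 5 * g2c"
    using wp_mult_wp_qpt[OF y] by (simp only:)
  then show ?thesis using g2c_nonzero by auto
qed

text \<open>\<open>deriv wp\<close> is odd, and -1/2 and 1/2 differ by a period.\<close>

lemma deriv_wp_half: "deriv wp (1/2) = 0"
proof -
  have n: "(1/2 :: complex) \<notin> gauss" using of_real_notin_gauss[of "1/2"] by simp
  have "deriv wp (\<i> * (\<i> * (1/2))) = \<i> * (\<i> * deriv wp (1/2))"
    using n by (metis deriv_wp_ii gauss_ii_mult_iff)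
  moreover have "\<i> * (\<i> * (1/2)) = 1/2 + (-1)" by (simp add: complex_eq_iff)
  moreover have "deriv wp (1/2 + (-1)) = deriv wp (1/2)"
    by (rule deriv_wp_shift[OF n]) simp
  ultimately have "deriv wp (1/2) = - deriv wp (1/2)" by (simp add: complex_eq_iff)
  then show ?thesis by simp
qed

section \<open>The restriction of wp to the real interval from 0 to 1\<close>

lemma wp0_cnj:
  assumes "z \<in> - gauss'"
  shows "wp0 (cnj z) = cnj (wp0 z)"
proof -
  have "cnj z \<in> - gauss'" using assms by auto
  then have "((\<lambda>z. cnj (zeta0 (cnj z))) has_field_derivative cnj (- wp0 (cnj z))) (at z)"
    using has_field_derivative_cnj_cnj[OF zeta0_has_field_derivative] by (simp add: o_def)
  then have "(zeta0 has_field_derivative cnj (- wp0 (cnj z))) (at z)"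
    by (simp add: zeta0_cnj)
  then have "cnj (- wp0 (cnj z)) = - wp0 z"
    using zeta0_has_field_derivative[OF assms] DERIV_unique by blast
  then show ?thesis by (metis complex_cnj_cnj complex_cnj_minus minus_equation_iff)
qed

lemma wp0_real:
  assumes "\<bar>x\<bar> < 1"
  shows "wp0 (of_real x) = of_real (Re (wp0 (of_real x)))"
proof -
  have "of_real x \<in> ball (0::complex) 1" using assms by simp
  then have "of_real x \<in> - gauss'" using ball_subset_compl_gauss by blast
  from wp0_cnj[OF this] show ?thesis by (simp add: complex_eq_iff)
qed

definition wpr :: "real \<Rightarrow> real" where "wpr x = Re (wp (of_real x))"

definition wpr' :: "real \<Rightarrow> real" where "wpr' x = Re (deriv wp (of_real x))"

lemma Re_has_real_derivative:
  assumes "(f has_field_derivative D) (at (of_real x))"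
  shows "((\<lambda>x. Re (f (of_real x))) has_real_derivative Re D) (at x)"
proof -
  have "((\<lambda>x. f (of_real x)) has_vector_derivative D) (at x)"
    using has_vector_derivative_real_field[OF assms] .
  then have "((\<lambda>x. Re (f (of_real x))) has_vector_derivative Re D) (at x)"
    by (simp add: has_vector_derivative_complex_iff has_real_derivative_iff_has_vector_derivative)
  then show ?thesis by (simp add: has_real_derivative_iff_has_vector_derivative)
qed


lemma wpr_eq:
  assumes x: "0 < x" "x < 1"
  shows "wpr x = 1 / x ^ 2 + Re (wp0 (of_real x))"
  by (simp add: wpr_def wp_eq[OF of_real_notin_gauss[OF x]] Re_divide_of_real flip: of_real_power)

lemma of_real_wpr:
  assumes x: "0 < x" "x < 1"
  shows "wp (of_real x) = of_real (wpr x)"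
  using wp0_real[of x] x by (simp add: wpr_def wp_eq[OF of_real_notin_gauss[OF x]] complex_eq_iff flip: of_real_power)

lemma wpr_has_derivative:
  assumes x: "0 < x" "x < 1"
  shows "(wpr has_real_derivative wpr' x) (at x)"
  unfolding wpr_def[abs_def] wpr'_def
  by (intro Re_has_real_derivative wp_has_field_derivative of_real_notin_gauss[OF x])

lemma of_real_wpr':
  assumes x: "0 < x" "x < 1"
  shows "deriv wp (of_real x) = of_real (wpr' x)"
proof -
  have "((\<lambda>x. wp (of_real x)) has_vector_derivative deriv wp (of_real x)) (at x)"
    by (rule has_vector_derivative_real_field, rule wp_has_field_derivative, rule of_real_notin_gauss[OF x])
  then have "((\<lambda>x. Im (wp (of_real x))) has_real_derivative Im (deriv wp (of_real x))) (at x)"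
    by (simp add: has_vector_derivative_complex_iff)
  moreover have "((\<lambda>x. Im (wp (of_real x))) has_real_derivative 0) (at x)"
  proof (rule has_field_derivative_transform_within_open)
    show "((\<lambda>_. 0) has_real_derivative 0) (at x)" by simp
    show "0 = Im (wp (of_real y))" if "y \<in> {0<..<1}" for y :: real
      using that of_real_wpr[of y] by simp
  qed (use x in auto)
  ultimately have "Im (deriv wp (of_real x)) = 0" by (rule DERIV_unique)
  then show ?thesis by (simp add: complex_eq_iff wpr'_def)
qed

text \<open>In fact \<open>wpr (1/2) > 0\<close> (lemma \<open>wpr_half\<close>); the absolute value lets the lower bound on \<open>wpr\<close> be
  proved before its sign at \<open>1/2\<close> is known.\<close>

definition wpe :: real where "wpe = \<bar>wpr (1/2)\<bar>"

lemma wpe_pos: "wpe > 0"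
  using wp_half_nonzero of_real_wpr[of "1/2"] by (auto simp: wpe_def)

text \<open>At 1/2 the left side of \<open>wp_first_integral\<close> is 0, so
  \<open>wp (1/2)\<close> is a root of a cubic; the root 0 is excluded by
  \<open>wp_half_nonzero\<close>.\<close>

lemma g2c_wpe: "5 * g2c = of_real (wpe ^ 2)"
proof -
  have "4 * wp (1/2) ^ 3 - 20 * g2c * wp (1/2) = 0"
    using wp_first_integral[of "1/2"] deriv_wp_half of_real_notin_gauss[of "1/2"] by simp
  then have "4 * wp (1/2) * (wp (1/2) ^ 2 - 5 * g2c) = 0"
    by (simp add: power2_eq_square power3_eq_cube algebra_simps)
  then have "5 * g2c = wp (1/2) ^ 2" using wp_half_nonzero by simp
  also have "\<dots> = of_real (wpe ^ 2)"
    using of_real_wpr[of "1/2"] by (simp add: wpe_def)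
  finally show ?thesis .
qed

lemma wpr_first_integral:
  assumes x: "0 < x" "x < 1"
  shows "wpr' x ^ 2 = 4 * wpr x * (wpr x ^ 2 - wpe ^ 2)"
proof -
  have "complex_of_real (wpr' x ^ 2) = deriv wp (of_real x) ^ 2"
    by (simp add: of_real_wpr'[OF x])
  also have "\<dots> = 4 * wp (of_real x) ^ 3 - 4 * (5 * g2c) * wp (of_real x)"
    using wp_first_integral[OF of_real_notin_gauss[OF x]] by simp
  also have "\<dots> = of_real (4 * wpr x * (wpr x ^ 2 - wpe ^ 2))"
    unfolding g2c_wpe of_real_wpr[OF x] by (simp add: algebra_simps power2_eq_square power3_eq_cube)
  finally show ?thesis by (simp only: of_real_eq_iff)
qed

lemma wpr'_has_derivative:
  assumes x: "0 < x" "x < 1"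
  shows "(wpr' has_real_derivative 6 * wpr x ^ 2 - 2 * wpe ^ 2) (at x)"
proof -
  have "(wpr' has_real_derivative Re (deriv (deriv wp) (of_real x))) (at x)"
    unfolding wpr'_def[abs_def]
    by (intro Re_has_real_derivative deriv_wp_has_field_derivative of_real_notin_gauss x)
  also have "deriv (deriv wp) (of_real x) = 6 * wp (of_real x) ^ 2 - 2 * (5 * g2c)"
    using wp_ode[OF of_real_notin_gauss[OF x]] by simp
  also have "\<dots> = of_real (6 * wpr x ^ 2 - 2 * wpe ^ 2)"
    unfolding g2c_wpe of_real_wpr[OF x] by simp
  finally show ?thesis by simp
qed

lemma wp0_real_continuous: "continuous_on {-1<..<1} (\<lambda>x. Re (wp0 (of_real x)))"
proof -
  have "continuous_on (ball 0 1) wp0"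
    by (rule holomorphic_on_imp_continuous_on, rule holomorphic_on_subset[OF wp0_holomorphic ball_subset_compl_gauss])
  then have "continuous_on {-1<..<1} (\<lambda>x. wp0 (complex_of_real x))"
    by (rule continuous_on_compose2) (auto intro!: continuous_intros)
  then show ?thesis by (intro continuous_intros)
qed

text \<open>The first integral is a real square, so \<open>wpr\<close> never takes a value strictly
  between 0 and \<open>wpe\<close>. It tends to infinity at 0, and by continuity it cannot cross
  this gap.\<close>

lemma wpr_ge:
  assumes x: "0 < x" "x < 1"
  shows "wpr x \<ge> wpe"
proof (rule ccontr)
  assume "\<not> wpr x \<ge> wpe"
  then have less: "wpr x < wpe" by simp
  have gap: "wpr y \<ge> wpe \<or> wpr y \<le> 0" if y: "0 < y" "y < 1" for y
  proof (rule ccontr)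
    assume "\<not> (wpr y \<ge> wpe \<or> wpr y \<le> 0)"
    then have y': "0 < wpr y" "wpr y < wpe" by auto
    then have "wpr y ^ 2 < wpe ^ 2" by (intro power_strict_mono) auto
    then have "4 * wpr y * (wpr y ^ 2 - wpe ^ 2) < 0" using y' by (simp add: mult_less_0_iff)
    then show False using wpr_first_integral[OF y] by (metis not_less zero_le_power2)
  qed
  have cont: "isCont (\<lambda>x. Re (wp0 (of_real x))) 0"
    using wp0_real_continuous by (rule continuous_on_interior) (simp add: interior_open)
  have "filterlim (\<lambda>x::real. inverse x ^ 2) at_top (at_right 0)"
    by (intro filterlim_pow_at_top filterlim_inverse_at_top_right) simp
  moreover have "((\<lambda>x. Re (wp0 (of_real x))) \<longlongrightarrow> Re (wp0 (of_real 0))) (at_right 0)"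
    using cont unfolding isCont_def by (rule tendsto_within_subset) simp
  ultimately have "filterlim (\<lambda>x. Re (wp0 (of_real x)) + inverse x ^ 2) at_top (at_right 0)"
    by (intro filterlim_tendsto_add_at_top)
  then have "\<forall>\<^sub>F y in at_right 0. Re (wp0 (of_real y)) + inverse y ^ 2 > wpe"
    by (simp add: filterlim_at_top_dense)
  moreover have "\<forall>\<^sub>F y in at_right 0. y \<in> {0<..<x}"
    by (rule eventually_at_right_real) (use x in simp)
  ultimately have "\<forall>\<^sub>F y in at_right 0. wpr y > wpe \<and> 0 < y \<and> y < x"
    by eventually_elim (use x in \<open>simp add: wpr_eq power_inverse divide_inverse\<close>)
  then obtain y where y: "wpr y > wpe" "0 < y" "y < x"
    using eventually_happens'[OF trivial_limit_at_right_real] by blast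
  \<comment> \<open>The value \<open>wpe / 2\<close> is a point of the forbidden gap.\<close>
  have "\<exists>z\<ge>y. z \<le> x \<and> wpr z = wpe / 2"
  proof (rule IVT2)
    show "wpr x \<le> wpe / 2" using gap[OF x] less wpe_pos by auto
    show "\<forall>z. y \<le> z \<and> z \<le> x \<longrightarrow> isCont wpr z"
      using x y by (auto intro!: DERIV_isCont wpr_has_derivative)
  qed (use y wpe_pos in auto)
  then obtain z where "y \<le> z" "z \<le> x" "wpr z = wpe / 2" by blast
  then show False using gap[of z] x y wpe_pos by auto
qed

lemma wpr_half: "wpr (1/2) = wpe"
  using wpr_ge[of "1/2"] by (simp add: wpe_def)

text \<open>The second derivative is positive because \<open>wpr \<ge> wpe\<close>, so
  \<open>wpr'\<close> increases to its zero at 1/2.\<close>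

lemma wpr'_neg:
  assumes "0 < x" "x < 1/2"
  shows "wpr' x < 0"
proof -
  have "wpr' x < wpr' (1/2)"
  proof (rule DERIV_pos_imp_increasing[OF assms(2)])
    fix y assume y: "x \<le> y" "y \<le> 1/2"
    then have y': "0 < y" "y < 1" using assms by auto
    have "wpe ^ 2 \<le> wpr y ^ 2" using wpr_ge[OF y'] wpe_pos by (intro power_mono) auto
    moreover have "wpe ^ 2 > 0" using wpe_pos by simp
    ultimately have "6 * wpr y ^ 2 - 2 * wpe ^ 2 > 0" by linarith
    then show "\<exists>D. (wpr' has_real_derivative D) (at y) \<and> D > 0"
      using wpr'_has_derivative[OF y'] by blast
  qed
  also have "wpr' (1/2) = 0" using deriv_wp_half by (simp add: wpr'_def)
  finally show ?thesis .
qed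

lemma wpr_gt:
  assumes "0 < x" "x < 1/2"
  shows "wpr x > wpe"
proof -
  have "wpr x \<noteq> wpe"
  proof
    assume "wpr x = wpe"
    then have "wpr' x ^ 2 = 0" using wpr_first_integral[of x] assms by simp
    then show False using wpr'_neg[OF assms] by simp
  qed
  then show ?thesis using wpr_ge[of x] assms by simp
qed

text \<open>The substitution \<open>s = (wpe / wpr x) ^ 2\<close> maps the interval from 0 to 1/2
  onto that from 0 to 1 and turns the Beta integrand into the constant \<open>4 * sqrt wpe\<close>,
  by the first integral. The interval has length 1/2.\<close>

lemma sqrt_wpe: "2 * sqrt wpe = Beta (1/4) (1/2)"
proof -
  define f where "f = (\<lambda>s::real. s powr (1/4 - 1) * (1 - s) powr (1/2 - 1))"
  define B where "B = (\<lambda>u. integral {0..u} f)"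
  define r where "r = (\<lambda>x. Re (wp0 (of_real x)))"
  \<comment> \<open>The substitution, multiplied out by \<open>x ^ 2\<close> so that it is
    continuous up to \<open>x = 0\<close>, with value 0 there.\<close>
  define y where "y = (\<lambda>x. (wpe * x ^ 2 / (1 + x ^ 2 * r x)) ^ 2)"
  have f: "(f has_integral Beta (1/4) (1/2)) {0..1}"
    unfolding f_def by (rule has_integral_Beta_real) auto
  then have fint: "f integrable_on {0..1}" by blast
  have D: "1 + x ^ 2 * r x = x ^ 2 * wpr x" if "0 < x" "x < 1" for x
    using that by (simp add: wpr_eq[OF that] r_def field_simps)
  have y: "y x = (wpe / wpr x) ^ 2" if "0 < x" "x < 1" for x
    using that by (simp add: y_def D)
  have y_le: "0 \<le> y x \<and> y x \<le> 1" if "0 \<le> x" "x \<le> 1/2" for x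
  proof (cases "x = 0")
    case False
    then have "0 < x" "x < 1" using that by auto
    moreover from this have "wpe / wpr x \<le> 1" using wpr_ge[of x] wpe_pos by simp
    moreover have "0 \<le> wpe / wpr x" using wpr_ge[of x] wpe_pos calculation by simp
    ultimately show ?thesis by (simp add: y power_le_one)
  qed (simp add: y_def)
  have "B (y (1/2)) - 4 * sqrt wpe * (1/2) = B (y 0) - 4 * sqrt wpe * 0"
  proof (rule DERIV_isconst_end[where f = "\<lambda>x. B (y x) - 4 * sqrt wpe * x"])
    have "continuous_on {0..1/2} y"
      unfolding y_def
    proof (intro continuous_intros ballI)
      show "continuous_on {0..1/2} r"
        unfolding r_def by (rule continuous_on_subset[OF wp0_real_continuous]) auto
      fix x :: real assume "x \<in> {0..1/2}"
      then show "1 + x ^ 2 * r x \<noteq> 0"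
        using D[of x] wpr_ge[of x] wpe_pos by (cases "x = 0") auto
    qed
    then have "continuous_on {0..1/2} (\<lambda>x. B (y x))"
      using y_le unfolding B_def
      by (intro continuous_on_compose2[OF indefinite_integral_continuous_1[OF fint]]) auto
    then show "continuous_on {0..1/2} (\<lambda>x. B (y x) - 4 * sqrt wpe * x)"
      by (intro continuous_intros)
    fix x :: real assume x: "0 < x" "x < 1/2"
    then have x1: "0 < x" "x < 1" by auto
    have gt: "wpr x > wpe" by (rule wpr_gt[OF x])
    define v where "v = wpe / wpr x"
    have pos: "wpr x > 0" using gt wpe_pos by linarith
    have v: "0 < v" "v < 1" using gt wpe_pos pos by (auto simp: v_def)
    have v2: "0 < v ^ 2" "v ^ 2 < 1" using v by (auto simp: power_less_one_iff)
    have "(B has_vector_derivative f (v ^ 2)) (at (v ^ 2) within ({0..1} - {}))"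
      unfolding B_def
    proof (rule integral_has_vector_derivative_continuous_at[OF fint])
      show "continuous (at (v ^ 2) within ({0..1} - {})) f"
        unfolding f_def by (intro continuous_intros) (use v2 in auto)
    qed (use v2 in auto)
    moreover have "at (v ^ 2) within {0..1} = at (v ^ 2)"
      by (rule at_within_interior) (use v2 in \<open>simp add: interior_atLeastAtMost_real\<close>)
    ultimately have B: "(B has_real_derivative f (v ^ 2)) (at (v ^ 2))"
      by (simp add: has_real_derivative_iff_has_vector_derivative)
    have "((\<lambda>x. (wpe / wpr x) ^ 2) has_real_derivative 2 * (wpe / wpr x) * (- (wpe * wpr' x) / (wpr x * wpr x))) (at x)"
      using pos by (auto intro!: derivative_eq_intros wpr_has_derivative x1) (simp add: mult_ac)
    then have "((\<lambda>x. B ((wpe / wpr x) ^ 2)) has_real_derivative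
        f (v ^ 2) * (2 * (wpe / wpr x) * (- (wpe * wpr' x) / (wpr x * wpr x)))) (at x)"
      using B unfolding v_def by (rule DERIV_chain2[rotated])
    also have "f (v ^ 2) * (2 * (wpe / wpr x) * (- (wpe * wpr' x) / (wpr x * wpr x))) = 4 * sqrt wpe"
    proof -
      have "(- wpr' x) ^ 2 = (2 * wpr x * sqrt (wpr x) * sqrt (1 - v ^ 2)) ^ 2"
      proof -
        have "(2 * wpr x * sqrt (wpr x) * sqrt (1 - v ^ 2)) ^ 2 = 4 * wpr x ^ 2 * wpr x * (1 - v ^ 2)"
          using pos v2 by (simp add: power_mult_distrib)
        also have "\<dots> = 4 * wpr x * (wpr x ^ 2 - (v * wpr x) ^ 2)"
          by (simp add: algebra_simps power2_eq_square)
        also have "v * wpr x = wpe" using pos by (simp add: v_def)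
        also have "4 * wpr x * (wpr x ^ 2 - wpe ^ 2) = (- wpr' x) ^ 2"
          using wpr_first_integral[OF x1] by simp
        finally show ?thesis by simp
      qed
      \<comment> \<open>The sign of the square root is settled by \<open>wpr'_neg\<close>.\<close>
      then have d: "- wpr' x = 2 * wpr x * sqrt (wpr x) * sqrt (1 - v ^ 2)"
        by (rule power2_eq_imp_eq) (use wpr'_neg[OF x] pos v2 in auto)
      have "(v ^ 2) powr (1/4 - 1) = (v powr 2) powr (1/4 - 1)"
        using v by (simp add: powr_numeral)
      also have "\<dots> = v powr (- (3/2))" by (simp add: powr_powr)
      also have "\<dots> = 1 / (v * sqrt v)"
        using v powr_add[of v 1 "1/2"] by (simp add: powr_minus_divide powr_half_sqrt)
      finally have "f (v ^ 2) = 1 / (v * sqrt v) * (1 / sqrt (1 - v ^ 2))"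
        using v2 by (simp add: f_def powr_minus_divide powr_half_sqrt)
      moreover have "2 * (wpe / wpr x) * (- (wpe * wpr' x) / (wpr x * wpr x)) = 2 * v ^ 2 * (- wpr' x) / wpr x"
        by (simp add: v_def power2_eq_square)
      ultimately have "f (v ^ 2) * (2 * (wpe / wpr x) * (- (wpe * wpr' x) / (wpr x * wpr x))) =
          4 * (v ^ 2 / (v * sqrt v)) * sqrt (wpr x) * (sqrt (1 - v ^ 2) / sqrt (1 - v ^ 2))"
        unfolding d using pos by simp
      also have "v ^ 2 / (v * sqrt v) = sqrt v"
        using v by (simp add: power2_eq_square real_div_sqrt)
      also have "sqrt (1 - v ^ 2) / sqrt (1 - v ^ 2) = 1" using v2 by simp
      also have "4 * sqrt v * sqrt (wpr x) * 1 = 4 * sqrt wpe"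
        using pos by (simp add: v_def flip: real_sqrt_mult)
      finally show ?thesis .
    qed
    finally have "((\<lambda>x. B ((wpe / wpr x) ^ 2) - 4 * sqrt wpe * x) has_real_derivative 0) (at x)"
      by (auto intro!: derivative_eq_intros)
    then show "((\<lambda>x. B (y x) - 4 * sqrt wpe * x) has_real_derivative 0) (at x)"
      by (rule has_field_derivative_transform_within_open[where S = "{0<..<1}"]) (use x1 y in auto)
  qed simp
  moreover have "y 0 = 0" "y (1/2) = 1"
    using wpe_pos by (simp_all add: y_def y[of "1/2", unfolded y_def] wpr_half)
  ultimately show ?thesis
    using f by (simp add: B_def integral_unique)
qed

lemma g2c_eq: "g2c = of_real (Beta (1/4) (1/2) / 2) ^ 4 / 5"
proof -
  have "wpe = (Beta (1/4) (1/2) / 2) ^ 2" using sqrt_wpe wpe_pos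
    by (metis nonzero_mult_div_cancel_left real_sqrt_pow2 less_imp_le zero_neq_numeral)
  then have "wpe ^ 2 = (Beta (1/4) (1/2) / 2) ^ 4"
    using power_mult[of "Beta (1/4) (1/2 :: real) / 2" 2 2] by simp
  moreover have "g2c = of_real (wpe ^ 2) / 5" unfolding g2c_wpe[symmetric] by simp
  ultimately show ?thesis by (simp only: of_real_power)
qed

text \<open>Reflection gives \<open>Gamma (1/4) * Gamma (3/4) = pi * sqrt 2\<close>, which
  eliminates \<open>Gamma (3/4)\<close>; the fourth power clears the square roots.\<close>

lemma Beta_power4: "(Beta (1/4) (1/2 :: real) / 2) ^ 4 = (Gamma (1/4) ^ 4) ^ 2 / (64 * pi ^ 2)"
proof -
  have "complex_of_real (Gamma (1/4) * Gamma (1 - 1/4)) = Gamma (of_real (1/4)) * Gamma (1 - of_real (1/4))"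
    by (simp only: of_real_mult Gamma_complex_of_real[symmetric] of_real_diff of_real_1)
  also have "\<dots> = of_real pi / sin (of_real pi * of_real (1/4))"
    by (rule Gamma_reflection_complex)
  also have "complex_of_real pi / sin (of_real pi * of_real q) = of_real (pi / sin (pi * q))" for q
    by (simp add: sin_of_real flip: of_real_mult)
  finally have "Gamma (1/4) * Gamma (1 - 1/4) = pi / sin (pi * (1/4))"
    by (simp only: of_real_eq_iff)
  then have "Gamma (1/4) * Gamma (3/4) = pi / sin (pi * (1/4))" by simp
  also have "sin (pi * (1/4)) = sqrt 2 / 2" using sin_45 by simp
  also have "pi / (sqrt 2 / 2) = pi * (2 / sqrt 2)" by simp
  also have "2 / sqrt 2 = sqrt (2 :: real)" by (rule real_div_sqrt) simp
  finally have G: "Gamma (1/4) * Gamma (3/4) = pi * sqrt 2" .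
  have pos: "Gamma (1/4 :: real) > 0" "Gamma (3/4 :: real) > 0" by (auto intro!: Gamma_real_pos)
  have "Beta (1/4) (1/2 :: real) = Gamma (1/4) * sqrt pi / Gamma (3/4)"
    by (simp add: Beta_def Gamma_one_half_real)
  also have "\<dots> = Gamma (1/4) ^ 2 * sqrt pi / (Gamma (1/4) * Gamma (3/4))"
    using pos by (simp add: power2_eq_square)
  finally have B: "Beta (1/4) (1/2 :: real) = Gamma (1/4) ^ 2 * sqrt pi / (pi * sqrt 2)"
    unfolding G .
  have s: "sqrt pi ^ 4 = pi ^ 2" "sqrt 2 ^ 4 = (4 :: real)" "pi ^ 4 = pi ^ 2 * pi ^ 2"
    using power_mult[of "sqrt pi" 2 2] power_mult[of "sqrt 2" 2 2] power_add[of pi 2 2] by simp_all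
  have "(Beta (1/4) (1/2 :: real) / 2) ^ 4 = (Gamma (1/4) ^ 2) ^ 4 * sqrt pi ^ 4 / (pi ^ 4 * sqrt 2 ^ 4 * 2 ^ 4)"
    unfolding B by (simp only: power_divide power_mult_distrib divide_divide_eq_left)
  also have "(Gamma (1/4 :: real) ^ 2) ^ 4 = (Gamma (1/4) ^ 4) ^ 2" by (simp flip: power_mult)
  also have "A * p / (p * p * 4 * 2 ^ 4) = A / (64 * p)" if "p \<noteq> 0" for A p :: real
    using that by simp
  then have "(Gamma (1/4) ^ 4) ^ 2 * sqrt pi ^ 4 / (pi ^ 4 * sqrt 2 ^ 4 * 2 ^ 4) = (Gamma (1/4) ^ 4) ^ 2 / (64 * pi ^ 2)"
    unfolding s by (metis pi_neq_zero power_not_zero)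
  finally show ?thesis .
qed

section \<open>Lattice sums with polynomial numerators\<close>

definition gsum :: "nat \<Rightarrow> nat \<Rightarrow> complex" where
  "gsum t b = (\<Sum>\<^sub>\<infinity>p\<in>gauss'. cnj p ^ t / p ^ b)"

lemma gsum_lat_sum:
  assumes "b \<ge> t + 3"
  shows "((\<lambda>p. cnj p ^ t / p ^ b) has_sum (-1) ^ b * lat_sum t b 0) gauss'"
proof -
  have "((\<lambda>p. (-1) ^ b * (cnj p ^ t / (0 - p) ^ b)) has_sum (-1) ^ b * lat_sum t b 0) gauss'"
    by (intro has_sum_cmult_right lat_sum_has_sum) (use assms in auto)
  moreover have "(-1) ^ b * (cnj p ^ t / (0 - p) ^ b) = cnj p ^ t / p ^ b" for p
    by (cases "even b") (auto simp: power_minus[of p])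
  ultimately show ?thesis by simp
qed

lemma gsum_has_sum: "b \<ge> t + 3 \<Longrightarrow> ((\<lambda>p. cnj p ^ t / p ^ b) has_sum gsum t b) gauss'"
  using gsum_lat_sum[of t b] infsumI[OF gsum_lat_sum, of t b] by (simp add: gsum_def)

text \<open>Rotating the summation index reproduces the sum with the factor
  \<open>(- \<i>) ^ (t + b)\<close>, which differs from 1 here.\<close>

lemma gsum_eq_0:
  assumes "\<not> 4 dvd (t + b)"
  shows "gsum t b = 0"
proof -
  have "gsum t b = (\<Sum>\<^sub>\<infinity>p\<in>gauss'. (- \<i>) ^ (t + b) * (cnj p ^ t / p ^ b))"
    unfolding gsum_def
  proof (rule infsum_reindex_bij_witness[of _ "\<lambda>p. \<i> * p" "\<lambda>p. - \<i> * p"])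
    fix p :: complex
    have "(- \<i>) ^ (t + b) * cnj (- \<i> * p) ^ t = (- \<i>) ^ b * cnj p ^ t"
      by (simp add: power_add flip: power_mult_distrib)
    then show "(- \<i>) ^ (t + b) * (cnj (- \<i> * p) ^ t / (- \<i> * p) ^ b) = cnj p ^ t / p ^ b"
      by (simp only: times_divide_eq_right power_mult_distrib[of "- \<i>" p]) simp
  qed (auto simp: minus_mult_left[symmetric] simp del: minus_mult_left)
  also have "\<dots> = (- \<i>) ^ (t + b) * gsum t b"
    unfolding gsum_def by (rule infsum_cmult_right')
  finally have "((- \<i>) ^ (t + b) - 1) * gsum t b = 0" by (simp add: algebra_simps)
  moreover have "(- \<i>) ^ (t + b) \<noteq> 1"
  proof
    assume "(- \<i>) ^ (t + b) = 1"
    moreover have "(- \<i>) ^ (t + b) * \<i> ^ (t + b) = 1" by (simp flip: power_mult_distrib)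
    ultimately have "\<i> ^ ((t + b) mod 4) = 1" by (simp flip: ii_power_mod_4)
    moreover have "(t + b) mod 4 = 1 \<or> (t + b) mod 4 = 2 \<or> (t + b) mod 4 = 3"
      using assms by presburger
    ultimately show False by (auto simp: power3_eq_cube complex_eq_iff)
  qed
  ultimately show ?thesis by simp
qed

text \<open>The numbers \<open>\<Gamma>(1/4)\<^sup>4\<close> and \<open>1/\<pi>\<close> enter through \<open>w\<^sup>4 = X\<^sup>2 Y\<^sup>2 / 64\<close> for \<open>w = B(1/4, 1/2) / 2\<close>.\<close>

lemma of_real_of_rat: "complex_of_real (of_rat q) = of_rat q"
  by (induct q) (simp add: of_rat_rat)

lemma gsum_eq:
  assumes "b \<ge> t + 4" "4 dvd (t + b)"
  obtains q :: rat where "gsum t b =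
    of_real (of_rat q * (Gamma (1/4) ^ 4) ^ ((t + b) div 2) * inverse pi ^ (t + (t + b) div 2))"
proof -
  define w :: real where "w = Beta (1/4) (1/2) / 2"
  define k where "k = (t + b) div 4"
  have k: "t + b = 4 * k" using assms(2) by (simp add: k_def)
  have "g2c = of_real w ^ 4 / 5" unfolding w_def by (rule g2c_eq)
  then have "of_real pi ^ t * lat_sum t b 0 \<in> homog (of_real w) (t + b)"
    by (rule lat_sum_homog) fact
  then obtain r where r: "r \<in> \<rat>" "of_real pi ^ t * lat_sum t b 0 = r * of_real w ^ (t + b)"
    by (auto simp: homog_def)
  obtain r' where r': "r = of_rat r'" using r(1) by (auto elim: Rats_cases)
  have gs: "gsum t b = (-1) ^ b * lat_sum t b 0"
    using infsumI[OF gsum_lat_sum, of t b] assms(1) by (simp add: gsum_def)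
  \<comment> \<open>Only \<open>w ^ 4\<close> is known to be a monomial in the Gamma value and
    \<open>inverse pi\<close>, up to a rational factor; divisibility of \<open>t + b\<close> by 4 is
    what lets it be used.\<close>
  have W: "w ^ (t + b) = ((Gamma (1/4) ^ 4) ^ 2 * inverse pi ^ 2 / 64) ^ k"
  proof -
    have "w ^ 4 = (Gamma (1/4) ^ 4) ^ 2 * inverse pi ^ 2 / 64"
      unfolding w_def Beta_power4 by (simp add: field_simps)
    then show ?thesis unfolding k by (simp only: power_mult)
  qed
  have "lat_sum t b 0 = r * of_real w ^ (t + b) * of_real (inverse pi) ^ t"
    using r(2) by (simp add: field_simps power_inverse)
  then have "gsum t b = of_real (of_rat ((-1) ^ b * r') * w ^ (t + b) * inverse pi ^ t)"
    by (simp add: gs r' of_rat_mult of_rat_power of_rat_minus of_real_of_rat)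
  also have "of_rat ((-1) ^ b * r') * w ^ (t + b) * inverse pi ^ t =
      of_rat ((-1) ^ b * r' / 64 ^ k) * (Gamma (1/4) ^ 4) ^ ((t + b) div 2) * inverse pi ^ (t + (t + b) div 2)"
    unfolding W using k
    by (simp add: power_mult_distrib power_divide of_rat_divide of_rat_power power_add flip: power_mult)
  finally show ?thesis by (rule that)
qed

section \<open>Linear combinations with prescribed exponents, and polynomial numerators\<close>

definition poly_span :: "(nat \<times> nat) set \<Rightarrow> real \<Rightarrow> real \<Rightarrow> real set" where
  "poly_span B x y = {\<Sum>(\<alpha>, \<beta>)\<in>S. of_rat (c \<alpha> \<beta>) * x ^ \<alpha> * y ^ \<beta> | S (c :: nat \<Rightarrow> nat \<Rightarrow> rat).
     finite S \<and> S \<subseteq> B}"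

lemma poly_span_monom: "(\<alpha>, \<beta>) \<in> B \<Longrightarrow> of_rat q * x ^ \<alpha> * y ^ \<beta> \<in> poly_span B x y"
  unfolding poly_span_def by (auto intro!: exI[of _ "{(\<alpha>, \<beta>)}"] exI[of _ "\<lambda>_ _. q"])

lemma poly_span_0: "0 \<in> poly_span B x y"
  unfolding poly_span_def by (auto intro!: exI[of _ "{}"])

lemma poly_span_add:
  assumes "u \<in> poly_span B x y" "v \<in> poly_span B x y"
  shows "u + v \<in> poly_span B x y"
proof -
  let ?m = "\<lambda>c (\<alpha>, \<beta>). of_rat (c \<alpha> \<beta>) * x ^ \<alpha> * y ^ \<beta>"
  obtain S c where S: "finite S" "S \<subseteq> B" "u = (\<Sum>z\<in>S. ?m c z)"
    using assms(1) by (auto simp: poly_span_def)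
  obtain T d where T: "finite T" "T \<subseteq> B" "v = (\<Sum>z\<in>T. ?m d z)"
    using assms(2) by (auto simp: poly_span_def)
  define e where "e = (\<lambda>\<alpha> \<beta>. (if (\<alpha>, \<beta>) \<in> S then c \<alpha> \<beta> else 0) + (if (\<alpha>, \<beta>) \<in> T then d \<alpha> \<beta> else 0))"
  have "(\<Sum>z\<in>S \<union> T. ?m e z) = (\<Sum>z\<in>S \<union> T. if z \<in> S then ?m c z else 0) + (\<Sum>z\<in>S \<union> T. if z \<in> T then ?m d z else 0)"
    unfolding sum.distrib[symmetric]
    by (intro sum.cong refl) (auto simp: e_def of_rat_add algebra_simps)
  also have "\<dots> = u + v"
    using S T by (simp add: sum.If_cases Int_absorb1 Int_absorb2 Int_Un_distrib2 sum.inter_restrict[symmetric])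
  finally have "u + v = (\<Sum>z\<in>S \<union> T. ?m e z)" ..
  then show ?thesis
    using S T unfolding poly_span_def by blast
qed

lemma poly_span_cmult:
  assumes "r \<in> \<rat>" "u \<in> poly_span B x y"
  shows "r * u \<in> poly_span B x y"
proof -
  obtain S c where S: "finite S" "S \<subseteq> B" "u = (\<Sum>(\<alpha>, \<beta>)\<in>S. of_rat (c \<alpha> \<beta>) * x ^ \<alpha> * y ^ \<beta>)"
    using assms(2) by (auto simp: poly_span_def)
  obtain r' where r': "r = of_rat r'" using assms(1) by (auto elim: Rats_cases)
  have "r * u = (\<Sum>(\<alpha>, \<beta>)\<in>S. of_rat (r' * c \<alpha> \<beta>) * x ^ \<alpha> * y ^ \<beta>)"
    by (simp add: S(3) r' sum_distrib_left of_rat_mult case_prod_unfold mult_ac)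
  then show ?thesis
    using S unfolding poly_span_def by (auto intro!: exI[of _ S] exI[of _ "\<lambda>\<alpha> \<beta>. r' * c \<alpha> \<beta>"])
qed

text \<open>The scalars met on the way lie in \<open>\<rat>(\<i>)\<close>, so values are collected
  in a space over this field; the integral is real and is recovered as a real part.\<close>

definition poly_span_complex :: "(nat \<times> nat) set \<Rightarrow> real \<Rightarrow> real \<Rightarrow> complex set" where
  "poly_span_complex B x y = {z. Re z \<in> poly_span B x y \<and> Im z \<in> poly_span B x y}"

lemma poly_span_complex_of_real: "u \<in> poly_span B x y \<Longrightarrow> of_real u \<in> poly_span_complex B x y"
  by (simp add: poly_span_complex_def poly_span_0)

definition gauss_rat :: "complex set" where
  "gauss_rat = {z. Re z \<in> \<rat> \<and> Im z \<in> \<rat>}"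

lemma gauss_rat_closed [intro]:
  "u \<in> gauss_rat \<Longrightarrow> v \<in> gauss_rat \<Longrightarrow> u + v \<in> gauss_rat"
  "u \<in> gauss_rat \<Longrightarrow> v \<in> gauss_rat \<Longrightarrow> u - v \<in> gauss_rat"
  "u \<in> gauss_rat \<Longrightarrow> v \<in> gauss_rat \<Longrightarrow> u * v \<in> gauss_rat"
  "u \<in> gauss_rat \<Longrightarrow> - u \<in> gauss_rat"
  "u \<in> gauss_rat \<Longrightarrow> cnj u \<in> gauss_rat"
  "\<i> \<in> gauss_rat" "1 \<in> gauss_rat" "0 \<in> gauss_rat" "of_nat n \<in> gauss_rat" "numeral k \<in> gauss_rat"
  by (auto simp: gauss_rat_def)

lemma gauss_rat_power [intro]: "u \<in> gauss_rat \<Longrightarrow> u ^ n \<in> gauss_rat"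
  by (induction n) auto

lemma gauss_rat_inverse [intro]:
  assumes "u \<in> gauss_rat"
  shows "inverse u \<in> gauss_rat"
  using assms by (auto simp: gauss_rat_def intro!: Rats_divide Rats_add Rats_power)

lemma poly_span_complex_add:
  "u \<in> poly_span_complex B x y \<Longrightarrow> v \<in> poly_span_complex B x y \<Longrightarrow> u + v \<in> poly_span_complex B x y"
  by (auto simp: poly_span_complex_def poly_span_add)

lemma poly_span_complex_cmult:
  assumes "c \<in> gauss_rat" "u \<in> poly_span_complex B x y"
  shows "c * u \<in> poly_span_complex B x y"
proof -
  have "Re c * Re u + (- Im c) * Im u \<in> poly_span B x y" "Re c * Im u + Im c * Re u \<in> poly_span B x y"
    by (intro poly_span_add poly_span_cmult; use assms in \<open>simp add: gauss_rat_def poly_span_complex_def\<close>)+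
  then show ?thesis by (simp add: poly_span_complex_def)
qed

text \<open>Polynomials over \<open>\<rat>(\<i>)\<close> in \<open>p\<close> and
  \<open>cnj p\<close> of total degree at most \<open>d\<close>. As a closure of monomials under
  addition they permit rule induction, with no coefficient arrays.\<close>

inductive gauss_poly :: "nat \<Rightarrow> (complex \<Rightarrow> complex) \<Rightarrow> bool" where
  monom: "c \<in> gauss_rat \<Longrightarrow> s + t \<le> d \<Longrightarrow> gauss_poly d (\<lambda>p. c * p ^ s * cnj p ^ t)"
| add: "gauss_poly d F \<Longrightarrow> gauss_poly d G \<Longrightarrow> gauss_poly d (\<lambda>p. F p + G p)"

lemma gauss_poly_affine_mult:
  assumes "gauss_poly d F" "u \<in> gauss_rat" "v \<in> gauss_rat" "x \<in> gauss_rat"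
  shows "gauss_poly (Suc d) (\<lambda>p. (u * p + v * cnj p + x) * F p)"
  using assms(1)
proof induction
  case (monom c s t d)
  have "gauss_poly (Suc d) (\<lambda>p. (u * c) * p ^ Suc s * cnj p ^ t + (v * c) * p ^ s * cnj p ^ Suc t + (x * c) * p ^ s * cnj p ^ t)"
    using monom assms by (intro gauss_poly.add gauss_poly.monom) auto
  then show ?case by (simp add: algebra_simps)
next
  case (add d F G)
  from gauss_poly.add[OF add.IH] show ?case by (simp add: algebra_simps)
qed

lemma gauss_poly_scale:
  assumes "gauss_poly d F" "l \<in> gauss_rat"
  shows "gauss_poly d (\<lambda>p. F (l * p))"
  using assms(1)
proof induction
  case (monom c s t d)
  have "gauss_poly d (\<lambda>p. (c * l ^ s * cnj l ^ t) * p ^ s * cnj p ^ t)"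
    using monom assms by (intro gauss_poly.monom) auto
  then show ?case by (simp add: power_mult_distrib mult_ac)
next
  case (add d F G)
  from gauss_poly.add[OF add.IH] show ?case .
qed

lemma gauss_poly_const: "c \<in> gauss_rat \<Longrightarrow> gauss_poly d (\<lambda>_. c)"
  using gauss_poly.monom[of c 0 0 d] by simp

text \<open>A monomial contributes \<open>gsum t (n - s)\<close>, and \<open>n \<ge> d + 4\<close>
  ensures \<open>n - s \<ge> t + 4\<close>. The set \<open>B\<close> need only contain the exponents
  with 4 dividing \<open>t + (n - s)\<close>, as the other sums vanish.\<close>

lemma gauss_poly_sum:
  assumes "gauss_poly d F" "n \<ge> d + 4"
    and B: "\<And>s t. s + t \<le> d \<Longrightarrow> 4 dvd (t + (n - s)) \<Longrightarrow> ((t + (n - s)) div 2, t + (t + (n - s)) div 2) \<in> B"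
  shows "\<exists>S\<in>poly_span_complex B (Gamma (1/4) ^ 4) (inverse pi). ((\<lambda>p. F p / p ^ n) has_sum S) gauss'"
  using assms
proof induction
  case (monom c s t d)
  let ?V = "poly_span_complex B (Gamma (1/4) ^ 4) (inverse pi)"
  have "((\<lambda>p. c * (cnj p ^ t / p ^ (n - s))) has_sum c * gsum t (n - s)) gauss'"
    by (intro has_sum_cmult_right gsum_has_sum) (use monom in auto)
  also have "?this \<longleftrightarrow> ((\<lambda>p. c * p ^ s * cnj p ^ t / p ^ n) has_sum c * gsum t (n - s)) gauss'"
  proof (intro has_sum_cong)
    fix p assume "p \<in> gauss'"
    moreover have "p ^ n = p ^ s * p ^ (n - s)" using monom by (simp flip: power_add)
    ultimately show "c * (cnj p ^ t / p ^ (n - s)) = c * p ^ s * cnj p ^ t / p ^ n" by simp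
  qed
  finally have hs: "((\<lambda>p. c * p ^ s * cnj p ^ t / p ^ n) has_sum c * gsum t (n - s)) gauss'" .
  have "gsum t (n - s) \<in> ?V"
  proof (cases "4 dvd (t + (n - s))")
    case True
    have "n - s \<ge> t + 4" using monom by simp
    then obtain q where "gsum t (n - s) = of_real (of_rat q * (Gamma (1/4) ^ 4) ^ ((t + (n - s)) div 2) *
        inverse pi ^ (t + (t + (n - s)) div 2))"
      using gsum_eq True by metis
    then show ?thesis
      using poly_span_complex_of_real[OF poly_span_monom[OF monom.prems(2)[OF monom.hyps(2) True]]]
      by (simp only:)
  next
    case False
    then show ?thesis using poly_span_0 by (simp add: gsum_eq_0 poly_span_complex_def)
  qed
  then have "c * gsum t (n - s) \<in> ?V" using monom by (intro poly_span_complex_cmult)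
  then show ?case using hs by blast
next
  case (add d F G)
  then obtain S T where "S \<in> poly_span_complex B (Gamma (1/4) ^ 4) (inverse pi)" "T \<in> poly_span_complex B (Gamma (1/4) ^ 4) (inverse pi)"
    "((\<lambda>p. F p / p ^ n) has_sum S) gauss'" "((\<lambda>p. G p / p ^ n) has_sum T) gauss'"
    by blast
  then show ?case
    by (intro bexI[of _ "S + T"]) (auto simp: add_divide_distrib intro: has_sum_add poly_span_complex_add)
qed

section \<open>Sums over a quadrant\<close>

text \<open>For \<open>k = 2 * j + m\<close> this is \<open>2 ^ (m - 1) * (m - 1)!\<close> times \<open>(j + m - 1) choose (m - 1)\<close>, and it vanishes
  at the other \<open>k > 0\<close> congruent to \<open>m\<close> modulo 2, so sums over \<open>j \<ge> 0\<close> become sums over a parity class.\<close>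

definition binom_poly :: "nat \<Rightarrow> complex \<Rightarrow> complex" where
  "binom_poly m x = (\<Prod>i\<in>{1..<m}. x - of_nat m + 2 * of_nat i)"

text \<open>The roots \<open>m - 2 * i\<close> are symmetric about 0, so reversing the product only
  changes the sign of each of its \<open>m - 1\<close> factors.\<close>

lemma binom_poly_uminus: "binom_poly m (- x) = (-1) ^ (m - 1) * binom_poly m x"
proof -
  have "binom_poly m (- x) = (\<Prod>i\<in>{1..<m}. - x - of_nat m + 2 * of_nat (m - i))"
    unfolding binom_poly_def by (rule prod.reindex_bij_witness[of _ "\<lambda>i. m - i" "\<lambda>i. m - i"]) auto
  also have "\<dots> = (\<Prod>i\<in>{1..<m}. (-1) * (x - of_nat m + 2 * of_nat i))"
    by (rule prod.cong) (auto simp: of_nat_diff)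
  also have "\<dots> = (-1) ^ (m - 1) * binom_poly m x"
    by (simp only: prod.distrib prod_constant card_atLeastLessThan binom_poly_def)
  finally show ?thesis .
qed

lemma binom_poly_eq_0:
  assumes "\<bar>k\<bar> < int m" "even (k - int m)"
  shows "binom_poly m (of_int k) = 0"
proof -
  obtain l where l: "k - int m = 2 * l" using assms(2) by (rule evenE)
  define i where "i = nat (- l)"
  have i: "i \<in> {1..<m}" "int i = - l" using l assms(1) by (auto simp: i_def)
  have "of_int k - of_nat m + 2 * of_nat i = (of_int (k - int m + 2 * int i) :: complex)" by simp
  also have "\<dots> = 0" using i l by simp
  finally show ?thesis
    unfolding binom_poly_def using i(1) by (intro prod_zero) auto
qed

text \<open>The sign of \<open>Im p\<close> is such that \<open>p = J - \<i> * K\<close> gives the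
  value of \<open>binom_poly m\<close> at \<open>J\<close> times that at \<open>K\<close>.\<close>

definition lat_num :: "nat \<Rightarrow> complex \<Rightarrow> complex" where
  "lat_num m p = binom_poly m (of_real (Re p)) * binom_poly m (of_real (- Im p))"

lemma gauss_poly_prod:
  assumes "finite I" "\<And>i. i \<in> I \<Longrightarrow> u i \<in> gauss_rat \<and> v i \<in> gauss_rat \<and> x i \<in> gauss_rat" "gauss_poly d F"
  shows "gauss_poly (card I + d) (\<lambda>p. (\<Prod>i\<in>I. u i * p + v i * cnj p + x i) * F p)"
  using assms(1,2)
proof (induction rule: finite_induct)
  case empty
  then show ?case using assms(3) by simp
next
  case (insert i I)
  then have "gauss_poly (Suc (card I + d)) (\<lambda>p. (u i * p + v i * cnj p + x i) *
      ((\<Prod>i\<in>I. u i * p + v i * cnj p + x i) * F p))"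
    by (intro gauss_poly_affine_mult) auto
  then show ?case using insert.hyps by (simp add: mult.assoc)
qed

text \<open>\<open>Re p = (p + cnj p) / 2\<close> and \<open>- Im p = \<i> * (p - cnj p) / 2\<close>
  make each linear factor affine in \<open>p\<close> and \<open>cnj p\<close>.\<close>

lemma gauss_poly_lat_num: "gauss_poly (2 * (m - 1)) (lat_num m)"
proof -
  have half: "inverse 2 \<in> gauss_rat" "\<i> * inverse 2 \<in> gauss_rat" "- (\<i> * inverse 2) \<in> gauss_rat"
    by (rule gauss_rat_inverse gauss_rat_closed)+
  have x: "2 * of_nat i - of_nat m \<in> gauss_rat" for i by auto
  have "gauss_poly (card {1..<m} + (card {1..<m} + 0)) (\<lambda>p. (\<Prod>i\<in>{1..<m}. inverse 2 * p + inverse 2 * cnj p + (2 * of_nat i - of_nat m)) *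
     ((\<Prod>i\<in>{1..<m}. \<i> * inverse 2 * p + (- (\<i> * inverse 2)) * cnj p + (2 * of_nat i - of_nat m)) * 1))"
    using half x by (intro gauss_poly_prod gauss_poly_const) auto
  also have "(\<lambda>p. (\<Prod>i\<in>{1..<m}. inverse 2 * p + inverse 2 * cnj p + (2 * of_nat i - of_nat m)) *
     ((\<Prod>i\<in>{1..<m}. \<i> * inverse 2 * p + (- (\<i> * inverse 2)) * cnj p + (2 * of_nat i - of_nat m)) * 1)) = lat_num m"
  proof
    fix p :: complex
    have "inverse 2 * p + inverse 2 * cnj p = of_real (Re p)"
      "\<i> * inverse 2 * p + (- (\<i> * inverse 2)) * cnj p = of_real (- Im p)"
      by (simp_all add: complex_eq_iff)
    then show "(\<Prod>i\<in>{1..<m}. inverse 2 * p + inverse 2 * cnj p + (2 * of_nat i - of_nat m)) *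
       ((\<Prod>i\<in>{1..<m}. \<i> * inverse 2 * p + (- (\<i> * inverse 2)) * cnj p + (2 * of_nat i - of_nat m)) * 1) = lat_num m p"
      by (simp only: lat_num_def binom_poly_def mult_1_right) (simp add: algebra_simps)
  qed
  finally show ?thesis by (simp add: mult_2)
qed

lemma lat_num_ii:
  "lat_num m (\<i> * p) = (-1) ^ (m - 1) * lat_num m p"
  using binom_poly_uminus[of m "of_real (Re p)"] by (simp add: lat_num_def)

section \<open>Parity classes as multiples of the lattice by 1 + i and 2\<close>

definition even_sum :: "complex set" where
  "even_sum = {Complex (of_int j) (of_int k) | j k. even (j + k)} - {0}"

definition both_even :: "complex set" where
  "both_even = {Complex (of_int j) (of_int k) | j k. even j \<and> even k} - {0}"

lemma gauss_obtain:
  assumes "p \<in> gauss"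
  obtains j k :: int where "p = Complex (of_int j) (of_int k)"
  using assms by (auto simp: gauss_def complex_eq_iff elim!: Ints_cases)

lemma Complex_of_int_in_gauss [simp]: "Complex (of_int j) (of_int k) \<in> gauss"
  by (simp add: gauss_def)

lemma bij_betw_even_sum: "bij_betw (\<lambda>p. (1 + \<i>) * p) gauss' even_sum"
proof (rule bij_betwI')
  fix p assume w: "p \<in> gauss'"
  then obtain j k :: int where jk: "p = Complex (of_int j) (of_int k)" using gauss_obtain by blast
  have "(1 + \<i>) * p = Complex (of_int (j - k)) (of_int (j + k))" by (simp add: jk complex_eq_iff)
  moreover have "even (j - k + (j + k))" by simp
  moreover have "(1 + \<i>) * p \<noteq> 0" using w by (auto simp: complex_eq_iff)
  ultimately show "(1 + \<i>) * p \<in> even_sum" unfolding even_sum_def by blast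
next
  fix p assume w: "p \<in> even_sum"
  then obtain j k where jk: "p = Complex (of_int j) (of_int k)" "even (j + k)" by (auto simp: even_sum_def)
  from jk(2) obtain l where l: "j + k = 2 * l" by (rule evenE)
  \<comment> \<open>The witness is \<open>p * (1 - \<i>) / 2\<close>, with real part
    \<open>(j + k) / 2\<close> and imaginary part \<open>(k - j) / 2\<close>.\<close>
  have "p = (1 + \<i>) * Complex (of_int l) (of_int (l - j))"
    using l by (simp add: jk complex_eq_iff)
  moreover from this have "Complex (of_int l) (of_int (l - j)) \<noteq> 0" using w by (auto simp: even_sum_def)
  ultimately show "\<exists>x\<in>gauss'. p = (1 + \<i>) * x"
    by (intro bexI[of _ "Complex (of_int l) (of_int (l - j))"]) (auto simp del: of_int_diff)
qed (auto simp: complex_eq_iff)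

lemma bij_betw_both_even: "bij_betw (\<lambda>p. 2 * p) gauss' both_even"
proof (rule bij_betwI')
  fix p assume w: "p \<in> gauss'"
  then obtain j k :: int where jk: "p = Complex (of_int j) (of_int k)" using gauss_obtain by blast
  have "2 * p = Complex (of_int (2 * j)) (of_int (2 * k))" by (simp add: jk complex_eq_iff)
  moreover have "even (2 * j) \<and> even (2 * k)" by simp
  ultimately have "\<exists>j k. 2 * p = Complex (of_int j) (of_int k) \<and> even j \<and> even k" by blast
  then show "2 * p \<in> both_even" using w by (simp add: both_even_def)
next
  fix p assume w: "p \<in> both_even"
  then obtain j k where jk: "p = Complex (of_int (2 * j)) (of_int (2 * k))"
    by (auto simp: both_even_def elim!: evenE)
  then have "p = 2 * Complex (of_int j) (of_int k)" by (simp add: complex_eq_iff)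
  then show "\<exists>x\<in>gauss'. p = 2 * x"
    using w by (intro bexI[of _ "Complex (of_int j) (of_int k)"]) (auto simp: both_even_def)
qed auto

lemma both_even_subset: "both_even \<subseteq> even_sum"
  unfolding both_even_def even_sum_def by auto

definition parity_class :: "nat \<Rightarrow> complex set" where
  "parity_class m = {Complex (of_int j) (of_int k) | j k. even (j - int m) \<and> even (k - int m)} - {0}"

text \<open>Pairs of odd numbers do not form a multiple of the lattice, but they are those with even
  sum that are not both even. Either class is thus reached from full lattice sums by rescaling and
  subtraction.\<close>

lemma parity_class_eq: "parity_class m = (if even m then both_even else even_sum - both_even)"
proof (cases "even m")
  case True
  then show ?thesis by (simp add: parity_class_def both_even_def)
next
  case False
  have "(\<exists>j k. p = Complex (of_int j) (of_int k) \<and> odd j \<and> odd k) \<longleftrightarrow>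
     (\<exists>j k. p = Complex (of_int j) (of_int k) \<and> even (j + k)) \<and>
     \<not> (\<exists>j k. p = Complex (of_int j) (of_int k) \<and> even j \<and> even k)" for p
    by (auto simp: complex_eq_iff)
  then show ?thesis using False by (auto simp: parity_class_def both_even_def even_sum_def)
qed

context
  fixes m n :: nat and B :: "(nat \<times> nat) set"
  assumes m: "m > 0" and n: "n \<ge> 2 * m + 2" "n mod 4 = (2 * m + 2) mod 4"
    and B: "\<And>s t. s + t \<le> 2 * (m - 1) \<Longrightarrow> 4 dvd (t + (n - s)) \<Longrightarrow>
      ((t + (n - s)) div 2, t + (t + (n - s)) div 2) \<in> B"
begin

abbreviation "lat_span \<equiv> poly_span_complex B (Gamma (1/4) ^ 4) (inverse pi)"

definition lat_term :: "complex \<Rightarrow> complex" where "lat_term p = lat_num m p / p ^ n"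

lemma lat_term_scaled_sum:
  assumes l: "l \<in> gauss_rat" and bij: "bij_betw (\<lambda>p. l * p) gauss' A"
  shows "\<exists>S\<in>lat_span. (lat_term has_sum S) A"
proof -
  have "\<exists>S\<in>lat_span. ((\<lambda>p. lat_num m (l * p) / p ^ n) has_sum S) gauss'"
    by (rule gauss_poly_sum[OF gauss_poly_scale[OF gauss_poly_lat_num l]]) (use B n m in auto)
  then obtain S where S: "S \<in> lat_span" "((\<lambda>p. lat_num m (l * p) / p ^ n) has_sum S) gauss'" by blast
  have "((\<lambda>p. inverse l ^ n * (lat_num m (l * p) / p ^ n)) has_sum inverse l ^ n * S) gauss'"
    by (rule has_sum_cmult_right) fact
  also have "?this \<longleftrightarrow> ((\<lambda>p. lat_term (l * p)) has_sum inverse l ^ n * S) gauss'"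
    by (intro has_sum_cong) (simp add: lat_term_def power_mult_distrib field_simps power_inverse)
  also have "\<dots> \<longleftrightarrow> (lat_term has_sum inverse l ^ n * S) A"
    by (rule has_sum_reindex_bij_betw[OF bij])
  finally show ?thesis using S(1) l by (intro bexI[of _ "inverse l ^ n * S"]) (auto intro!: poly_span_complex_cmult)
qed

lemma lat_term_sum: "\<exists>S\<in>lat_span. (lat_term has_sum S) (parity_class m)"
proof -
  obtain S2 where S2: "S2 \<in> lat_span" "(lat_term has_sum S2) both_even"
    using lat_term_scaled_sum[OF _ bij_betw_both_even] by auto
  obtain S1 where S1: "S1 \<in> lat_span" "(lat_term has_sum S1) even_sum"
    using lat_term_scaled_sum[OF _ bij_betw_even_sum] by auto
  have "(lat_term has_sum (S1 - S2)) (even_sum - both_even)"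
    by (rule has_sum_Diff) (use S1 S2 both_even_subset in auto)
  moreover have "S1 + (-1) * S2 \<in> lat_span"
    using S1 S2 by (intro poly_span_complex_add poly_span_complex_cmult) auto
  ultimately show ?thesis
    unfolding parity_class_eq using S2 by auto
qed

text \<open>The congruence on \<open>n\<close> enters here: it gives
  \<open>\<i> ^ n = (-1) ^ (m + 1)\<close>, which cancels the sign in
  \<open>lat_num_ii\<close>.\<close>

lemma lat_term_ii: "lat_term (\<i> * p) = lat_term p"
proof -
  have "\<i> ^ n = \<i> ^ (2 * (m + 1))"
    using n(2) ii_power_mod_4[of n] ii_power_mod_4[of "2 * (m + 1)"] by simp
  also have "\<dots> = (-1) ^ (m + 1)" by (simp only: power_mult power2_i)
  also have "\<dots> = (-1) ^ (m - 1)" using m by (cases m) auto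
  finally show ?thesis
    by (simp add: lat_term_def lat_num_ii power_mult_distrib)
qed

definition quadrant :: "complex set" where
  "quadrant = {p \<in> parity_class m. Re p > 0 \<and> Im p < 0}"

lemma parity_class_ii: "p \<in> parity_class m \<Longrightarrow> \<i> * p \<in> parity_class m"
proof -
  assume "p \<in> parity_class m"
  then obtain j k where jk: "p = Complex (of_int j) (of_int k)" "even (j - int m)" "even (k - int m)" "p \<noteq> 0"
    by (auto simp: parity_class_def)
  have "\<i> * p = Complex (of_int (- k)) (of_int j)" by (simp add: jk complex_eq_iff)
  moreover have "even (- k - int m)" using jk(3) by simp
  ultimately have "\<exists>j k. \<i> * p = Complex (of_int j) (of_int k) \<and> even (j - int m) \<and> even (k - int m)"
    using jk(2) by blast
  then show ?thesis using jk(4) by (simp add: parity_class_def)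
qed

lemma parity_class_ii_iff: "\<i> * p \<in> parity_class m \<longleftrightarrow> p \<in> parity_class m"
proof
  assume "\<i> * p \<in> parity_class m"
  from parity_class_ii[OF parity_class_ii[OF parity_class_ii[OF this]]]
  show "p \<in> parity_class m" by simp
qed (rule parity_class_ii)

text \<open>The four rotations of the quadrant cover the parity class up to the axes, where the
  summand vanishes; all four carry the same sum.\<close>

lemma quadrant_sum: "\<exists>S\<in>lat_span. (lat_term has_sum S) quadrant"
proof -
  obtain T where T: "T \<in> lat_span" "(lat_term has_sum T) (parity_class m)" using lat_term_sum by blast
  have "lat_term summable_on quadrant"
    using T(2) by (rule summable_on_subset_banach[OF has_sum_imp_summable]) (auto simp: quadrant_def)
  then obtain S where S: "(lat_term has_sum S) quadrant" by (auto simp: summable_on_def)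
  define f where "f = (\<lambda>p. if p \<in> quadrant then lat_term p else 0)"
  have f: "(f has_sum S) (parity_class m)"
    using S by (subst has_sum_cong_neutral[where T = quadrant and g = lat_term]) (auto simp: f_def quadrant_def)
  have rot: "((\<lambda>p. g (\<i> * p)) has_sum S) (parity_class m)" if "(g has_sum S) (parity_class m)" for g
  proof (subst has_sum_reindex_bij_witness[of _ "\<lambda>p. - \<i> * p" "\<lambda>p. \<i> * p"])
    fix p assume "p \<in> parity_class m"
    then show "- \<i> * p \<in> parity_class m"
      by (subst parity_class_ii_iff[symmetric]) simp
  qed (use that in \<open>auto simp: parity_class_ii\<close>)
  have "((\<lambda>p. f p + f (\<i> * p) + f (\<i> * (\<i> * p)) + f (\<i> * (\<i> * (\<i> * p)))) has_sum S + S + S + S) (parity_class m)"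
    by (intro has_sum_add f rot[OF f] rot[OF rot[OF f]] rot[OF rot[OF rot[OF f]]])
  also have "?this \<longleftrightarrow> (lat_term has_sum S + S + S + S) (parity_class m)"
  proof (intro has_sum_cong)
    fix p assume w: "p \<in> parity_class m"
    have inv: "lat_term (- p) = lat_term p" "lat_term (- (\<i> * p)) = lat_term p"
      using lat_term_ii[of "\<i> * p"] lat_term_ii[of "\<i> * (\<i> * p)"] by (simp_all add: lat_term_ii)
    have cl: "- p \<in> parity_class m" "- (\<i> * p) \<in> parity_class m"
      using parity_class_ii_iff[of "\<i> * p"] parity_class_ii_iff[of "\<i> * (\<i> * p)"] w
      by (simp_all add: parity_class_ii_iff)
    have z: "lat_term p = 0" if "Re p = 0 \<or> Im p = 0"
    proof -
      obtain j k where jk: "p = Complex (of_int j) (of_int k)" "even (j - int m)" "even (k - int m)"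
        using w by (auto simp: parity_class_def)
      \<comment> \<open>A coordinate 0 has the parity of \<open>m\<close>, so \<open>m\<close> is
        even and 0 is a root of \<open>binom_poly m\<close>.\<close>
      have "even (0 - int m)" using that jk by auto
      then have "binom_poly m (of_int 0) = 0" by (rule binom_poly_eq_0[rotated]) (use m in auto)
      then show ?thesis using that by (auto simp: lat_term_def lat_num_def)
    qed
    show "f p + f (\<i> * p) + f (\<i> * (\<i> * p)) + f (\<i> * (\<i> * (\<i> * p))) = lat_term p"
    proof -
      consider "Re p = 0 \<or> Im p = 0" | "Re p > 0" "Im p < 0" | "Re p > 0" "Im p > 0"
        | "Re p < 0" "Im p < 0" | "Re p < 0" "Im p > 0" by linarith
      then show ?thesis
        by cases (use z w cl in \<open>auto simp: f_def quadrant_def parity_class_ii_iff inv lat_term_ii\<close>)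
    qed
  qed
  finally have "S + S + S + S = T" using T(2) has_sum_unique by blast
  then have S4: "S = inverse 4 * T" by auto
  have "inverse 4 * T \<in> lat_span"
    using T(1) by (intro poly_span_complex_cmult gauss_rat_inverse gauss_rat_closed)
  then have "S \<in> lat_span" unfolding S4 .
  then show ?thesis using S by blast
qed

lemma quadrant_nat_sum:
  "\<exists>S\<in>lat_span. ((\<lambda>(j, k). binom_poly m (of_nat (2 * j + m)) * binom_poly m (of_nat (2 * k + m)) /
     Complex (of_nat (2 * j + m)) (- of_nat (2 * k + m)) ^ n) has_sum S) (UNIV :: (nat \<times> nat) set)"
proof -
  let ?w = "\<lambda>(j, k). Complex (of_nat (2 * j + m)) (- of_nat (2 * k + m))"
  obtain S where S: "S \<in> lat_span" "(lat_term has_sum S) quadrant" using quadrant_sum by blast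
  have in_quad: "?w jk \<in> quadrant" for jk :: "nat \<times> nat"
  proof (cases jk)
    case (Pair j k)
    have "?w jk = Complex (of_int (int (2 * j + m))) (of_int (- int (2 * k + m)))" by (simp add: Pair)
    moreover have "even (int (2 * j + m) - int m)" "even (- int (2 * k + m) - int m)" by simp_all
    moreover have "?w jk \<noteq> 0" using m by (simp add: Pair complex_eq_iff)
    ultimately have "?w jk \<in> parity_class m" unfolding parity_class_def by blast
    then show ?thesis using m by (simp add: quadrant_def Pair)
  qed
  have zero: "lat_term p = 0" if w: "p \<in> quadrant" "p \<notin> range ?w" for p
  proof -
    obtain j k where jk: "p = Complex (of_int j) (of_int k)" "even (j - int m)" "even (k - int m)"
      using w(1) by (auto simp: quadrant_def parity_class_def)
    have pos: "j > 0" "k < 0" using w(1) jk by (auto simp: quadrant_def)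
    \<comment> \<open>A point not of the form in \<open>?w\<close> has a coordinate of absolute
      value below \<open>m\<close>, hence at a root of \<open>binom_poly m\<close>.\<close>
    have "j < int m \<or> - k < int m"
    proof (rule ccontr)
      assume "\<not> (j < int m \<or> - k < int m)"
      then have ge: "j - int m \<ge> 0" "- k - int m \<ge> 0" by auto
      obtain j' k' where j': "j - int m = 2 * j'" and k': "- k - int m = 2 * k'"
        using jk by (metis evenE even_minus minus_diff_eq dvd_diff_commute even_diff even_add)
      have "p = ?w (nat j', nat k')"
        using ge j' k' by (simp add: jk complex_eq_iff)
      then show False using w(2) by blast
    qed
    then show ?thesis
    proof
      assume "j < int m"
      then have "binom_poly m (of_int j) = 0" using pos jk by (intro binom_poly_eq_0) auto
      then show ?thesis by (simp add: lat_term_def lat_num_def jk)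
    next
      assume "- k < int m"
      then have "binom_poly m (of_int (- k)) = 0" using pos jk by (intro binom_poly_eq_0) auto
      then show ?thesis by (simp add: lat_term_def lat_num_def jk)
    qed
  qed
  have "(lat_term has_sum S) (range ?w)"
    using S(2) by (subst has_sum_cong_neutral[where T = quadrant and g = lat_term]) (use zero in_quad in auto)
  moreover have "inj ?w" by (auto intro!: injI)
  ultimately have "((lat_term \<circ> ?w) has_sum S) UNIV"
    by (subst (asm) has_sum_reindex)
  moreover have "lat_term (?w (j, k)) = binom_poly m (of_nat (2 * j + m)) * binom_poly m (of_nat (2 * k + m)) /
     Complex (of_nat (2 * j + m)) (- of_nat (2 * k + m)) ^ n" for j k
    by (simp add: lat_term_def lat_num_def add.commute)
  ultimately show ?thesis using S(1) by (auto simp: o_def case_prod_unfold)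
qed

end

section \<open>Laplace integrals and negative binomial series\<close>

lemma einterval_0_inf: "einterval 0 \<infinity> = {0<..}"
  by (auto simp: einterval_def)

text \<open>Integration by parts, by induction on \<open>a\<close>. The limit at infinity and the
  value at 0 are what the fundamental theorem of calculus will need.\<close>

lemma laplace_antiderivative:
  fixes s :: complex
  assumes s: "Re s > 0"
  shows "\<exists>G. (\<forall>x. (G has_vector_derivative of_real x ^ a * exp (- (s * of_real x))) (at x)) \<and>
    (G \<longlongrightarrow> 0) at_top \<and> G 0 = - fact a / s ^ Suc a"
proof -
  have s0: "s \<noteq> 0" using s by auto
  have dexp: "((\<lambda>x. exp (- (s * of_real x))) has_vector_derivative - s * exp (- (s * of_real x))) (at x)" for x
    by (rule has_vector_derivative_real_field) (auto intro!: derivative_eq_intros)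
  have lim: "((\<lambda>x. of_real x ^ k * exp (- (s * of_real x))) \<longlongrightarrow> 0) at_top" for k
  proof (rule tendsto_norm_zero_cancel)
    have "filterlim (\<lambda>x. Re s * x) at_top at_top"
      by (rule filterlim_tendsto_pos_mult_at_top[OF tendsto_const s filterlim_ident])
    then have "((\<lambda>x. inverse (Re s) ^ k * ((Re s * x) ^ k / exp (Re s * x))) \<longlongrightarrow> inverse (Re s) ^ k * 0) at_top"
      by (intro tendsto_mult tendsto_const filterlim_compose[OF tendsto_power_div_exp_0])
    then have "((\<lambda>x. inverse (Re s) ^ k * ((Re s * x) ^ k / exp (Re s * x))) \<longlongrightarrow> 0) at_top" by simp
    then show "((\<lambda>x. norm (of_real x ^ k * exp (- (s * of_real x)))) \<longlongrightarrow> 0) at_top"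
    proof (rule Lim_transform_eventually)
      show "\<forall>\<^sub>F x in at_top. inverse (Re s) ^ k * ((Re s * x) ^ k / exp (Re s * x)) = norm (of_real x ^ k * exp (- (s * of_real x)))"
        using eventually_ge_at_top[of 0]
      proof eventually_elim
        case (elim x)
        have "norm (of_real x ^ k * exp (- (s * of_real x))) = x ^ k * exp (- (Re s * x))"
          using elim by (simp add: norm_mult norm_power)
        also have "\<dots> = inverse (Re s) ^ k * ((Re s * x) ^ k / exp (Re s * x))"
          using s by (simp add: exp_minus power_mult_distrib divide_inverse power_inverse)
        finally show ?case ..
      qed
    qed
  qed
  show ?thesis
  proof (induction a)
    case 0
    show ?case
    proof (intro exI[of _ "\<lambda>x. exp (- (s * of_real x)) * (- inverse s)"] conjI allI)
      show "((\<lambda>x. exp (- (s * of_real x)) * (- inverse s)) has_vector_derivative of_real x ^ 0 * exp (- (s * of_real x))) (at x)" for x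
        by (rule has_vector_derivative_eq_rhs[OF has_vector_derivative_mult_left[OF dexp]]) (use s0 in simp)
      show "((\<lambda>x. exp (- (s * of_real x)) * (- inverse s)) \<longlongrightarrow> 0) at_top"
        using tendsto_mult_left_zero[OF lim[of 0], of "- inverse s"] by (simp only: power_0 mult_1)
    qed (simp add: field_simps)
  next
    case (Suc a)
    then obtain G where G: "\<And>x. (G has_vector_derivative of_real x ^ a * exp (- (s * of_real x))) (at x)"
      "(G \<longlongrightarrow> 0) at_top" "G 0 = - fact a / s ^ Suc a" by blast
    let ?H = "\<lambda>x. (of_real x ^ Suc a * exp (- (s * of_real x))) * (- inverse s) + G x * (of_nat (Suc a) * inverse s)"
    show ?case
    proof (intro exI[of _ ?H] conjI allI)
      fix x :: real
      have "((\<lambda>x. complex_of_real x ^ Suc a) has_vector_derivative of_nat (Suc a) * of_real x ^ a) (at x)"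
        by (rule has_vector_derivative_real_field) (auto intro!: derivative_eq_intros simp del: of_nat_Suc power_Suc)
      from has_vector_derivative_mult[OF this dexp]
      have "((\<lambda>x. of_real x ^ Suc a * exp (- (s * of_real x))) has_vector_derivative
          of_real x ^ Suc a * (- s * exp (- (s * of_real x))) + of_nat (Suc a) * of_real x ^ a * exp (- (s * of_real x))) (at x)" .
      from has_vector_derivative_add[OF has_vector_derivative_mult_left[OF this, of "- inverse s"]
        has_vector_derivative_mult_left[OF G(1), of "of_nat (Suc a) * inverse s"]]
      show "(?H has_vector_derivative of_real x ^ Suc a * exp (- (s * of_real x))) (at x)"
      proof (rule has_vector_derivative_eq_rhs)
        have "(p * (- s * e) + n * q * e) * (- inverse s) + q * e * (n * inverse s) = p * e" for p e n q :: complex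
          using s0 by (simp add: field_simps)
        then show "(of_real x ^ Suc a * (- s * exp (- (s * of_real x))) + of_nat (Suc a) * of_real x ^ a * exp (- (s * of_real x))) * (- inverse s) +
          of_real x ^ a * exp (- (s * of_real x)) * (of_nat (Suc a) * inverse s) = of_real x ^ Suc a * exp (- (s * of_real x))" .
      qed
      show "(?H \<longlongrightarrow> 0) at_top"
        using tendsto_add[OF tendsto_mult_left_zero[OF lim[of "Suc a"]] tendsto_mult_left_zero[OF G(2)],
          of "- inverse s" "of_nat (Suc a) * inverse s"] by (simp only: add_0)
    qed (use s0 in \<open>simp add: G(3) field_simps\<close>)
  qed
qed

lemma laplace_power:
  fixes s :: complex
  assumes s: "Re s > 0"
  shows "set_integrable lborel {0<..} (\<lambda>x. of_real x ^ a * exp (- (s * of_real x)))" (is ?int)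
    and "(LBINT x:{0<..}. of_real x ^ a * exp (- (s * of_real x))) = fact a / s ^ Suc a"
proof -
  let ?f = "\<lambda>x::real. of_real x ^ a * exp (- (s * of_real x))"
  have meas: "?f \<in> borel_measurable borel"
    by (intro borel_measurable_continuous_onI continuous_intros)
  \<comment> \<open>The integrand of the Gamma integral with rate \<open>Re s\<close> has the same
    norm.\<close>
  have "(\<lambda>t. complex_of_real t powr (of_nat (Suc a) - 1) / of_real (exp (Re s * t))) absolutely_integrable_on {0<..}"
    by (rule absolutely_integrable_Gamma_integral) (use s in auto)
  then have "set_integrable lebesgue {0<..} ?f"
  proof (rule set_integrable_bound)
    show "set_borel_measurable lebesgue {0<..} ?f"
      unfolding set_borel_measurable_def by (rule measurable_completion) (use meas in simp)
    have "norm (?f x) \<le> norm (complex_of_real x powr (of_nat (Suc a) - 1) / of_real (exp (Re s * x)))" if "x > 0" for x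
    proof -
      have "norm (?f x) = x ^ a * exp (- (Re s * x))" using that by (simp add: norm_mult norm_power)
      also have "\<dots> = x ^ a / exp (Re s * x)" by (simp add: exp_minus divide_inverse)
      also have "\<dots> = norm (complex_of_real x powr (of_nat (Suc a) - 1) / of_real (exp (Re s * x)))"
        using that by (simp add: norm_divide norm_powr_real_powr powr_realpow norm_power)
      finally show ?thesis by simp
    qed
    then show "AE x in lebesgue. x \<in> {0<..} \<longrightarrow>
        norm (?f x) \<le> norm (complex_of_real x powr (of_nat (Suc a) - 1) / of_real (exp (Re s * x)))"
      by auto
  qed
  then show int: ?int
    unfolding set_integrable_def using meas by (subst (asm) integrable_completion) simp_all
  obtain G where G: "\<And>x. (G has_vector_derivative ?f x) (at x)"
      "(G \<longlongrightarrow> 0) at_top" "G 0 = - fact a / s ^ Suc a"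
    using laplace_antiderivative[OF s, of a] by blast
  have "(LBINT x=0..\<infinity>. ?f x) = 0 - G 0"
  proof (rule interval_integral_FTC_integrable)
    show "isCont ?f x" for x by (intro continuous_intros)
    show "set_integrable lborel (einterval 0 \<infinity>) ?f" using int by (simp add: einterval_0_inf)
    have "isCont G 0" using G(1) has_vector_derivative_continuous by blast
    then have "(G \<longlongrightarrow> G 0) (at_right 0)"
      unfolding isCont_def by (rule tendsto_within_subset) simp
    then show "((G \<circ> real_of_ereal) \<longlongrightarrow> G 0) (at_right 0)"
      unfolding zero_ereal_def ereal_tendsto_simps .
    show "((G \<circ> real_of_ereal) \<longlongrightarrow> 0) (at_left \<infinity>)"
      unfolding ereal_tendsto_simps by (rule G(2))
  qed (use G in auto)
  then show "(LBINT x:{0<..}. ?f x) = fact a / s ^ Suc a"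
    by (simp add: interval_lebesgue_integral_def einterval_0_inf G(3))
qed

lemma negative_binomial_sums:
  fixes z :: complex
  assumes "norm z < 1" "m > 0"
  shows "(\<lambda>n. of_nat ((n + m - 1) choose (m - 1)) * z ^ n) sums (1 / (1 - z) ^ m)"
proof -
  have "(\<lambda>n. (-1) ^ n * ((of_nat m + of_nat n - 1) gchoose n) * (- z) ^ n) sums (1 + - z) powr (- of_nat m)"
    by (rule one_plus_neg_powr_powser) (use assms in simp)
  also have "(\<lambda>n. (-1) ^ n * ((of_nat m + of_nat n - 1) gchoose n) * (- z) ^ n) =
      (\<lambda>n. of_nat ((n + m - 1) choose (m - 1)) * z ^ n)"
  proof
    fix n
    have "of_nat m + of_nat n - 1 = (of_nat (n + m - 1) :: complex)"
      using assms(2) by (simp add: of_nat_diff)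
    moreover have "(n + m - 1) choose n = (n + m - 1) choose (m - 1)"
      using binomial_symmetric[of n "n + m - 1"] assms(2) by simp
    ultimately show "(-1) ^ n * ((of_nat m + of_nat n - 1) gchoose n) * (- z) ^ n =
        of_nat ((n + m - 1) choose (m - 1)) * z ^ n"
      by (simp add: binomial_gbinomial[symmetric] flip: power_mult_distrib mult.assoc)
  qed
  also have "(1 + - z) powr (- of_nat m) = 1 / (1 - z) ^ m"
  proof -
    have "1 - z \<noteq> 0" using assms(1) by auto
    then show ?thesis by (simp add: powr_minus powr_nat' divide_inverse)
  qed
  finally show ?thesis .
qed

lemma has_sum_product_complex:
  fixes f :: "'a \<Rightarrow> complex" and g :: "'b \<Rightarrow> complex"
  assumes "(\<lambda>x. norm (f x)) summable_on UNIV" "(\<lambda>y. norm (g y)) summable_on UNIV"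
    "(f has_sum F) UNIV" "(g has_sum G) UNIV"
  shows "(\<lambda>(x, y). norm (f x * g y)) summable_on UNIV"
    and "((\<lambda>(x, y). f x * g y) has_sum F * G) UNIV"
proof -
  have s: "(\<lambda>(x, y). norm (f x * g y)) summable_on (SIGMA x:UNIV. UNIV)"
    by (rule summable_on_SigmaI[where g = "\<lambda>x. norm (f x) * (\<Sum>\<^sub>\<infinity>y. norm (g y))"])
       (use assms in \<open>auto intro!: summable_on_cmult_left has_sum_cmult_right simp: norm_mult\<close>)
  from s show "(\<lambda>(x, y). norm (f x * g y)) summable_on UNIV" by simp
  have "(\<lambda>(x, y). norm (f x * g y)) = (\<lambda>p. norm (case p of (x, y) \<Rightarrow> f x * g y))"
    by (auto simp: fun_eq_iff)
  with s have "(\<lambda>p. norm (case p of (x, y) \<Rightarrow> f x * g y)) summable_on (SIGMA x:UNIV. UNIV)"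
    by (simp only:)
  then have "(\<lambda>(x, y). f x * g y) summable_on (SIGMA x:UNIV. UNIV)"
    by (rule abs_summable_summable)
  then obtain S where S: "((\<lambda>(x, y). f x * g y) has_sum S) (SIGMA x:UNIV. UNIV)"
    unfolding summable_on_def by blast
  have "((\<lambda>x. f x * G) has_sum S) UNIV"
    by (rule has_sum_Sigma'[OF S]) (auto intro!: has_sum_cmult_right assms)
  moreover have "((\<lambda>x. f x * G) has_sum F * G) UNIV"
    by (intro has_sum_cmult_left assms)
  ultimately have "S = F * G" by (rule has_sum_unique)
  then show "((\<lambda>(x, y). f x * g y) has_sum F * G) UNIV" using S by simp
qed

text \<open>The norms form the same series at \<open>norm z\<close>, so absolute convergence follows
  from the series itself.\<close>

lemma negative_binomial_has_sum:
  fixes z :: complex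
  assumes "norm z < 1" "m > 0"
  shows "(\<lambda>n. norm (of_nat ((n + m - 1) choose (m - 1)) * z ^ n)) summable_on UNIV"
    and "((\<lambda>n. of_nat ((n + m - 1) choose (m - 1)) * z ^ n) has_sum 1 / (1 - z) ^ m) UNIV"
proof -
  have "summable (\<lambda>n. of_nat ((n + m - 1) choose (m - 1)) * complex_of_real (norm z) ^ n)"
    using negative_binomial_sums[of "of_real (norm z)" m] assms by (auto intro: sums_summable)
  then have "summable (\<lambda>n. complex_of_real (norm (of_nat ((n + m - 1) choose (m - 1)) * z ^ n)))"
    by (simp add: norm_mult norm_power)
  then have s: "summable (\<lambda>n. norm (of_nat ((n + m - 1) choose (m - 1)) * z ^ n))"
    unfolding summable_of_real_iff .
  then show "(\<lambda>n. norm (of_nat ((n + m - 1) choose (m - 1)) * z ^ n)) summable_on UNIV"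
    by (intro summable_nonneg_imp_summable_on) auto
  show "((\<lambda>n. of_nat ((n + m - 1) choose (m - 1)) * z ^ n) has_sum 1 / (1 - z) ^ m) UNIV"
    using s negative_binomial_sums[OF assms] by (rule norm_summable_imp_has_sum)
qed

lemma binom_poly_nat:
  assumes "m > 0"
  shows "binom_poly m (of_nat (2 * j + m)) = 2 ^ (m - 1) * fact (m - 1) * of_nat ((j + m - 1) choose (m - 1))"
proof -
  have fact: "fact (j + m - 1) = fact j * (\<Prod>i\<in>{1..<m}. of_nat (j + i) :: complex)"
    using assms
  proof (induction m rule: nat_induct_non_zero)
    case (Suc m)
    have "fact (j + Suc m - 1) = of_nat (j + m) * (fact (j + m - 1) :: complex)"
      using Suc.hyps by (cases m) (auto simp: algebra_simps)
    then show ?case using Suc by (simp add: prod.atLeastLessThan_Suc mult_ac)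
  qed simp
  have "fact (m - 1) * fact j * of_nat ((j + m - 1) choose (m - 1)) = (fact (j + m - 1) :: complex)"
  proof -
    have "fact (m - 1) * fact (j + m - 1 - (m - 1)) * ((j + m - 1) choose (m - 1)) = fact (j + m - 1)"
      by (rule binomial_fact_lemma) (use assms in auto)
    also have "j + m - 1 - (m - 1) = j" using assms by auto
    finally show ?thesis by (metis of_nat_mult of_nat_fact)
  qed
  then have "(\<Prod>i\<in>{1..<m}. of_nat (j + i) :: complex) = fact (m - 1) * of_nat ((j + m - 1) choose (m - 1))"
    unfolding fact by (simp add: mult_ac)
  moreover have "binom_poly m (of_nat (2 * j + m)) = (\<Prod>i\<in>{1..<m}. 2 * of_nat (j + i))"
    unfolding binom_poly_def by (rule prod.cong) (auto simp: algebra_simps)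
  ultimately show ?thesis
    by (simp only: prod.distrib prod_constant card_atLeastLessThan mult.assoc)
qed

section \<open>The integral\<close>

text \<open>Termwise integration by dominated convergence for series indexed by pairs, transported
  to sequences along \<open>prod_decode\<close>.\<close>

lemma integrable_sums_pairs:
  fixes f :: "nat \<times> nat \<Rightarrow> real \<Rightarrow> complex"
  assumes int: "\<And>p. set_integrable lborel A (f p)"
    and sum: "\<And>x. x \<in> A \<Longrightarrow> ((\<lambda>p. f p x) has_sum g x) UNIV" "\<And>x. x \<in> A \<Longrightarrow> (\<lambda>p. norm (f p x)) summable_on UNIV"
    and norms: "(\<lambda>p. LBINT x:A. norm (f p x)) summable_on UNIV"
    and S: "((\<lambda>p. LBINT x:A. f p x) has_sum S) UNIV"
  shows "set_integrable lborel A g" "(LBINT x:A. g x) = S"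
proof -
  define F where "F = (\<lambda>n x. indicator A x *\<^sub>R f (prod_decode n) x)"
  note bij = bij_prod_decode
  have F: "integrable lborel (F n)" for n
    using int[of "prod_decode n"] by (simp add: F_def set_integrable_def)
  have nF: "norm (F n x) = indicator A x *\<^sub>R norm (f (prod_decode n) x)" for n x
    by (simp add: F_def indicator_def)
  have 1: "AE x in lborel. summable (\<lambda>n. norm (F n x))"
  proof (rule AE_I2)
    fix x :: real
    show "summable (\<lambda>n. norm (F n x))"
    proof (cases "x \<in> A")
      case True
      have "(\<lambda>n. norm (f (prod_decode n) x)) summable_on UNIV"
        using sum(2)[OF True] by (subst summable_on_reindex_bij_betw[OF bij, where f = "\<lambda>p. norm (f p x)"])
      then show ?thesis using True by (simp add: nF summable_on_imp_summable)
    qed (simp add: nF)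
  qed
  have "(\<lambda>n. LBINT x:A. norm (f (prod_decode n) x)) summable_on UNIV"
    using norms by (subst summable_on_reindex_bij_betw[OF bij, where f = "\<lambda>p. LBINT x:A. norm (f p x)"])
  then have 2: "summable (\<lambda>n. \<integral>x. norm (F n x) \<partial>lborel)"
    by (simp add: nF set_lebesgue_integral_def summable_on_imp_summable)
  have "((\<lambda>n. LBINT x:A. f (prod_decode n) x) has_sum S) UNIV"
    using S by (subst has_sum_reindex_bij_betw[OF bij, where f = "\<lambda>p. LBINT x:A. f p x"])
  then have 3: "(\<lambda>n. integral\<^sup>L lborel (F n)) sums S"
    by (simp add: F_def set_lebesgue_integral_def has_sum_imp_sums)
  have 4: "(\<Sum>n. F n x) = indicator A x *\<^sub>R g x" for x
  proof (cases "x \<in> A")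
    case True
    have "((\<lambda>n. f (prod_decode n) x) has_sum g x) UNIV"
      using sum(1)[OF True] by (subst has_sum_reindex_bij_betw[OF bij, where f = "\<lambda>p. f p x"])
    then show ?thesis using True by (simp add: F_def has_sum_imp_sums sums_unique[symmetric])
  qed (simp add: F_def)
  show "set_integrable lborel A g"
    using integrable_suminf[OF F 1 2] by (simp add: 4 set_integrable_def)
  show "(LBINT x:A. g x) = S"
    using sums_integral[OF F 1 2] 3 by (simp add: 4 set_lebesgue_integral_def sums_unique2)
qed

context
  fixes a m :: nat
  assumes m: "m > 0"
begin

text \<open>The exponent \<open>m + (1 + \<i>) * j + (1 - \<i>) * k\<close>, written as
  \<open>(1 + \<i>) / 2\<close> times \<open>J - \<i> * K\<close> with \<open>J = 2 * j + m\<close>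
  and \<open>K = 2 * k + m\<close>, so that lattice points appear.\<close>

definition lap_exp :: "nat \<times> nat \<Rightarrow> complex" where
  "lap_exp = (\<lambda>(j, k). (1 + \<i>) / 2 * Complex (of_nat (2 * j + m)) (- of_nat (2 * k + m)))"

text \<open>The factor \<open>(-2) ^ m\<close> inverts the \<open>m\<close>-th power of the
  \<open>- (1/2)\<close> in \<open>cos_minus_cosh\<close>.\<close>

definition lap_coeff :: "nat \<times> nat \<Rightarrow> complex" where
  "lap_coeff = (\<lambda>(j, k). (-2) ^ m * (of_nat ((j + m - 1) choose (m - 1)) * of_nat ((k + m - 1) choose (m - 1))))"

lemma Re_lap_exp: "Re (lap_exp (j, k)) = real (j + k + m)"
  by (simp add: lap_exp_def field_simps)

lemma Re_lap_exp_pos: "Re (lap_exp p) > 0"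
  using m by (cases p) (simp add: Re_lap_exp)

lemma cos_minus_cosh:
  fixes x :: real
  defines "u \<equiv> exp (- ((1 + \<i>) * of_real x))"
  shows "complex_of_real (cos x - cosh x) = - (1/2) * exp (of_real x) * ((1 - u) * (1 - cnj u))"
proof -
  have u: "u = of_real (exp (- x)) * cis (- x)"
    by (simp add: u_def cis_conv_exp exp_of_real[symmetric] algebra_simps flip: exp_add)
  have "(1 - u) * (1 - cnj u) = of_real (1 - 2 * exp (- x) * cos x + exp (- x) ^ 2)"
  proof -
    have "u * cnj u = of_real (exp (- x) ^ 2)"
      unfolding complex_norm_square[symmetric] by (simp add: u norm_mult)
    moreover have "u + cnj u = of_real (2 * exp (- x) * cos x)"
      by (simp add: u complex_eq_iff)
    moreover have "(1 - u) * (1 - cnj u) = 1 - (u + cnj u) + u * cnj u" by (simp add: algebra_simps)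
    ultimately show ?thesis by simp
  qed
  moreover have "cos x - cosh x = - (1/2) * exp x * (1 - 2 * exp (- x) * cos x + exp (- x) ^ 2)"
    by (simp add: cosh_def exp_minus field_simps power2_eq_square)
  ultimately show ?thesis
    by (simp only: exp_of_real of_real_mult[symmetric]) simp
qed

lemma integrand_expansion:
  assumes x: "x > 0"
  shows "((\<lambda>p. lap_coeff p * (of_real x ^ a * exp (- (lap_exp p * of_real x)))) has_sum
      of_real (x ^ a / (cos x - cosh x) ^ m)) UNIV" (is "(?f has_sum _) _")
    and "(\<lambda>p. norm (lap_coeff p * (of_real x ^ a * exp (- (lap_exp p * of_real x))))) summable_on UNIV"
proof -
  define u where "u = exp (- ((1 + \<i>) * of_real x))"
  define K where "K = (-2) ^ m * of_real x ^ a * exp (- (of_nat m * of_real x :: complex))"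
  let ?c = "\<lambda>z n. of_nat ((n + m - 1) choose (m - 1)) * z ^ n :: complex"
  have u: "norm u < 1" "norm (cnj u) < 1" using x by (simp_all add: u_def)
  have cu: "cnj u = exp (- ((1 - \<i>) * of_real x))" by (simp add: u_def exp_cnj)
  have f: "?f = (\<lambda>p. K * (case p of (j, k) \<Rightarrow> ?c u j * ?c (cnj u) k))"
  proof
    fix p :: "nat \<times> nat"
    obtain j k where p: "p = (j, k)" by (cases p)
    have "exp (- (lap_exp p * of_real x)) = exp (- (of_nat m * of_real x)) * u ^ j * cnj u ^ k"
      unfolding cu unfolding u_def unfolding exp_of_nat_mult[symmetric] exp_add[symmetric]
      by (rule arg_cong[where f = exp]) (simp add: lap_exp_def p complex_eq_iff field_simps)
    then show "?f p = K * (case p of (j, k) \<Rightarrow> ?c u j * ?c (cnj u) k)"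
      by (simp add: p lap_coeff_def K_def)
  qed
  note prod = has_sum_product_complex[OF negative_binomial_has_sum(1)[OF u(1) m] negative_binomial_has_sum(1)[OF u(2) m]
      negative_binomial_has_sum(2)[OF u(1) m] negative_binomial_has_sum(2)[OF u(2) m]]
  have "(?f has_sum K * (1 / (1 - u) ^ m * (1 / (1 - cnj u) ^ m))) UNIV"
    unfolding f by (rule has_sum_cmult_right[OF prod(2)])
  also have "K * (1 / (1 - u) ^ m * (1 / (1 - cnj u) ^ m)) = of_real (x ^ a / (cos x - cosh x) ^ m)"
  proof -
    have "1 - u \<noteq> 0" "1 - cnj u \<noteq> 0" using u by auto
    have "of_real (x ^ a / (cos x - cosh x) ^ m) =
        of_real x ^ a / (- (1/2) * exp (of_real x) * ((1 - u) * (1 - cnj u))) ^ m"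
      by (simp only: of_real_divide of_real_power cos_minus_cosh u_def)
    also have "\<dots> = K * (1 / (1 - u) ^ m * (1 / (1 - cnj u) ^ m))"
    proof -
      have "(- (1/2) * exp (of_real x) :: complex) ^ m * ((-2) ^ m * exp (- (of_nat m * of_real x))) = 1"
      proof -
        have "exp (- (of_nat m * of_real x)) = exp (- of_real x :: complex) ^ m"
          by (simp flip: exp_of_nat_mult)
        then show ?thesis
          by (simp add: exp_minus flip: power_mult_distrib)
      qed
      then have "K = of_real x ^ a / (- (1/2) * exp (of_real x)) ^ m"
        unfolding K_def by (simp add: field_simps)
      then show ?thesis by (simp only: power_mult_distrib) simp
    qed
    finally show ?thesis ..
  qed
  finally show "(?f has_sum of_real (x ^ a / (cos x - cosh x) ^ m)) UNIV" .
  have "(\<lambda>p. norm K * (case p of (j, k) \<Rightarrow> norm (?c u j * ?c (cnj u) k))) summable_on UNIV"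
    by (rule summable_on_cmult_right[OF prod(1)])
  moreover have "norm (?f p) = norm K * (case p of (j, k) \<Rightarrow> norm (?c u j * ?c (cnj u) k))" for p
    unfolding fun_cong[OF f] by (cases p) (simp only: norm_mult prod.case)
  ultimately show "(\<lambda>p. norm (?f p)) summable_on UNIV"
    by (simp only:)
qed

lemma norm_lap_integral:
  "(LBINT x:{0<..}. norm (lap_coeff p * (of_real x ^ a * exp (- (lap_exp p * of_real x))))) =
     norm (lap_coeff p) * (fact a / Re (lap_exp p) ^ Suc a)"
proof -
  let ?r = "Re (lap_exp p)"
  have "(LBINT x:{0<..}. norm (lap_coeff p * (of_real x ^ a * exp (- (lap_exp p * of_real x))))) =
      (LBINT x:{0<..}. norm (lap_coeff p) * (x ^ a * exp (- (?r * x))))"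
    by (rule set_lebesgue_integral_cong) (auto simp: norm_mult norm_power)
  also have "\<dots> = norm (lap_coeff p) * (LBINT x:{0<..}. x ^ a * exp (- (?r * x)))"
    by (rule set_integral_mult_right)
  also have "(LBINT x:{0<..}. x ^ a * exp (- (?r * x))) = fact a / ?r ^ Suc a"
  proof -
    have "complex_of_real (LBINT x:{0<..}. x ^ a * exp (- (?r * x))) =
        (LBINT x:{0<..}. complex_of_real (x ^ a * exp (- (?r * x))))"
      by (rule set_integral_complex_of_real[symmetric])
    also have "\<dots> = (LBINT x:{0<..}. of_real x ^ a * exp (- (of_real ?r * of_real x)))"
      by (simp only: of_real_mult of_real_power of_real_minus exp_of_real[symmetric])
    also have "\<dots> = fact a / of_real ?r ^ Suc a"
      by (rule laplace_power(2)) (use Re_lap_exp_pos in simp)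
    also have "\<dots> = of_real (fact a / ?r ^ Suc a)" by simp
    finally show ?thesis by (simp only: of_real_eq_iff)
  qed
  finally show ?thesis .
qed

text \<open>All factors in front of the lattice term lie in \<open>gauss_rat\<close>; they are
  written with \<open>inverse\<close> so that its closure rules apply directly.\<close>

lemma lap_term_eq:
  "lap_coeff (j, k) * (fact a / lap_exp (j, k) ^ Suc a) =
     (-2) ^ m * fact a * inverse (2 ^ (m - 1) * fact (m - 1)) ^ 2 * inverse ((1 + \<i>) * inverse 2) ^ Suc a *
     (binom_poly m (of_nat (2 * j + m)) * binom_poly m (of_nat (2 * k + m)) /
      Complex (of_nat (2 * j + m)) (- of_nat (2 * k + m)) ^ Suc a)"
proof -
  define D :: complex where "D = 2 ^ (m - 1) * fact (m - 1)"
  have "D \<noteq> 0" by (simp add: D_def)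
  have c: "of_nat ((j + m - 1) choose (m - 1)) = inverse D * binom_poly m (of_nat (2 * j + m))" for j
    unfolding binom_poly_nat[OF m] D_def[symmetric] using \<open>D \<noteq> 0\<close> by (simp only: mult.assoc[symmetric] left_inverse) simp
  have "P * ((d * x) * (d * y)) * (q / (v * w) ^ n) = P * q * d ^ 2 * inverse v ^ n * (x * y / w ^ n)"
    for P d x y q v w :: complex and n
    by (simp add: power_mult_distrib power2_eq_square divide_inverse power_inverse mult_ac)
  moreover have "(1 + \<i>) / 2 = (1 + \<i>) * inverse 2" by (rule divide_inverse)
  ultimately show ?thesis
    unfolding lap_coeff_def lap_exp_def prod.case c D_def[symmetric] by (simp only:)
qed

end

theorem berndt_integral:
  fixes a m :: nat and B :: "(nat \<times> nat) set"
  assumes m: "m > 0" and n: "Suc a \<ge> 2 * m + 2" "Suc a mod 4 = (2 * m + 2) mod 4"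
    and B: "\<And>s t. s + t \<le> 2 * (m - 1) \<Longrightarrow> 4 dvd (t + (Suc a - s)) \<Longrightarrow>
      ((t + (Suc a - s)) div 2, t + (t + (Suc a - s)) div 2) \<in> B"
  shows "set_integrable lborel {0<..} (\<lambda>x::real. x ^ a / (cos x - cosh x) ^ m)"
    and "(LBINT x:{0<..}. x ^ a / (cos x - cosh x) ^ m) \<in> poly_span B (Gamma (1/4) ^ 4) (inverse pi)"
proof -
  let ?V = "poly_span_complex B (Gamma (1/4) ^ 4) (inverse pi)"
  let ?f = "\<lambda>p x. lap_coeff m p * (of_real x ^ a * exp (- (lap_exp m p * of_real x)))"
  let ?q = "\<lambda>(j, k). binom_poly m (of_nat (2 * j + m)) * binom_poly m (of_nat (2 * k + m)) /
     Complex (of_nat (2 * j + m)) (- of_nat (2 * k + m)) ^ Suc a"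
  define K :: complex where "K = (-2) ^ m * fact a * inverse (2 ^ (m - 1) * fact (m - 1)) ^ 2 * inverse ((1 + \<i>) * inverse 2) ^ Suc a"
  have fact: "fact i \<in> gauss_rat" for i
    using gauss_rat_closed(9)[of "fact i"] by simp
  have K: "K \<in> gauss_rat"
    unfolding K_def by (intro gauss_rat_power gauss_rat_inverse gauss_rat_closed fact)
  obtain S where S: "S \<in> ?V" "(?q has_sum S) UNIV"
    using quadrant_nat_sum[OF m n B] by blast
  have eq: "lap_coeff m p * (fact a / lap_exp m p ^ Suc a) = K * ?q p" for p
    unfolding K_def using lap_term_eq[OF m] by (cases p) (simp only: prod.case)
  have int: "set_integrable lborel {0<..} (?f p)" for p
    by (intro set_integrable_mult_right laplace_power Re_lap_exp_pos m)
  have val: "(LBINT x:{0<..}. ?f p x) = K * ?q p" for p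
    unfolding eq[symmetric] by (subst set_integral_mult_right) (simp only: laplace_power(2)[OF Re_lap_exp_pos[OF m]])
  have sumS: "((\<lambda>p. LBINT x:{0<..}. ?f p x) has_sum K * S) UNIV"
    unfolding val by (rule has_sum_cmult_right[OF S(2)])
  have "(\<lambda>p. LBINT x:{0<..}. norm (?f p x)) summable_on UNIV"
  proof (rule summable_on_comparison_test)
    \<comment> \<open>The quadrant sum supplies the majorant: for complex families summability is
      absolute.\<close>
    have "(\<lambda>p. norm (lap_coeff m p * (fact a / lap_exp m p ^ Suc a))) summable_on UNIV"
      unfolding eq using has_sum_cmult_right[OF S(2), of K, THEN has_sum_imp_summable]
      by (subst (asm) summable_on_iff_abs_summable_on_complex)
    then show "(\<lambda>p. 2 ^ Suc a * norm (lap_coeff m p * (fact a / lap_exp m p ^ Suc a))) summable_on UNIV"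
      by (rule summable_on_cmult_right)
    fix p :: "nat \<times> nat"
    obtain j k where p: "p = (j, k)" by (cases p)
    have pos: "Re (lap_exp m p) > 0" by (rule Re_lap_exp_pos[OF m])
    \<comment> \<open>The integrals of the norms involve the real part of the exponent, not its
      norm. As \<open>\<bar>j - k\<bar> \<le> j + k + m\<close>, the norm is at most twice the real
      part, whence the factor \<open>2 ^ Suc a\<close>.\<close>
    have "norm (lap_exp m p) \<le> \<bar>Re (lap_exp m p)\<bar> + \<bar>Im (lap_exp m p)\<bar>" by (rule cmod_le)
    also have "Im (lap_exp m p) = real j - real k" by (simp add: p lap_exp_def[OF m] field_simps)
    also have "\<bar>Re (lap_exp m p)\<bar> + \<bar>real j - real k\<bar> \<le> 2 * Re (lap_exp m p)"
      by (simp add: p Re_lap_exp[OF m])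
    finally have "norm (lap_exp m p) ^ Suc a \<le> (2 * Re (lap_exp m p)) ^ Suc a"
      by (rule power_mono) simp
    moreover have "norm (lap_exp m p) > 0" using pos by auto
    ultimately have "1 / Re (lap_exp m p) ^ Suc a \<le> 2 ^ Suc a * (1 / norm (lap_exp m p) ^ Suc a)"
      using pos by (simp add: field_simps power_mult_distrib del: power_Suc)
    then have "norm (lap_coeff m p) * fact a * (1 / Re (lap_exp m p) ^ Suc a) \<le>
        norm (lap_coeff m p) * fact a * (2 ^ Suc a * (1 / norm (lap_exp m p) ^ Suc a))"
      by (rule mult_left_mono) simp
    then show "(LBINT x:{0<..}. norm (?f p x)) \<le> 2 ^ Suc a * norm (lap_coeff m p * (fact a / lap_exp m p ^ Suc a))"
      unfolding norm_lap_integral[OF m] by (simp add: norm_mult norm_divide norm_power mult_ac)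
    show "0 \<le> (LBINT x:{0<..}. norm (?f p x))"
      unfolding norm_lap_integral[OF m] using pos by simp
  qed
  note res = integrable_sums_pairs[OF int integrand_expansion(1)[OF m] integrand_expansion(2)[OF m] this sumS, simplified]
  have ci: "set_integrable lborel {0<..} (\<lambda>x. complex_of_real (x ^ a / (cos x - cosh x) ^ m))"
    using res(1) by simp
  have "integrable lborel (\<lambda>x. Re (indicator {0<..} x *\<^sub>R complex_of_real (x ^ a / (cos x - cosh x) ^ m)))"
    using ci unfolding set_integrable_def by (rule integrable_Re)
  then show "set_integrable lborel {0<..} (\<lambda>x::real. x ^ a / (cos x - cosh x) ^ m)"
    unfolding set_integrable_def by simp
  have "complex_of_real (LBINT x:{0<..}. x ^ a / (cos x - cosh x) ^ m) =
      (LBINT x:{0<..}. complex_of_real (x ^ a / (cos x - cosh x) ^ m))"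
    by (rule set_integral_complex_of_real[symmetric])
  also have "\<dots> = K * S" using res(2) by simp
  finally have "complex_of_real (LBINT x:{0<..}. x ^ a / (cos x - cosh x) ^ m) \<in> ?V"
    using poly_span_complex_cmult[OF K S(1)] by simp
  then show "(LBINT x:{0<..}. x ^ a / (cos x - cosh x) ^ m) \<in> poly_span B (Gamma (1/4) ^ 4) (inverse pi)"
    by (simp add: poly_span_complex_def)
qed

theorem theorem1p2:
  fixes a m :: nat and X Y :: real and f :: "real \<Rightarrow> real"
  defines "X \<equiv> Gamma (1 / 4) ^ 4"
    and "Y \<equiv> inverse pi"
    and "f \<equiv> (\<lambda>x. x ^ a / (cos x - cosh x) ^ m)"
  assumes "a > 0" and "m > 0"
    and "int a - 2 * int m > 0"
    and "(int a - 2 * int m) mod 4 = 1"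
  shows "interval_lebesgue_integrable lborel 0 \<infinity> f \<and>
    (LBINT x=0..\<infinity>. f x) \<in> rat_poly_ring2 X Y \<and>
    (\<exists>(S :: (nat \<times> nat) set) (c :: nat \<Rightarrow> nat \<Rightarrow> rat).
       finite S \<and>
       (\<forall>(\<alpha>, \<beta>)\<in>S.
          even \<alpha> \<and>
          (real a + 3) / 2 - real m \<le> real \<alpha> \<and> real \<alpha> \<le> (real a - 1) / 2 + real m \<and>
          (real a + 3) / 2 - real m \<le> real \<beta> \<and> real \<beta> \<le> (real a - 5) / 2 + 3 * real m) \<and>
       (LBINT x=0..\<infinity>. f x) = (\<Sum>(\<alpha>, \<beta>)\<in>S. of_rat (c \<alpha> \<beta>) * X ^ \<alpha> * Y ^ \<beta>))"
proof -
  define B :: "(nat \<times> nat) set" where "B = {(\<alpha>, \<beta>). even \<alpha> \<and>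
    (real a + 3) / 2 - real m \<le> real \<alpha> \<and> real \<alpha> \<le> (real a - 1) / 2 + real m \<and>
    (real a + 3) / 2 - real m \<le> real \<beta> \<and> real \<beta> \<le> (real a - 5) / 2 + 3 * real m}"
  have n: "Suc a \<ge> 2 * m + 2" "Suc a mod 4 = (2 * m + 2) mod 4"
    using assms(6,7) by presburger+
  have B: "((t + (Suc a - s)) div 2, t + (t + (Suc a - s)) div 2) \<in> B"
    if st: "s + t \<le> 2 * (m - 1)" "4 dvd (t + (Suc a - s))" for s t
  proof -
    obtain k where k: "t + (Suc a - s) = 4 * k" using st(2) by (rule dvdE)
    \<comment> \<open>The exponents are \<open>2 * k = (a + 1 + t - s) / 2\<close> and
      \<open>(a + 1 + 3 * t - s) / 2\<close>; with \<open>s, t \<ge> 0\<close> and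
      \<open>s + t \<le> 2 * m - 2\<close> their extremes are attained at \<open>t = 0\<close> or
      \<open>s = 0\<close>.\<close>
    have "real t + (real a + 1 - real s) = 4 * real k"
      using arg_cong[OF k, of real] st n by (simp add: of_nat_diff)
    moreover have "real s + real t \<le> 2 * real m - 2"
      using st(1) \<open>m > 0\<close> by linarith
    ultimately show ?thesis
      unfolding k B_def by (simp add: field_simps)
  qed
  have int: "(LBINT x=0..\<infinity>. f x) = (LBINT x:{0<..}. f x)"
    by (simp add: interval_lebesgue_integral_def einterval_0_inf)
  have "(LBINT x=0..\<infinity>. f x) \<in> poly_span B X Y"
    unfolding int unfolding f_def X_def Y_def by (rule berndt_integral(2)[OF \<open>m > 0\<close> n B])
  then obtain S c where S: "finite S" "S \<subseteq> B"
    "(LBINT x=0..\<infinity>. f x) = (\<Sum>(\<alpha>, \<beta>)\<in>S. of_rat (c \<alpha> \<beta>) * X ^ \<alpha> * Y ^ \<beta>)"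
    unfolding poly_span_def by blast
  have "interval_lebesgue_integrable lborel 0 \<infinity> f"
    using berndt_integral(1)[OF \<open>m > 0\<close> n B]
    by (simp add: interval_lebesgue_integrable_def einterval_0_inf f_def)
  moreover have "(LBINT x=0..\<infinity>. f x) \<in> rat_poly_ring2 X Y"
    unfolding S(3) rat_poly_ring2_def using S(1) by blast
  ultimately show ?thesis
    using S unfolding B_def by (intro conjI exI[of _ S] exI[of _ c]) auto
qed

end
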